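(* Let $n\ge1$, let $(P,Q)\in\bigsqcup_{\rho,\lambda\in\mathbb S}\mathrm{SST}(\lambda/\rho,n)^2$ and let $(P',Q')=\mathbf{cRSK}(P,Q)$. If $\Upsilon_{\mathrm{col}}(P,Q)=(H_1,H_2,\kappa,\nu)$ with $H_1,H_2$ of shape $\mu$, then $$\Upsilon_{\mathrm{col}}(P',Q')=(H_1,H_2,\kappa+\mu,\nu).$$
   Context: NOTATION. $\mathbb N=\{0,1,\dots\}$. A signature of length $\ell\ge0$ is a sequence of integers $\lambda=(\lambda_1\ge\dots\ge\lambda_\ell)$; $\mathbb S_\ell$ is the set of these, $\mathbb S=\bigsqcup_{\ell\ge0}\mathbb S_\ell$. $\mathbb Y$ is the set of partitions; for $\mu\in\mathbb Y$, $\ell(\mu)$ is the number of positive parts. Conjugate: $\lambda'_x=\#\{j:\lambda_j\ge x\}$, $x\in\mathbb Z$. $\kappa\preceq\mu$ (same length) means $\mu_1\ge\kappa_1\ge\mu_2\ge\kappa_2\ge\cdots$, equivalently $\mu'_x-\kappa'_x\in\{0,1\}$ for all $x$. $\mathcal K(\mu)=\{\kappa\in\mathbb Z^{\ell(\mu)}:\kappa_i\ge\kappa_{i+1}\text{ if }\mu_i=\mu_{i+1}\}$. FOMIN FIELDS. For $\kappa\preceq\mu$, $\kappa\preceq\lambda$ in $\mathbb S_\ell$ put $a_x=\mu'_x-\kappa'_x$, $b_x=\lambda'_x-\kappa'_x$, $c_x=\max\{0,a_x+b_x+c_{x-1}-1\}$ with $c_x=0$ for $x\ll0$; $\overline{\mathsf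 F}(\kappa,\mu,\lambda)=\nu\in\mathbb S_\ell$ is given by $\nu'_x=\mu'_x+\lambda'_x-\kappa'_x+c_{x-1}-c_x$. $\mathscr C_n=\mathbb Z^2/\sim$, $(x,y)\sim(x+kn,y-kn)$, $k\in\mathbb Z$. A Fomin field is a map $\boldsymbol\lambda:\mathscr C_n\to\mathbb S_\ell$ with $\boldsymbol\lambda(p)\preceq\boldsymbol\lambda(p+\mathbf e_i)$ ($i=1,2$) and $\boldsymbol\lambda(p+\mathbf e_1+\mathbf e_2)=\overline{\mathsf F}(\boldsymbol\lambda(p),\boldsymbol\lambda(p+\mathbf e_1),\boldsymbol\lambda(p+\mathbf e_2))$. TABLEAUX. For $\rho,\lambda$ of the same length, $P\in\mathrm{SST}(\lambda/\rho,n)$ is a chain $\rho=\lambda^{(0)}\preceq\lambda^{(1)}\preceq\dots\preceq\lambda^{(n)}=\lambda$; equivalently a filling where cells $(j,k)$ (row $j$, column $k$) with $\lambda^{(i-1)}_j<k\le\lambda^{(i)}_j$ have label $i$. For $P=(\lambda^{(i)})_i$, $Q=(\mu^{(i)})_i$ in $\mathrm{SST}(\lambda/\rho,n)$, $\boldsymbol\lambda[P,Q]$ is the unique Fomin field on $\mathscr C_n$ with $\boldsymbol\lambda(i,0)=\lambda^{(i)}$, $\boldsymbol\lambda(0,i)=\mu^{(i)}$, $0\le i\le n$. With $\boldsymbol\lambda=\boldsymbol\lambda[P,Q]$ define the invertible maps $\mathbf{cRSK}(P,Q)=\big((\boldsymbol\lambda(n+i,0))_{i=0}^n,(\boldsymbol\lambda(n,i))_{i=0}^n\big)$,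 $\iota_1(P,Q)=\big((\boldsymbol\lambda(1+i,0))_{i=0}^n,(\boldsymbol\lambda(1,i))_{i=0}^n\big)$, $\iota_2(P,Q)=\big((\boldsymbol\lambda(i,1))_{i=0}^n,(\boldsymbol\lambda(0,1+i))_{i=0}^n\big)$. For $\mu\in\mathbb N^\ell$, $\mathrm{HWT}(\mu,n)$ is the set of fillings by $\{1,\dots,n\}$ of left-justified rows of lengths $\mu_1,\dots,\mu_\ell$, weakly increasing along rows, no column condition. Soliton data: $\Phi(P,Q)=(H_1,H_2)$, where row $j$ of $H_1$ has $\lim_{t\to\infty}(\boldsymbol\lambda_j(i,t)-\boldsymbol\lambda_j(i-1,t))$ entries $i$, and row $j$ of $H_2$ has $\lim_{t\to\infty}(\boldsymbol\lambda_j(t,i)-\boldsymbol\lambda_j(t,i-1))$ entries $i$ ($1\le i\le n$); $H_1,H_2$ have a common shape $\mu\in\mathbb Y$. KASHIWARA OPERATORS ON HWT. Write $H\in\mathrm{HWT}(\mu,n)$ as $h_\ell\otimes\cdots\otimes h_1$ with $h_j$ the $j$-th row. For $1\le i\le n-1$ take the word $w=h_\ell\cdots h_1$, replace each $i$ by ")" and each $i+1$ by "(", ignore other letters, and delete successively adjacent pairs "(" ")" until the remaining string is $)\cdots)(\cdots($. $e_i(H)$ changes the $i+1$ of the leftmost remaining "(" into $i$ ($e_i(H)=\mathbf 0$ if none); $f_i(H)$ changes the $i$ of the rightmost remaining ")" into $i+1$ ($\mathbf 0$ if none). For $i=0$ use the word obtained by reversing each $h_j$ before concatenating, with $n$ as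 ")" and $1$ as "("; $e_0$ changes a $1$ into $n$, $f_0$ changes an $n$ into $1$ by the same rule; rows are re-sorted. COMBINATORIAL $R$, ENERGY. For rows $a,b$ of lengths $K\le L$: place the letters of $a$ as dots in a right column of boxes $1,\dots,n$ (top to bottom), those of $b$ in a left column. Pair each right dot (any order) with the lowest unpaired left dot in a strictly higher box; if none exists, with the lowest unpaired left dot (a winding pair). Move the unpaired left dots to the same boxes of the right column; the right column is now $b'$, the left $a'$; $\mathcal R(a\otimes b)=b'\otimes a'$, $W(a\otimes b)$ = number of winding pairs. For $K>L$, $\mathcal R$ is the inverse of this map and $W(a\otimes b)=W(\mathcal R(a\otimes b))$. $\sigma_i$ applies $\mathcal R$ to the factors $h_{i+1}\otimes h_i$; $W_i(H)=W(h_{i+1}\otimes h_i)$. Energy $D(H)=\sum_{1\le i<j\le\ell}W_i(\sigma_{i+1}\sigma_{i+2}\cdots\sigma_{j-1}(H))$. Let $\sigma^-=(\sigma_1\cdots\sigma_{\ell-1})\cdots(\sigma_1\sigma_2)(\sigma_1)$; $\eta(H)$ is obtained from $\sigma^-(H)$ by reversing the order of the tensor factors and replacing each entry $j$ by $n+1-j$ (re-sorting rows). Dual energy $D'(H)=D(\eta(H))$. LEADING PATHS. Let $\ell(\mu)\le n$; $H_{\max}\in\mathrm{HWT}(\mu,n)$ has all entries $1$. The classical component of $H$ is its connected component under $e_i,f_i$, $1\le i\le n-1$; it contains a unique $H_{\mathrm{lw}}$ killed by all $f_i$, $1\le i\le n-1$; $\underline{H_{\mathrm{lw}}}$ is obtained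 by subtracting $\min(H_{\mathrm{lw}})-1$ from all entries, and lies in the same classical component. The leading path $\mathcal L_H$ is the composition of Kashiwara operators with $\mathcal L_H(H)=H_{\max}$ defined recursively: if $D'(H)=D'(H_{\max})$, it is a composition of $e_1,\dots,e_{n-1}$ taking $H$ to $H_{\max}$; otherwise $\mathcal L_H=\mathcal L_{H'}\circ e_0\circ\mathcal G_H$, where $\mathcal G_H$ is a composition of $e_i,f_i$ ($1\le i\le n-1$) taking $H$ to $\underline{H_{\mathrm{lw}}}$ and $H'=e_0(\underline{H_{\mathrm{lw}}})$. (For $n=1$ the path is empty.) OPERATORS ON PAIRS. For skew $P$, $e_i(P),f_i(P)$ ($1\le i\le n-1$) are given by the same signature rule applied to the row reading word (rows concatenated from bottom to top). On pairs: $E^{(1)}_i=e_i\times\mathbf 1$, $F^{(1)}_i=f_i\times\mathbf 1$, $E^{(2)}_i=\mathbf 1\times e_i$, $F^{(2)}_i=\mathbf 1\times f_i$ for $1\le i\le n-1$, and $E^{(k)}_0=\iota_k\circ E^{(k)}_1\circ\iota_k^{-1}$, $F^{(k)}_0=\iota_k\circ F^{(k)}_1\circ\iota_k^{-1}$. If $\Phi(P,Q)=(H_1,H_2)$, $\mathcal L_{P,Q}$ is the composition on pairs obtained from $\mathcal L_{H_1}$ (with $e_i,f_i$ replaced by $E_i^{(1)},F_i^{(1)}$) followed by $\mathcal L_{H_2}$ (with $E_i^{(2)},F_i^{(2)}$). KKR. A box-ball state is a finitely supported $B=(b_x)_{x\in\mathbb Z}\in\{0,1\}^{\mathbb Z}$.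 $\mathrm{KKR}(B)=(\mu,J)$, $J\in\mathcal K(\mu)$, is computed by scanning sites $k$ from the leftmost to the rightmost ball, starting with the empty pair. Vacancy numbers: $p^{[k]}_i=k-2\sum_j\min(\mu^{[k]}_j,i)$; string $s$ of $(\mu^{[k]},J^{[k]})$ is singular if $J^{[k]}_s=p^{[k]}_{\mu^{[k]}_s}$; a singular string of length $0$ is always available. If $b_k=0$, $(\mu^{[k]},J^{[k]})=(\mu^{[k-1]},J^{[k-1]})$; if $b_k=1$, take a longest singular string of $(\mu^{[k-1]},J^{[k-1]})$, increase its length by one and set its rigging to the vacancy number of its new length with respect to $\mu^{[k]}$ and $k$; other riggings are unchanged. Riggings of equal rows are listed in weakly decreasing order. THE MAP $\Upsilon_{\mathrm{col}}$. Given $(P,Q)$, let $(H_1,H_2)=\Phi(P,Q)$ of shape $\mu$, $n'=\max\{\ell(\mu),n\}$, and regard all tableaux as having entries in $\{1,\dots,n'\}$. Then $\mathcal L_{P,Q}(P,Q)=(T,T)$ (computed with alphabet $n'$), where $T=(\bar\rho\preceq\bar\lambda)$ has all labels $1$. Put $B=\bar\lambda'-\bar\rho'$, a box-ball state; let $\nu$ be the signature obtained from the multiset of entries of $\bar\rho$ by removing once each $j$ with $(b_j,b_{j+1})=(0,1)$; let $J$ be the rigging of $\mathrm{KKR}(B)=(\mu,J)$ and $\kappa=J+\mu$. Set $\Upsilon_{\mathrm{col}}(P,Q)=(H_1,H_2,\kappa,\nu)$. *)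

theory Defs
  imports
    Complex_Main
    "HOL-Library.Multiset"
    "HOL-Library.Product_Lexorder"
    "HOL-Library.Monad_Syntax"
begin

text \<open>
  A signature, and more generally a vector indexed by rows, is a list; the entry with index
  \<open>j\<close> in the mathematical text is the list entry at position \<open>j - 1\<close>.
\<close>

definition signatures :: "nat \<Rightarrow> int list set" where
  "signatures l = {lam. length lam = l \<and> sorted_wrt (\<ge>) lam}"

definition conjugate :: "int list \<Rightarrow> int \<Rightarrow> int" where
  "conjugate lam x = int (card {j. j < length lam \<and> x \<le> lam ! j})"

definition hstrip :: "int list \<Rightarrow> int list \<Rightarrow> bool" (infix "\<preceq>\<^sub>h" 50) where
  "kap \<preceq>\<^sub>h mu \<longleftrightarrow> length kap = length mu
     \<and> (\<forall>j < length mu. kap ! j \<le> mu ! j)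
     \<and> (\<forall>j. Suc j < length mu \<longrightarrow> mu ! Suc j \<le> kap ! j)"

definition fomin_carry :: "int list \<Rightarrow> int list \<Rightarrow> int list \<Rightarrow> int \<Rightarrow> int" where
  "fomin_carry kap mu lam = (THE c.
     (\<forall>x. c x = max 0 ((conjugate mu x - conjugate kap x) + (conjugate lam x - conjugate kap x)
                        + c (x - 1) - 1))
     \<and> (\<forall>\<^sub>F x in at_bot. c x = 0))"

definition fomin_rule :: "int list \<Rightarrow> int list \<Rightarrow> int list \<Rightarrow> int list" where
  "fomin_rule kap mu lam = (THE nu. nu \<in> signatures (length kap) \<and>
     (\<forall>x. conjugate nu x = conjugate mu x + conjugate lam x - conjugate kap x
            + fomin_carry kap mu lam (x - 1) - fomin_carry kap mu lam x))"

text \<open>A map on the cylinder of circumference \<open>n\<close> is a map on pairs of integers that is invariant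
  under translation by \<open>(k n, - k n)\<close>.\<close>

definition fomin_field :: "nat \<Rightarrow> nat \<Rightarrow> (int \<Rightarrow> int \<Rightarrow> int list) \<Rightarrow> bool" where
  "fomin_field n l F \<longleftrightarrow>
     (\<forall>x y k. F (x + k * int n) (y - k * int n) = F x y) \<and>
     (\<forall>x y. F x y \<in> signatures l) \<and>
     (\<forall>x y. F x y \<preceq>\<^sub>h F (x + 1) y \<and> F x y \<preceq>\<^sub>h F x (y + 1)) \<and>
     (\<forall>x y. F (x + 1) (y + 1) = fomin_rule (F x y) (F (x + 1) y) (F x (y + 1)))"

text \<open>A tableau is given by its chain of \<open>n + 1\<close> signatures.\<close>

type_synonym tableau = "int list list"

definition SST :: "int list \<Rightarrow> int list \<Rightarrow> nat \<Rightarrow> tableau set" where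
  "SST lam rho n = {P. length P = Suc n \<and> P ! 0 = rho \<and> P ! n = lam
                        \<and> (\<forall>i<n. P ! i \<preceq>\<^sub>h P ! Suc i)}"

definition SST_pairs :: "nat \<Rightarrow> (tableau \<times> tableau) set" where
  "SST_pairs n = (\<Union>l. \<Union>rho \<in> signatures l. \<Union>lam \<in> signatures l. SST lam rho n \<times> SST lam rho n)"

definition field_of :: "nat \<Rightarrow> tableau \<times> tableau \<Rightarrow> int \<Rightarrow> int \<Rightarrow> int list" where
  "field_of n = (\<lambda>(P, Q). THE F. fomin_field n (length (P ! 0)) F
       \<and> (\<forall>i\<le>n. F (int i) 0 = P ! i \<and> F 0 (int i) = Q ! i))"

definition cRSK :: "nat \<Rightarrow> tableau \<times> tableau \<Rightarrow> tableau \<times> tableau" where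
  "cRSK n PQ = (let F = field_of n PQ in
     (map (\<lambda>i. F (int n + int i) 0) [0..<Suc n], map (\<lambda>i. F (int n) (int i)) [0..<Suc n]))"

definition iota1 :: "nat \<Rightarrow> tableau \<times> tableau \<Rightarrow> tableau \<times> tableau" where
  "iota1 n PQ = (let F = field_of n PQ in
     (map (\<lambda>i. F (1 + int i) 0) [0..<Suc n], map (\<lambda>i. F 1 (int i)) [0..<Suc n]))"

definition iota2 :: "nat \<Rightarrow> tableau \<times> tableau \<Rightarrow> tableau \<times> tableau" where
  "iota2 n PQ = (let F = field_of n PQ in
     (map (\<lambda>i. F (int i) 1) [0..<Suc n], map (\<lambda>i. F 0 (1 + int i)) [0..<Suc n]))"

text \<open>The tableau \<open>h\<^sub>l \<otimes> \<dots> \<otimes> h\<^sub>1\<close> is the list \<open>[h\<^sub>1, \<dots>, h\<^sub>l]\<close> of its rows, first row first.\<close>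

type_synonym hwt = "nat list list"

definition HWT :: "nat list \<Rightarrow> nat \<Rightarrow> hwt set" where
  "HWT mu n = {H. map length H = mu \<and> (\<forall>r \<in> set H. sorted r \<and> set r \<subseteq> {1..n})}"

definition row_of_content :: "nat \<Rightarrow> (nat \<Rightarrow> nat) \<Rightarrow> nat list" where
  "row_of_content n m = concat (map (\<lambda>i. replicate (m i) i) [1..<Suc n])"

text \<open>Empty rows are dropped, so that the number of rows is the number of positive parts of the
  common shape.\<close>

definition soliton_data :: "nat \<Rightarrow> tableau \<times> tableau \<Rightarrow> hwt \<times> hwt" where
  "soliton_data n PQ = (let F = field_of n PQ; l = length (fst PQ ! 0) in
     (filter (\<lambda>r. r \<noteq> []) (map (\<lambda>j. row_of_content n
        (\<lambda>i. nat (lim (\<lambda>t::nat. F (int i) (int t) ! j - F (int i - 1) (int t) ! j)))) [0..<l]),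
      filter (\<lambda>r. r \<noteq> []) (map (\<lambda>j. row_of_content n
        (\<lambda>i. nat (lim (\<lambda>t::nat. F (int t) (int i) ! j - F (int t) (int i - 1) ! j)))) [0..<l])))"

text \<open>A bracket is a position in a word together with a flag, which is true for a closing
  and false for an opening bracket. The function cancels adjacent pairs of an
  opening bracket followed by a closing one until none is left.\<close>

fun cancel_brackets :: "(nat \<times> bool) list \<Rightarrow> (nat \<times> bool) list" where
  "cancel_brackets [] = []"
| "cancel_brackets (b # w) = (case cancel_brackets w of
      [] \<Rightarrow> [b]
    | b' # w' \<Rightarrow> if \<not> snd b \<and> snd b' then w' else b # b' # w')"

definition uncancelled :: "nat \<Rightarrow> nat \<Rightarrow> nat list \<Rightarrow> (nat \<times> bool) list" where
  "uncancelled cl op w = cancel_brackets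
     (map (\<lambda>p. (p, w ! p = cl)) (filter (\<lambda>p. w ! p = cl \<or> w ! p = op) [0..<length w]))"

definition raise_word :: "nat \<Rightarrow> nat \<Rightarrow> nat list \<Rightarrow> nat list option" where
  "raise_word cl op w = (case filter (\<lambda>b. \<not> snd b) (uncancelled cl op w) of
      [] \<Rightarrow> None
    | b # _ \<Rightarrow> Some (w[fst b := cl]))"

definition lower_word :: "nat \<Rightarrow> nat \<Rightarrow> nat list \<Rightarrow> nat list option" where
  "lower_word cl op w = (case rev (filter snd (uncancelled cl op w)) of
      [] \<Rightarrow> None
    | b # _ \<Rightarrow> Some (w[fst b := op]))"

text \<open>\<open>E i\<close> and \<open>F i\<close> are names for the operators \<open>e\<^sub>i\<close> and \<open>f\<^sub>i\<close>; the value \<open>None\<close> below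
  plays the role of the element \<open>\<zero>\<close>.\<close>

datatype kashiwara = E (kindex: nat) | F (kindex: nat)

fun act_word :: "nat \<Rightarrow> kashiwara \<Rightarrow> nat list \<Rightarrow> nat list option" where
  "act_word n (E i) = (if i = 0 then raise_word n 1 else raise_word i (Suc i))"
| "act_word n (F i) = (if i = 0 then lower_word n 1 else lower_word i (Suc i))"

fun split_word :: "nat list \<Rightarrow> 'a list \<Rightarrow> 'a list list" where
  "split_word [] w = []"
| "split_word (k # ks) w = take k w # split_word ks (drop k w)"

definition reading_word :: "nat \<Rightarrow> hwt \<Rightarrow> nat list" where
  "reading_word i H = concat (rev (if i = 0 then map rev H else H))"

definition act_hwt :: "nat \<Rightarrow> kashiwara \<Rightarrow> hwt \<Rightarrow> hwt option" where
  "act_hwt n k H = map_option (\<lambda>w. map sort (rev (split_word (rev (map length H)) w)))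
     (act_word n k (reading_word (kindex k) H))"

text \<open>Apply the listed operators one after the other, the head of the list first.\<close>

fun run :: "('k \<Rightarrow> 's \<Rightarrow> 's option) \<Rightarrow> 'k list \<Rightarrow> 's \<Rightarrow> 's option" where
  "run act [] s = Some s"
| "run act (k # ks) s = do { s' \<leftarrow> act k s; run act ks s' }"

text \<open>\<open>pair_dots a b\<close> pairs the dots of the right column \<open>a\<close> with dots of the left column \<open>b\<close>
  and returns the number of winding pairs together with the unpaired dots of \<open>b\<close>. Boxes are
  numbered from top to bottom, so the lowest dot is the one with the largest label. The outcome does
  not depend on the order in which the dots of \<open>a\<close> are treated; the order of the list is used.\<close>

fun pair_dots :: "nat list \<Rightarrow> nat list \<Rightarrow> nat \<times> nat list" where
  "pair_dots [] b = (0, b)"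
| "pair_dots (x # a) b =
     (let S = {y \<in> set b. y < x};
          y = (if S = {} then Max (set b) else Max S);
          (w, u) = pair_dots a (remove1 y b)
      in (w + of_bool (S = {}), u))"

definition R_short_long :: "nat list \<Rightarrow> nat list \<Rightarrow> nat list \<times> nat list" where
  "R_short_long a b = (let u = snd (pair_dots a b) in
     (sort (a @ u), sorted_list_of_multiset (mset b - mset u)))"

definition comb_R :: "nat list \<Rightarrow> nat list \<Rightarrow> nat list \<times> nat list" where
  "comb_R a b = (if length a \<le> length b then R_short_long a b
     else (THE (c, d). sorted c \<and> sorted d \<and> length c = length b \<and> length d = length a
                       \<and> R_short_long c d = (a, b)))"

definition winding :: "nat list \<Rightarrow> nat list \<Rightarrow> nat" where
  "winding a b = (if length a \<le> length b then fst (pair_dots a b)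
     else (case comb_R a b of (c, d) \<Rightarrow> fst (pair_dots c d)))"

text \<open>In the next two definitions \<open>H ! i\<close> is the factor \<open>h\<^bsub>i+1\<^esub>\<close> and \<open>H ! (i - 1)\<close> is \<open>h\<^sub>i\<close>, for
  \<open>1 \<le> i < length H\<close>.\<close>

definition sigma :: "nat \<Rightarrow> hwt \<Rightarrow> hwt" where
  "sigma i H = (case comb_R (H ! i) (H ! (i - 1)) of (b, a) \<Rightarrow> H[i := b, i - 1 := a])"

definition local_winding :: "nat \<Rightarrow> hwt \<Rightarrow> nat" where
  "local_winding i H = winding (H ! i) (H ! (i - 1))"

definition energy :: "hwt \<Rightarrow> nat" where
  "energy H = (\<Sum>j\<in>{1..length H}. \<Sum>i\<in>{1..<j}. local_winding i (foldr sigma [Suc i..<j] H))"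

definition sigma_minus :: "hwt \<Rightarrow> hwt" where
  "sigma_minus H = fold (\<lambda>k. foldr sigma [1..<Suc k]) [1..<length H] H"

definition eta :: "nat \<Rightarrow> hwt \<Rightarrow> hwt" where
  "eta n H = map (\<lambda>r. sort (map (\<lambda>j. n + 1 - j) r)) (rev (sigma_minus H))"

definition dual_energy :: "nat \<Rightarrow> hwt \<Rightarrow> nat" where
  "dual_energy n H = energy (eta n H)"

definition H_max :: "hwt \<Rightarrow> hwt" where
  "H_max H = map (\<lambda>r. replicate (length r) 1) H"

definition classical :: "nat \<Rightarrow> kashiwara set" where
  "classical n = E ` {1..<n} \<union> F ` {1..<n}"

definition classical_component :: "nat \<Rightarrow> hwt \<Rightarrow> hwt set" where
  "classical_component n H = {K. (H, K) \<in> {(X, Y). \<exists>k \<in> classical n. act_hwt n k X = Some Y}\<^sup>*}"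

definition lowest_weight :: "nat \<Rightarrow> hwt \<Rightarrow> hwt" where
  "lowest_weight n H =
     (THE K. K \<in> classical_component n H \<and> (\<forall>i\<in>{1..<n}. act_hwt n (F i) K = None))"

definition underline :: "hwt \<Rightarrow> hwt" where
  "underline H = map (map (\<lambda>x. x - (Min (set (concat H)) - 1))) H"

text \<open>For \<open>n = 1\<close> there are no classical operators and \<open>H = H_max H\<close>, so the
  first rule gives the empty path.\<close>

inductive is_leading_path :: "nat \<Rightarrow> hwt \<Rightarrow> kashiwara list \<Rightarrow> bool" for n where
  classical:
    "\<lbrakk> dual_energy n H = dual_energy n (H_max H);
       set L \<subseteq> E ` {1..<n}; run (act_hwt n) L H = Some (H_max H) \<rbrakk>
     \<Longrightarrow> is_leading_path n H L"
| affine: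
    "\<lbrakk> dual_energy n H \<noteq> dual_energy n (H_max H);
       set G \<subseteq> classical n; run (act_hwt n) G H = Some (underline (lowest_weight n H));
       act_hwt n (E 0) (underline (lowest_weight n H)) = Some H';
       is_leading_path n H' L \<rbrakk>
     \<Longrightarrow> is_leading_path n H (G @ E 0 # L)"

text \<open>The recursion leaves the choice of the classical compositions open; one leading path
  is fixed for each tableau.\<close>

definition leading_path :: "nat \<Rightarrow> hwt \<Rightarrow> kashiwara list option" where
  "leading_path n H =
     (if \<exists>L. is_leading_path n H L then Some (SOME L. is_leading_path n H L) else None)"

definition tableau_rows :: "tableau \<Rightarrow> nat list list" where
  "tableau_rows P = map (\<lambda>j. row_of_content (length P - 1)
     (\<lambda>i. nat (P ! i ! j - P ! (i - 1) ! j))) [0..<length (P ! 0)]"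

definition tableau_of_rows :: "nat \<Rightarrow> int list \<Rightarrow> nat list list \<Rightarrow> tableau" where
  "tableau_of_rows n rho rs =
     map (\<lambda>i. map2 (\<lambda>k r. k + int (length (filter (\<lambda>x. x \<le> i) r))) rho rs) [0..<Suc n]"

text \<open>For index at least 1 the signature rule on the row reading word of a skew tableau is the
  same as on the rows regarded as an unrelated sequence of rows.\<close>

definition act_skew :: "nat \<Rightarrow> kashiwara \<Rightarrow> tableau \<Rightarrow> tableau option" where
  "act_skew n k P = map_option (tableau_of_rows n (P ! 0)) (act_hwt n k (tableau_rows P))"

definition act_P :: "nat \<Rightarrow> kashiwara \<Rightarrow> tableau \<times> tableau \<Rightarrow> (tableau \<times> tableau) option" where
  "act_P n k = (\<lambda>(P, Q). map_option (\<lambda>P'. (P', Q)) (act_skew n k P))"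

definition act_Q :: "nat \<Rightarrow> kashiwara \<Rightarrow> tableau \<times> tableau \<Rightarrow> (tableau \<times> tableau) option" where
  "act_Q n k = (\<lambda>(P, Q). map_option (\<lambda>Q'. (P, Q')) (act_skew n k Q))"

text \<open>The index 0 operator is the index 1 operator conjugated by \<open>\<iota>\<close>, an invertible map on the set
  of all pairs.\<close>

definition with_affine :: "nat \<Rightarrow> (tableau \<times> tableau \<Rightarrow> tableau \<times> tableau)
    \<Rightarrow> (kashiwara \<Rightarrow> tableau \<times> tableau \<Rightarrow> (tableau \<times> tableau) option)
    \<Rightarrow> kashiwara \<Rightarrow> tableau \<times> tableau \<Rightarrow> (tableau \<times> tableau) option" where
  "with_affine n iota act k PQ = (case k of
      E i \<Rightarrow> if i = 0 then map_option iota (act (E 1) (inv_into (SST_pairs n) iota PQ)) else act k PQ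
    | F i \<Rightarrow> if i = 0 then map_option iota (act (F 1) (inv_into (SST_pairs n) iota PQ)) else act k PQ)"

definition act1 :: "nat \<Rightarrow> kashiwara \<Rightarrow> tableau \<times> tableau \<Rightarrow> (tableau \<times> tableau) option" where
  "act1 n = with_affine n (iota1 n) (act_P n)"

definition act2 :: "nat \<Rightarrow> kashiwara \<Rightarrow> tableau \<times> tableau \<Rightarrow> (tableau \<times> tableau) option" where
  "act2 n = with_affine n (iota2 n) (act_Q n)"

text \<open>A rigged configuration is a multiset of strings (length, rigging).\<close>

definition vacancy :: "int \<Rightarrow> nat multiset \<Rightarrow> nat \<Rightarrow> int" where
  "vacancy k mu i = k - 2 * (\<Sum>m\<in>#mu. int (min m i))"

text \<open>Singular strings of equal length are equal, so the length of a longest singular string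
  determines it. If the maximum is 0 then nothing is removed, and a new string of
  length 1 is created.\<close>

definition KKR_step :: "(int \<Rightarrow> int) \<Rightarrow> int \<Rightarrow> (nat \<times> int) multiset \<Rightarrow> (nat \<times> int) multiset" where
  "KKR_step b k M = (if b k = 1 then
     (let p = vacancy (k - 1) (image_mset fst M);
          m = Max (insert 0 {m. (m, p m) \<in># M});
          N = M - {#(m, p m)#};
          p' = vacancy k (add_mset (Suc m) (image_mset fst N))
      in add_mset (Suc m, p' (Suc m)) N)
     else M)"

definition KKR :: "(int \<Rightarrow> int) \<Rightarrow> nat list \<times> int list" where
  "KKR b = (let S = {x. b x = 1};
                M = (if S = {} then {#} else fold (KKR_step b) [Min S..Max S] {#});
                strings = rev (sorted_list_of_multiset M)
            in (map fst strings, map snd strings))"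

definition extend_alphabet :: "nat \<Rightarrow> tableau \<Rightarrow> tableau" where
  "extend_alphabet n' P = P @ replicate (Suc n' - length P) (last P)"

definition ball_state :: "int list \<Rightarrow> int list \<Rightarrow> int \<Rightarrow> int" where
  "ball_state rho lam x = conjugate lam x - conjugate rho x"

definition residual :: "int list \<Rightarrow> (int \<Rightarrow> int) \<Rightarrow> int list" where
  "residual rho b =
     rev (sorted_list_of_multiset (mset rho - mset_set {j. b j = 0 \<and> b (j + 1) = 1}))"

text \<open>The value \<open>None\<close> stands for undefined: it is returned if one of the objects named in the
  construction does not exist, that is, if a leading path is missing, if a composition of Kashiwara
  operators vanishes, if its result is not of the form \<open>(T, T)\<close> with all labels 1, or if the shape
  of the rigged configuration differs from that of the soliton data.\<close>

definition Upsilon_col ::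
  "nat \<Rightarrow> tableau \<times> tableau \<Rightarrow> (hwt \<times> hwt \<times> int list \<times> int list) option" where
  "Upsilon_col n PQ =
     (let (H1, H2) = soliton_data n PQ;
          mu = map length H1;
          n' = max (length mu) n
      in do {
        L1 \<leftarrow> leading_path n' H1;
        L2 \<leftarrow> leading_path n' H2;
        PQ1 \<leftarrow> run (act1 n') L1 (map_prod (extend_alphabet n') (extend_alphabet n') PQ);
        (T, T') \<leftarrow> run (act2 n') L2 PQ1;
        (let rho = T ! 0; lam = T ! 1; b = ball_state rho lam; (mu', J) = KKR b in
          if T = T' \<and> (\<forall>i\<in>{1..n'}. T ! i = lam) \<and> mu' = mu
          then Some (H1, H2, map2 (+) J (map int mu), residual rho b)
          else None)
      })"

end

theory Submission
  imports Defs
begin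

text \<open>
  The map \<open>cRSK\<close> translates a Fomin field by \<open>(n, 0)\<close>, so it preserves the soliton data and with them
  the leading paths. It also commutes with the operators along these paths. The operators of index 0
  are conjugates of operators of index 1 by other translations. A classical operator of index \<open>i\<close>
  changes only the column \<open>i\<close> of the field: the two carries in horizontally adjacent squares form a
  one-row tableau that travels through the columns of the skew tableau, and at each column the local
  rule acts as an isomorphism of crystals.

  This reduces the claim to pairs \<open>(T, T)\<close> with a single letter, on which \<open>cRSK\<close> is one time step of
  the box-ball system with an infinite carrier. Numbering the seats of the carrier shows that the time
  step adds to the rigging of each string the length of this string. The signature \<open>nu\<close> is unchanged
  because the pattern 10 in the old state sits exactly where 01 sits in the new one.
\<close>

section \<open>Conjugates and the local rule\<close>

text \<open>Carry, local rule and field are defined by definite descriptions, and the operators by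
  bracket words on rows. Neither form can be pushed through a field, so each gets a relational
  substitute: a square together with its carry for the local rule, and for \<open>e_i\<close> the
  relation \<open>raises\<close>, a change of one column height right after the last minimum of an
  integer function. The row reading of the definition and the column reading of
  \<open>raises\<close> agree because the heights that matter lie at the columns
  \<open>mu ! j\<close>. In relational form \<open>f_i\<close> is the converse of
  \<open>e_i\<close>, so one propagation argument serves both, and transposing the field serves the
  second tableau. The hypothesis supplies one successful run of operators, and this run is carried
  along step by step; nothing has to be shown about the existence of leading paths. A second
  obstacle is the alphabet \<open>n'\<close>, which may exceed \<open>n\<close>. Enlarging it
  changes the circumference of the cylinder and hence the field, but the first block changes only by
  repeating its last row and column, and \<open>cRSK\<close> can be read off that block.\<close>

lemma signaturesD:
  assumes "lam \<in> signatures l"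
  shows "length lam = l" "\<And>i j. i \<le> j \<Longrightarrow> j < l \<Longrightarrow> lam ! j \<le> lam ! i"
  using assms unfolding signatures_def sorted_wrt_iff_nth_less
  by (auto simp: le_less)

text \<open>Monotonicity makes the rows that reach column \<open>x\<close> an initial segment, so
  row \<open>j\<close> belongs to it exactly when its size exceeds \<open>j\<close>. This adjunction
  transfers statements between rows and columns.\<close>

lemma conjugate_gt_iff:
  assumes "lam \<in> signatures l" "j < l"
  shows "int j < conjugate lam x \<longleftrightarrow> x \<le> lam ! j"
proof -
  note s = signaturesD[OF assms(1)]
  let ?S = "{j. j < length lam \<and> x \<le> lam ! j}"
  show ?thesis
  proof (cases "x \<le> lam ! j")
    case True
    then have "{..j} \<subseteq> ?S" using s assms(2) by (auto intro: order_trans)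
    then have "card {..j} \<le> card ?S" by (intro card_mono) auto
    then show ?thesis using True by (simp add: conjugate_def)
  next
    case False
    then have "?S \<subseteq> {..<j}" using s by (force simp: not_le)
    then have "card ?S \<le> card {..<j}" by (intro card_mono) auto
    then show ?thesis using False by (simp add: conjugate_def)
  qed
qed

lemma conjugate_bounds: "0 \<le> conjugate lam x" "conjugate lam x \<le> int (length lam)"
proof -
  have "card {j. j < length lam \<and> x \<le> lam ! j} \<le> card {..<length lam}"
    by (intro card_mono) auto
  then show "0 \<le> conjugate lam x" "conjugate lam x \<le> int (length lam)"
    by (auto simp: conjugate_def)
qed

lemma conjugate_antimono: "x \<le> y \<Longrightarrow> conjugate lam y \<le> conjugate lam x"
  unfolding conjugate_def of_nat_le_iff by (intro card_mono) auto

lemma conjugate_eq_length: "(\<And>k. k \<in> set lam \<Longrightarrow> x \<le> k) \<Longrightarrow> conjugate lam x = int (length lam)"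
  unfolding conjugate_def by (metis (mono_tags, lifting) Collect_cong card_Collect_less_nat nth_mem)

lemma conjugate_eq_0: "(\<And>k. k \<in> set lam \<Longrightarrow> k < x) \<Longrightarrow> conjugate lam x = 0"
  unfolding conjugate_def by (fastforce simp: not_le dest: nth_mem)

lemma eventually_conjugate_at_bot: "\<forall>\<^sub>F x in at_bot. conjugate lam x = int (length lam)"
proof -
  have "\<forall>k\<in>set lam. \<forall>\<^sub>F x in at_bot. x \<le> k" by (simp add: eventually_le_at_bot)
  then have "\<forall>\<^sub>F x in at_bot. \<forall>k\<in>set lam. x \<le> k" by (simp add: eventually_ball_finite)
  then show ?thesis by eventually_elim (simp add: conjugate_eq_length)
qed

lemma eventually_conjugate_at_top: "\<forall>\<^sub>F x in at_top. conjugate lam x = 0"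
proof -
  have "\<forall>k\<in>set lam. \<forall>\<^sub>F x in at_top. k < x" by (simp add: eventually_gt_at_top)
  then have "\<forall>\<^sub>F x in at_top. \<forall>k\<in>set lam. k < x" by (simp add: eventually_ball_finite)
  then show ?thesis by eventually_elim (simp add: conjugate_eq_0)
qed

lemma conjugate_inject:
  assumes "lam \<in> signatures l" "mu \<in> signatures l" "\<And>x. conjugate lam x = conjugate mu x"
  shows "lam = mu"
proof (rule nth_equalityI)
  show "length lam = length mu" using assms by (simp add: signatures_def)
  fix j assume "j < length lam"
  then have "j < l" using assms by (simp add: signatures_def)
  then have "x \<le> lam ! j \<longleftrightarrow> x \<le> mu ! j" for x
    using conjugate_gt_iff assms by metis
  then show "lam ! j = mu ! j" by (meson order_antisym order_refl)
qed

text \<open>Row \<open>j\<close> is recovered as the last column of height greater than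
  \<open>j\<close>; the two limit conditions guarantee that there is such a column for
  \<open>j < l\<close>.\<close>

lemma ex_signature_conjugate:
  fixes f :: "int \<Rightarrow> int"
  assumes anti: "\<And>x. f (x + 1) \<le> f x"
    and bot: "\<forall>\<^sub>F x in at_bot. f x = int l" and top: "\<forall>\<^sub>F x in at_top. f x = 0"
  obtains lam where "lam \<in> signatures l" "\<And>x. conjugate lam x = f x"
proof -
  have anti': "f y \<le> f x" if "x \<le> y" for x y
    using that by (induction y rule: int_ge_induct) (auto intro: order_trans anti)
  obtain N1 where N1: "\<And>x. x \<le> N1 \<Longrightarrow> f x = int l"
    using bot by (auto simp: eventually_at_bot_linorder)
  obtain N2 where N2: "\<And>x. x \<ge> N2 \<Longrightarrow> f x = 0"
    using top by (auto simp: eventually_at_top_linorder)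
  have f0: "0 \<le> f x" for x using anti'[of x "max x N2"] N2[of "max x N2"] by simp
  have fl: "f x \<le> int l" for x using anti'[of "min x N1" x] N1[of "min x N1"] by simp
  \<comment> \<open>The restriction to \<open>{N1..N2}\<close> makes the set finite and loses
    nothing: up to \<open>N1\<close> every height is \<open>l\<close>, from \<open>N2\<close> on it
    is 0.\<close>
  define g where "g j = Max {x \<in> {N1..N2}. int j < f x}" for j :: nat
  have le_iff: "x \<le> g j \<longleftrightarrow> int j < f x" if "j < l" for x j
  proof -
    let ?S = "{x \<in> {N1..N2}. int j < f x}"
    have fin: "finite ?S" by (rule finite_subset[of _ "{N1..N2}"]) auto
    have "N1 \<le> N2" using N1[of N1] N2[of N1] that by force
    then have ne: "N1 \<in> ?S" using N1 that by auto
    then have g: "g j \<in> ?S" "N1 \<le> g j" unfolding g_def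
      using Max_in[OF fin] Max_ge[OF fin ne] ne by blast+
    show ?thesis
    proof
      assume "x \<le> g j" then show "int j < f x" using g anti' by force
    next
      assume j: "int j < f x"
      then have "x < N2" using N2[of x] by (cases "x < N2") auto
      show "x \<le> g j"
      proof (cases "N1 \<le> x")
        case True
        then show ?thesis unfolding g_def using \<open>x < N2\<close> j by (intro Max_ge[OF fin]) auto
      qed (use g in auto)
    qed
  qed
  define lam where "lam = map g [0..<l]"
  have "lam \<in> signatures l"
  proof -
    have "g j \<le> g i" if "i < j" "j < l" for i j
      using le_iff[of i "g j"] le_iff[of j "g j"] that by auto
    then show ?thesis by (auto simp: signatures_def lam_def sorted_wrt_iff_nth_less)
  qed
  moreover have "conjugate lam x = f x" for x
  proof -
    have "{j. j < length lam \<and> x \<le> lam ! j} = {..<nat (f x)}"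
      using fl[of x] f0[of x] by (auto simp: lam_def le_iff)
    then show ?thesis using f0 by (simp add: conjugate_def)
  qed
  ultimately show thesis using that by blast
qed

lemma hstrip_signatures:
  assumes "kap \<preceq>\<^sub>h mu"
  shows "kap \<in> signatures (length mu)" "mu \<in> signatures (length mu)"
proof -
  have 1: "kap ! Suc j \<le> kap ! j" "mu ! Suc j \<le> mu ! j" if "Suc j < length mu" for j
    using assms that by (auto simp: hstrip_def intro: order_trans dest: Suc_lessD)
  have 2: "kap ! j \<le> kap ! i \<and> mu ! j \<le> mu ! i" if "i \<le> j" "j < length mu" for i j
    using that by (induction j rule: dec_induct) (auto intro: order_trans 1)
  show "kap \<in> signatures (length mu)" "mu \<in> signatures (length mu)"
    using 2 assms by (auto simp: signatures_def sorted_wrt_iff_nth_less hstrip_def)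
qed

lemma hstrip_iff:
  assumes "kap \<in> signatures l" "mu \<in> signatures l"
  shows "kap \<preceq>\<^sub>h mu \<longleftrightarrow>
    (\<forall>x. conjugate kap x \<le> conjugate mu x \<and> conjugate mu x \<le> conjugate kap x + 1)"
proof -
  note gk = conjugate_gt_iff[OF assms(1)] and gm = conjugate_gt_iff[OF assms(2)]
  have len: "length kap = l" "length mu = l" using assms by (auto simp: signatures_def)
  show ?thesis
  proof (intro iffI allI conjI)
    fix x assume h: "kap \<preceq>\<^sub>h mu"
    show "conjugate kap x \<le> conjugate mu x"
    proof (rule ccontr)
      define j where "j = nat (conjugate mu x)"
      assume "\<not> ?thesis"
      then have "int j < conjugate kap x" "\<not> int j < conjugate mu x" "j < l"
        using conjugate_bounds[of mu x] conjugate_bounds[of kap x] len by (auto simp: j_def)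
      then show False using gk[of j x] gm[of j x] h len by (force simp: hstrip_def)
    qed
    show "conjugate mu x \<le> conjugate kap x + 1"
    proof (rule ccontr)
      define j where "j = nat (conjugate kap x)"
      assume "\<not> ?thesis"
      then have "int (Suc j) < conjugate mu x" "\<not> int j < conjugate kap x" "Suc j < l"
        using conjugate_bounds[of mu x] conjugate_bounds[of kap x] len by (auto simp: j_def)
      then show False using gk[of j x] gm[of "Suc j" x] h len by (force simp: hstrip_def)
    qed
  next
    assume h: "\<forall>x. conjugate kap x \<le> conjugate mu x \<and> conjugate mu x \<le> conjugate kap x + 1"
    show "kap \<preceq>\<^sub>h mu" unfolding hstrip_def len
    proof (intro conjI allI impI)
      fix j assume "j < l"
      then show "kap ! j \<le> mu ! j" using gk[of j "kap ! j"] gm[of j "kap ! j"] h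
        by (meson order_less_le_trans order_refl)
    next
      fix j assume "Suc j < l"
      then show "mu ! Suc j \<le> kap ! j"
        using gk[of j "mu ! Suc j"] gm[of "Suc j" "mu ! Suc j"] h[rule_format, of "mu ! Suc j"] by simp
    qed simp
  qed
qed

section \<open>The carry recursion for sequences of integers\<close>

text \<open>Only the sum of the two input bits enters, so \<open>u\<close> is arbitrary. The same
  predicate covers the squares of a field and, with \<open>u = b + b\<close>, the carrier of the
  box-ball system.\<close>

definition is_carry :: "(int \<Rightarrow> int) \<Rightarrow> (int \<Rightarrow> int) \<Rightarrow> bool" where
  "is_carry u c \<longleftrightarrow> (\<forall>x. c x = max 0 (u x + c (x - 1) - 1)) \<and> (\<forall>\<^sub>F x in at_bot. c x = 0)"

lemma is_carry_rec: "is_carry u c \<Longrightarrow> c x = max 0 (u x + c (x - 1) - 1)"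
  unfolding is_carry_def by blast

lemma is_carry_nonneg: "is_carry u c \<Longrightarrow> 0 \<le> c x"
  using is_carry_rec[of u c x] by simp

lemma is_carry_unique:
  assumes "is_carry u c" "is_carry u d"
  shows "c = d"
proof
  fix x
  have "\<forall>\<^sub>F x in at_bot. c x = 0 \<and> d x = 0"
    using assms unfolding is_carry_def eventually_conj_iff by blast
  then obtain N where N: "\<And>x. x \<le> N \<Longrightarrow> c x = 0 \<and> d x = 0"
    by (auto simp: eventually_at_bot_linorder)
  have "c x = d x" if "N \<le> x" for x
    using that
  proof (induction x rule: int_ge_induct)
    case (step x)
    then show ?case using is_carry_rec[OF assms(1), of "x + 1"] is_carry_rec[OF assms(2), of "x + 1"] by simp
  qed (simp add: N)
  then show "c x = d x" using N[of x] by (cases "x \<le> N") auto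
qed

lemma ex_is_carry:
  assumes "\<forall>\<^sub>F x in at_bot. u x = 0"
  obtains c where "is_carry u c"
proof -
  obtain N where N: "\<And>x. x \<le> N \<Longrightarrow> u x = 0"
    using assms by (auto simp: eventually_at_bot_linorder)
  define g where "g = rec_nat 0 (\<lambda>k r. max 0 (u (N + 1 + int k) + r - 1))"
  have g: "g 0 = 0" "g (Suc k) = max 0 (u (N + 1 + int k) + g k - 1)" for k
    by (simp_all add: g_def)
  define c where "c x = g (nat (x - N))" for x
  have 0: "c x = 0" if "x \<le> N" for x using that g by (simp add: c_def)
  have "c x = max 0 (u x + c (x - 1) - 1)" for x
  proof (cases "x \<le> N")
    case True then show ?thesis using 0[of x] 0[of "x - 1"] N[of x] by simp
  next
    case False
    then obtain k where k: "x = N + 1 + int k"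
      by (metis add.commute not_le zle_iff_zadd zless_imp_add1_zle)
    then have "nat (x - N) = Suc k" "nat (x - 1 - N) = k" by auto
    then show ?thesis unfolding c_def by (simp add: g k)
  qed
  moreover have "\<forall>\<^sub>F x in at_bot. c x = 0" using 0 by (auto simp: eventually_at_bot_linorder)
  ultimately show thesis using that unfolding is_carry_def by blast
qed

text \<open>Once the input has stopped, the carry loses one unit at each position until it is
  0.\<close>

lemma is_carry_at_top:
  assumes "is_carry u c" "\<forall>\<^sub>F x in at_top. u x = 0"
  shows "\<forall>\<^sub>F x in at_top. c x = 0"
proof -
  obtain N where N: "\<And>x. x \<ge> N \<Longrightarrow> u x = 0"
    using assms by (auto simp: eventually_at_top_linorder)
  have "c (N + int k) \<le> max 0 (c N - int k)" for k
  proof (induction k)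
    case (Suc k)
    then show ?case using is_carry_rec[OF assms(1), of "N + int (Suc k)"] N[of "N + int (Suc k)"] by simp
  qed simp
  then have "c x = 0" if "x \<ge> N + c N" for x
    using that[THEN order_trans[OF add_increasing2[OF is_carry_nonneg[OF assms(1)] order_refl]]] that
      is_carry_nonneg[OF assms(1), of N] is_carry_nonneg[OF assms(1), of x]
    by (smt (verit) zle_iff_zadd)
  then show ?thesis by (auto simp: eventually_at_top_linorder)
qed

text \<open>The output bits at \<open>y = 1 - x\<close> are \<open>a y + c (y - 1) - c y\<close> and
  the same with \<open>b\<close>. If \<open>c y > 0\<close>, the recursion is linear at
  \<open>y\<close> and can be solved for \<open>c (y - 1)\<close>; if \<open>c y = 0\<close>, then
  \<open>a y + b y + c (y - 1)\<close> is 0 or 1, and both cases are immediate.\<close>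

lemma is_carry_reflect:
  assumes c: "is_carry (\<lambda>x. a x + b x) c"
    and bits: "\<And>x. a x \<in> {0, 1}" "\<And>x. b x \<in> {0, 1}"
    and top: "\<forall>\<^sub>F x in at_top. a x + b x = 0"
  shows "is_carry (\<lambda>x. (a (1 - x) + c (- x) - c (1 - x)) + (b (1 - x) + c (- x) - c (1 - x)))
           (\<lambda>x. c (- x))"
  unfolding is_carry_def
proof (intro conjI allI)
  fix x
  show "c (- x) = max 0 ((a (1 - x) + c (- x) - c (1 - x)) + (b (1 - x) + c (- x) - c (1 - x))
           + c (- (x - 1)) - 1)"
    using is_carry_rec[OF c, of "1 - x"] is_carry_nonneg[OF c, of "- x"] bits[of "1 - x"] by force
next
  obtain N where "\<And>x. x \<ge> N \<Longrightarrow> c x = 0"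
    using is_carry_at_top[OF c top] by (auto simp: eventually_at_top_linorder)
  then have "c (- x) = 0" if "x \<le> - N" for x using that by simp
  then show "\<forall>\<^sub>F x in at_bot. c (- x) = 0" unfolding eventually_at_bot_linorder by blast
qed

section \<open>The local rule as a square with its carry\<close>

text \<open>A certificate for the two nested definite descriptions in \<open>fomin_rule\<close>;
  keeping the carry as an argument lets later proofs compute with it.\<close>

definition fomin_square :: "int list \<Rightarrow> int list \<Rightarrow> int list \<Rightarrow> int list \<Rightarrow> (int \<Rightarrow> int) \<Rightarrow> bool" where
  "fomin_square kap mu lam nu c \<longleftrightarrow>
     kap \<preceq>\<^sub>h mu \<and> kap \<preceq>\<^sub>h lam \<and> mu \<preceq>\<^sub>h nu \<and> lam \<preceq>\<^sub>h nu \<and>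
     is_carry (\<lambda>x. (conjugate mu x - conjugate kap x) + (conjugate lam x - conjugate kap x)) c \<and>
     (\<forall>x. conjugate nu x = conjugate mu x + conjugate lam x - conjugate kap x + c (x - 1) - c x)"

lemma fomin_square_commute: "fomin_square kap mu lam nu c \<longleftrightarrow> fomin_square kap lam mu nu c"
  unfolding fomin_square_def by (auto simp: algebra_simps)

lemma hstrip_bits:
  assumes "kap \<preceq>\<^sub>h mu"
  shows "conjugate mu x - conjugate kap x \<in> {0, 1}"
  using hstrip_iff[OF hstrip_signatures[OF assms]] assms by (smt (verit) insert_iff)

lemma hstrip_length: "kap \<preceq>\<^sub>h mu \<Longrightarrow> length kap = length mu"
  by (simp add: hstrip_def)

lemma hstrip_eventually:
  assumes "kap \<preceq>\<^sub>h mu"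
  shows "\<forall>\<^sub>F x in at_bot. conjugate mu x - conjugate kap x = 0"
    "\<forall>\<^sub>F x in at_top. conjugate mu x - conjugate kap x = 0"
proof -
  show "\<forall>\<^sub>F x in at_bot. conjugate mu x - conjugate kap x = 0"
    using eventually_conjugate_at_bot[of mu] eventually_conjugate_at_bot[of kap]
    by eventually_elim (use hstrip_length[OF assms] in simp)
  show "\<forall>\<^sub>F x in at_top. conjugate mu x - conjugate kap x = 0"
    using eventually_conjugate_at_top[of mu] eventually_conjugate_at_top[of kap]
    by eventually_elim simp
qed

lemma hstrip_pair_eventually:
  assumes "kap \<preceq>\<^sub>h mu" "kap' \<preceq>\<^sub>h lam"
  shows "\<forall>\<^sub>F x in at_bot. (conjugate mu x - conjugate kap x) + (conjugate lam x - conjugate kap' x) = 0"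
    "\<forall>\<^sub>F x in at_top. (conjugate mu x - conjugate kap x) + (conjugate lam x - conjugate kap' x) = 0"
proof -
  show "\<forall>\<^sub>F x in at_bot. (conjugate mu x - conjugate kap x) + (conjugate lam x - conjugate kap' x) = 0"
    using hstrip_eventually(1)[OF assms(1)] hstrip_eventually(1)[OF assms(2)]
    by eventually_elim simp
  show "\<forall>\<^sub>F x in at_top. (conjugate mu x - conjugate kap x) + (conjugate lam x - conjugate kap' x) = 0"
    using hstrip_eventually(2)[OF assms(1)] hstrip_eventually(2)[OF assms(2)]
    by eventually_elim simp
qed

lemma ex_fomin_square:
  assumes "kap \<preceq>\<^sub>h mu" "kap \<preceq>\<^sub>h lam"
  obtains nu c where "fomin_square kap mu lam nu c"
proof -
  let ?l = "length mu"
  have sig: "kap \<in> signatures ?l" "mu \<in> signatures ?l" "lam \<in> signatures ?l"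
    using hstrip_signatures[OF assms(1)] hstrip_signatures[OF assms(2)] hstrip_length[OF assms(1)]
      hstrip_length[OF assms(2)] by auto
  let ?a = "\<lambda>x. conjugate mu x - conjugate kap x" and ?b = "\<lambda>x. conjugate lam x - conjugate kap x"
  obtain c where c: "is_carry (\<lambda>x. ?a x + ?b x) c"
    using ex_is_carry[OF hstrip_pair_eventually(1)[OF assms]] .
  note c0 = is_carry_nonneg[OF c] and crec = is_carry_rec[OF c]
  define f where "f x = conjugate mu x + conjugate lam x - conjugate kap x + c (x - 1) - c x" for x
  have bits: "?a x = 0 \<or> ?a x = 1" "?b x = 0 \<or> ?b x = 1" for x
    using hstrip_bits[OF assms(1), of x] hstrip_bits[OF assms(2), of x] by auto
  have le1: "f x \<le> conjugate kap x + 1" for x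
    using bits[of x] crec[of x] unfolding f_def by linarith
  \<comment> \<open>Column \<open>x\<close> gains a cell over \<open>kap\<close> unless both inputs
    and the incoming carry vanish there. In that exceptional case the next column is just the larger
    of those of \<open>mu\<close> and \<open>lam\<close>, so \<open>f\<close> still does not
    increase.\<close>
  have fx: "f x = conjugate kap x + 1 \<or>
      f x = conjugate kap x \<and> conjugate mu x = conjugate kap x \<and> conjugate lam x = conjugate kap x \<and> c x = 0" for x
    using bits[of x] crec[of x] c0[of "x - 1"] unfolding f_def by (auto simp: max_def)
  have "f (x + 1) \<le> f x" for x
    using fx[of x]
  proof
    assume "f x = conjugate kap x + 1"
    then show ?thesis using le1[of "x + 1"] conjugate_antimono[of x "x + 1" kap] by simp
  next
    assume *: "f x = conjugate kap x \<and> conjugate mu x = conjugate kap x \<and> conjugate lam x = conjugate kap x \<and> c x = 0"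
    then show ?thesis
      using crec[of "x + 1"] conjugate_antimono[of x "x + 1" mu] bits[of "x + 1"]
        conjugate_antimono[of x "x + 1" lam]
      unfolding f_def by (auto simp: max_def)
  qed
  moreover have "\<forall>\<^sub>F x in at_bot. f x = int ?l"
  proof -
    have "\<forall>\<^sub>F x in at_bot. c x = 0" using c unfolding is_carry_def by blast
    then obtain N where "\<And>x. x \<le> N \<Longrightarrow> c x = 0" by (auto simp: eventually_at_bot_linorder)
    then have "\<forall>\<^sub>F x in at_bot. c x = 0 \<and> c (x - 1) = 0" by (auto simp: eventually_at_bot_linorder intro!: exI[of _ N])
    then show ?thesis using eventually_conjugate_at_bot[of mu] eventually_conjugate_at_bot[of kap]
      eventually_conjugate_at_bot[of lam]
      by eventually_elim (use sig in \<open>auto simp: f_def signatures_def\<close>)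
  qed
  moreover have "\<forall>\<^sub>F x in at_top. f x = 0"
  proof -
    have "\<forall>\<^sub>F x in at_top. c x = 0"
      using is_carry_at_top[OF c] hstrip_pair_eventually(2)[OF assms] by simp
    then obtain N where "\<And>x. x \<ge> N \<Longrightarrow> c x = 0" by (auto simp: eventually_at_top_linorder)
    then have "\<forall>\<^sub>F x in at_top. c x = 0 \<and> c (x - 1) = 0" by (auto simp: eventually_at_top_linorder intro!: exI[of _ "N + 1"])
    then show ?thesis using eventually_conjugate_at_top[of mu] eventually_conjugate_at_top[of kap]
      eventually_conjugate_at_top[of lam]
      by eventually_elim (auto simp: f_def)
  qed
  ultimately obtain nu where nu: "nu \<in> signatures ?l" "\<And>x. conjugate nu x = f x"
    using ex_signature_conjugate[of f ?l] by blast
  have "mu \<preceq>\<^sub>h nu" "lam \<preceq>\<^sub>h nu"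
    unfolding hstrip_iff[OF sig(2) nu(1)] hstrip_iff[OF sig(3) nu(1)] nu(2)
    using le1 fx bits by (intro conjI allI; smt (verit))+
  then have "fomin_square kap mu lam nu c"
    using assms c by (simp add: fomin_square_def nu(2) f_def)
  then show thesis by (rule that)
qed

lemma fomin_square_signatures:
  assumes "fomin_square kap mu lam nu c"
  shows "kap \<in> signatures (length kap)" "mu \<in> signatures (length kap)"
    "lam \<in> signatures (length kap)" "nu \<in> signatures (length kap)"
  using assms hstrip_signatures hstrip_length unfolding fomin_square_def by metis+

lemma fomin_rule_eq:
  assumes "fomin_square kap mu lam nu c"
  shows "fomin_rule kap mu lam = nu"
proof -
  note sig = fomin_square_signatures[OF assms]
  have c: "is_carry (\<lambda>x. (conjugate mu x - conjugate kap x) + (conjugate lam x - conjugate kap x)) c"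
    and nu: "\<And>x. conjugate nu x = conjugate mu x + conjugate lam x - conjugate kap x + c (x - 1) - c x"
    using assms by (auto simp: fomin_square_def)
  have "fomin_carry kap mu lam = c"
    unfolding fomin_carry_def
  proof (rule the_equality)
    fix d assume "(\<forall>x. d x = max 0 ((conjugate mu x - conjugate kap x)
        + (conjugate lam x - conjugate kap x) + d (x - 1) - 1)) \<and> (\<forall>\<^sub>F x in at_bot. d x = 0)"
    then show "d = c" using is_carry_unique[OF _ c] unfolding is_carry_def by blast
  qed (use c in \<open>unfold is_carry_def, blast\<close>)
  then show ?thesis unfolding fomin_rule_def
    using sig nu by (intro the_equality) (auto intro: conjugate_inject)
qed

lemma fomin_square_rule:
  assumes "kap \<preceq>\<^sub>h mu" "kap \<preceq>\<^sub>h lam"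
  obtains c where "fomin_square kap mu lam (fomin_rule kap mu lam) c"
  using ex_fomin_square[OF assms] fomin_rule_eq by metis

lemma fomin_rule_commute:
  assumes "kap \<preceq>\<^sub>h mu" "kap \<preceq>\<^sub>h lam"
  shows "fomin_rule kap lam mu = fomin_rule kap mu lam"
  using fomin_square_rule[OF assms] fomin_square_commute fomin_rule_eq by metis

text \<open>A single bit on top of an empty carry never exceeds 1, so nothing is carried. This
  settles all squares with a trivial side, which arise from additional letters of an enlarged
  alphabet and from tableaux with one letter.\<close>

lemma fomin_rule_triv:
  assumes "kap \<preceq>\<^sub>h mu"
  shows "fomin_rule kap mu kap = mu"
proof -
  have kk: "kap \<preceq>\<^sub>h kap" "mu \<preceq>\<^sub>h mu"
    using hstrip_signatures[OF assms] by (auto simp: hstrip_iff)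
  have "is_carry (\<lambda>x. (conjugate mu x - conjugate kap x) + (conjugate kap x - conjugate kap x)) (\<lambda>x. 0)"
    unfolding is_carry_def
  proof (intro conjI allI)
    show "0 = max 0 ((conjugate mu x - conjugate kap x) + (conjugate kap x - conjugate kap x) + 0 - 1)" for x
      using hstrip_bits[OF assms, of x] by auto
  qed simp
  then show ?thesis using assms kk by (intro fomin_rule_eq) (auto simp: fomin_square_def)
qed

text \<open>The local rule is its own inverse after reflecting the line: read from right to left, the carry
  obeys the same recursion with respect to the two opposite edges of the square.\<close>

definition dual :: "int list \<Rightarrow> int list" where
  "dual lam = rev (map uminus lam)"

lemma dual_dual [simp]: "dual (dual lam) = lam"
  by (simp add: dual_def rev_map o_def)

lemma dual_signatures: "lam \<in> signatures l \<Longrightarrow> dual lam \<in> signatures l"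
  by (auto simp: signatures_def dual_def sorted_wrt_rev sorted_wrt_map)

text \<open>For an integer part \<open>k\<close>, the condition \<open>x \<le> - k\<close> is the
  negation of \<open>1 - x \<le> k\<close>. This is the origin of the shift by one, and of the carry
  \<open>c (- x)\<close> in the reflected square.\<close>

lemma conjugate_dual: "conjugate (dual lam) x = int (length lam) - conjugate lam (1 - x)"
proof -
  have c: "conjugate lam x = int (length (filter (\<lambda>k. x \<le> k) lam))" for lam x
    by (simp add: conjugate_def length_filter_conv_card)
  have "length (filter (\<lambda>k. x \<le> k) (dual lam)) = length (filter (\<lambda>k. \<not> 1 - x \<le> k) lam)"
    by (simp add: dual_def filter_map rev_filter[symmetric] o_def) (rule arg_cong[of _ _ length], rule filter_cong, auto)
  then show ?thesis unfolding c using sum_length_filter_compl[of "\<lambda>k. 1 - x \<le> k" lam] by simp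
qed

lemma hstrip_dual:
  assumes "kap \<preceq>\<^sub>h mu"
  shows "dual mu \<preceq>\<^sub>h dual kap"
proof -
  note s = hstrip_signatures[OF assms]
  have "conjugate mu (1 - x) - conjugate kap (1 - x) = 0 \<or> conjugate mu (1 - x) - conjugate kap (1 - x) = 1" for x
    using hstrip_bits[OF assms, of "1 - x"] by auto
  then show ?thesis
    unfolding hstrip_iff[OF dual_signatures[OF s(2)] dual_signatures[OF s(1)]] conjugate_dual hstrip_length[OF assms]
    by (smt (verit))
qed

lemma fomin_square_dual:
  assumes s: "fomin_square kap mu lam nu c"
  shows "fomin_square (dual nu) (dual lam) (dual mu) (dual kap) (\<lambda>x. c (- x))"
proof -
  have h: "kap \<preceq>\<^sub>h mu" "kap \<preceq>\<^sub>h lam" "mu \<preceq>\<^sub>h nu" "lam \<preceq>\<^sub>h nu"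
    and c: "is_carry (\<lambda>x. (conjugate mu x - conjugate kap x) + (conjugate lam x - conjugate kap x)) c"
    and nu: "\<And>x. conjugate nu x = conjugate mu x + conjugate lam x - conjugate kap x + c (x - 1) - c x"
    using s by (auto simp: fomin_square_def)
  have len: "length mu = length nu" "length lam = length nu" "length kap = length nu"
    using h by (auto simp: hstrip_def)
  have nu': "conjugate nu (1 - x) = conjugate mu (1 - x) + conjugate lam (1 - x) - conjugate kap (1 - x)
      + c (- x) - c (1 - x)" for x using nu[of "1 - x"] by simp
  show ?thesis
    unfolding fomin_square_def
  proof (intro conjI allI)
    show "is_carry (\<lambda>x. (conjugate (dual lam) x - conjugate (dual nu) x)
        + (conjugate (dual mu) x - conjugate (dual nu) x)) (\<lambda>x. c (- x))"
      using is_carry_reflect[OF c hstrip_bits[OF h(1)] hstrip_bits[OF h(2)] hstrip_pair_eventually(2)[OF h(1,2)]]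
      by (simp add: conjugate_dual len nu' algebra_simps)
  qed (use h len in \<open>simp_all add: hstrip_dual conjugate_dual nu'\<close>)
qed

section \<open>Fomin fields\<close>

definition boundary :: "nat \<Rightarrow> (int \<Rightarrow> int \<Rightarrow> int list) \<Rightarrow> tableau \<times> tableau" where
  "boundary n X = (map (\<lambda>i. X (int i) 0) [0..<Suc n], map (\<lambda>i. X 0 (int i)) [0..<Suc n])"

definition translate :: "int \<Rightarrow> int \<Rightarrow> (int \<Rightarrow> int \<Rightarrow> 'a) \<Rightarrow> int \<Rightarrow> int \<Rightarrow> 'a" where
  "translate u v X = (\<lambda>x y. X (x + u) (y + v))"

lemma translate_translate: "translate u v (translate u' v' X) = translate (u + u') (v + v') X"
  by (simp add: translate_def algebra_simps)

lemma translate_0: "translate 0 0 X = X"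
  by (simp add: translate_def)

lemma cRSK_eq_boundary: "cRSK n PQ = boundary n (translate (int n) 0 (field_of n PQ))"
  and iota1_eq_boundary: "iota1 n PQ = boundary n (translate 1 0 (field_of n PQ))"
  and iota2_eq_boundary: "iota2 n PQ = boundary n (translate 0 1 (field_of n PQ))"
  by (simp_all add: cRSK_def iota1_def iota2_def boundary_def translate_def Let_def add.commute del: upt_Suc)

lemma boundary_nth:
  "i \<le> n \<Longrightarrow> fst (boundary n X) ! i = X (int i) 0" "i \<le> n \<Longrightarrow> snd (boundary n X) ! i = X 0 (int i)"
  "length (fst (boundary n X)) = Suc n" "length (snd (boundary n X)) = Suc n"
  by (auto simp: boundary_def simp del: upt_Suc)

lemma boundary_eq_iff:
  assumes "length P = Suc n" "length Q = Suc n"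
  shows "boundary n X = (P, Q) \<longleftrightarrow> (\<forall>i\<le>n. X (int i) 0 = P ! i \<and> X 0 (int i) = Q ! i)"
  using assms unfolding boundary_def by (auto simp: list_eq_iff_nth_eq less_Suc_eq_le simp del: upt_Suc)

text \<open>Membership in \<open>SST_pairs\<close> with the row length \<open>l\<close> exposed:
  \<open>fomin_field\<close> takes it as a parameter, and it is the invariant kept along
  translations and operators.\<close>

definition tableau_pair :: "nat \<Rightarrow> nat \<Rightarrow> tableau \<times> tableau \<Rightarrow> bool" where
  "tableau_pair n l = (\<lambda>(P, Q). length P = Suc n \<and> length Q = Suc n \<and>
     (\<forall>i\<le>n. P ! i \<in> signatures l \<and> Q ! i \<in> signatures l) \<and> P ! 0 = Q ! 0 \<and> P ! n = Q ! n \<and>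
     (\<forall>i<n. P ! i \<preceq>\<^sub>h P ! Suc i \<and> Q ! i \<preceq>\<^sub>h Q ! Suc i))"

lemma hstrip_signatures_iff:
  assumes "kap \<preceq>\<^sub>h mu"
  shows "kap \<in> signatures l \<longleftrightarrow> length mu = l" "mu \<in> signatures l \<longleftrightarrow> length mu = l"
  using hstrip_signatures[OF assms] hstrip_length[OF assms] by (auto simp: signatures_def)

lemma SST_signatures:
  assumes "P \<in> SST lam rho n" "rho \<in> signatures l" "i \<le> n"
  shows "P ! i \<in> signatures l"
  using assms(3)
proof (induction i)
  case (Suc i)
  then have "P ! i \<preceq>\<^sub>h P ! Suc i" using assms by (auto simp: SST_def)
  then show ?case using Suc hstrip_signatures_iff by auto
qed (use assms in \<open>auto simp: SST_def\<close>)

lemma SST_pairs_iff: "PQ \<in> SST_pairs n \<longleftrightarrow> (\<exists>l. tableau_pair n l PQ)"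
proof
  assume "PQ \<in> SST_pairs n"
  then obtain l rho lam P Q where PQ: "PQ = (P, Q)" "rho \<in> signatures l"
      "P \<in> SST lam rho n" "Q \<in> SST lam rho n"
    unfolding SST_pairs_def by blast
  then have "tableau_pair n l PQ"
    using SST_signatures[OF PQ(3,2)] SST_signatures[OF PQ(4,2)] by (auto simp: tableau_pair_def SST_def)
  then show "\<exists>l. tableau_pair n l PQ" ..
next
  assume "\<exists>l. tableau_pair n l PQ"
  then obtain l where l: "tableau_pair n l PQ" by blast
  then have "fst PQ ! 0 \<in> signatures l" "fst PQ ! n \<in> signatures l"
    "PQ \<in> SST (fst PQ ! n) (fst PQ ! 0) n \<times> SST (fst PQ ! n) (fst PQ ! 0) n"
    by (auto simp: tableau_pair_def SST_def)
  then show "PQ \<in> SST_pairs n" unfolding SST_pairs_def by blast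
qed

lemma fomin_field_tableau_pair:
  assumes "fomin_field n l X"
  shows "tableau_pair n l (boundary n X)"
proof -
  have "X (int n) 0 = X 0 (int n)"
    using assms unfolding fomin_field_def
    by (metis add_0 add_diff_cancel_right' diff_self mult_1)
  then show ?thesis
    using assms unfolding fomin_field_def tableau_pair_def case_prod_beta
    by (auto simp: boundary_nth) (metis add.commute)+
qed

lemma fomin_field_translate:
  assumes "fomin_field n l X"
  shows "fomin_field n l (translate u v X)"
proof -
  have "X (x + k * int n + u) (y - k * int n + v) = X (x + u) (y + v)" for x y k
  proof -
    have "X ((x + u) + k * int n) ((y + v) - k * int n) = X (x + u) (y + v)"
      using assms unfolding fomin_field_def by blast
    then show ?thesis by (simp add: algebra_simps)
  qed
  moreover have "X (x + 1 + u) (y + v) = X (x + u + 1) (y + v)" "X (x + u) (y + 1 + v) = X (x + u) (y + v + 1)"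
     "X (x + 1 + u) (y + 1 + v) = X (x + u + 1) (y + v + 1)" for x y
    by (simp_all add: algebra_simps)
  ultimately show ?thesis
    using assms unfolding fomin_field_def translate_def by presburger
qed

text \<open>The local rule is symmetric in its two middle arguments. Reflection in the diagonal
  exchanges the two tableaux of the boundary, so statements on the second one follow from those on
  the first.\<close>

lemma fomin_field_transpose:
  assumes "fomin_field n l X"
  shows "fomin_field n l (\<lambda>x y. X y x)"
  unfolding fomin_field_def
proof (intro conjI allI)
  fix x y k
  have "X (y + (- k) * int n) (x - (- k) * int n) = X y x"
    using assms unfolding fomin_field_def by blast
  then show "X (y - k * int n) (x + k * int n) = X y x" by simp
next
  fix x y
  show "X (y + 1) (x + 1) = fomin_rule (X y x) (X y (x + 1)) (X (y + 1) x)"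
    using assms unfolding fomin_field_def by (metis fomin_rule_commute)
qed (use assms in \<open>auto simp: fomin_field_def\<close>)

section \<open>Finite patches of a field\<close>

fun grow :: "(nat \<Rightarrow> int list) \<Rightarrow> (nat \<Rightarrow> int list) \<Rightarrow> nat \<Rightarrow> nat \<Rightarrow> int list" where
  "grow p q i 0 = p i"
| "grow p q 0 (Suc j) = q (Suc j)"
| "grow p q (Suc i) (Suc j) = fomin_rule (grow p q i j) (grow p q (Suc i) j) (grow p q i (Suc j))"

text \<open>A square patch of a field, without the periodicity. Up to periodicity, patches stacked
  on top of each other cover the whole cylinder, so existence and uniqueness of fields reduce to
  patches.\<close>

definition grid :: "nat \<Rightarrow> (nat \<Rightarrow> nat \<Rightarrow> int list) \<Rightarrow> bool" where
  "grid n G \<longleftrightarrow> (\<forall>i<n. \<forall>j\<le>n. G i j \<preceq>\<^sub>h G (Suc i) j) \<and> (\<forall>i\<le>n. \<forall>j<n. G i j \<preceq>\<^sub>h G i (Suc j))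
     \<and> (\<forall>i<n. \<forall>j<n. G (Suc i) (Suc j) = fomin_rule (G i j) (G (Suc i) j) (G i (Suc j)))"

lemma grow_0: "p 0 = q 0 \<Longrightarrow> grow p q 0 j = q j"
  by (cases j) auto

lemma grid_grow:
  assumes "\<And>i. i < n \<Longrightarrow> p i \<preceq>\<^sub>h p (Suc i)" "\<And>i. i < n \<Longrightarrow> q i \<preceq>\<^sub>h q (Suc i)" "p 0 = q 0"
  shows "grid n (grow p q)"
proof -
  let ?G = "grow p q"
  have sq: "?G (Suc i) j \<preceq>\<^sub>h ?G (Suc i) (Suc j) \<and> ?G i (Suc j) \<preceq>\<^sub>h ?G (Suc i) (Suc j)"
    if "?G i j \<preceq>\<^sub>h ?G (Suc i) j" "?G i j \<preceq>\<^sub>h ?G i (Suc j)" for i j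
    using fomin_square_rule[OF that] unfolding fomin_square_def grow.simps(3) by blast
  have up: "?G i j \<preceq>\<^sub>h ?G i (Suc j)" if "\<And>i. i < n \<Longrightarrow> ?G i j \<preceq>\<^sub>h ?G (Suc i) j" "j < n" "i \<le> n" for i j
    using that(3)
  proof (induction i)
    case 0
    then show ?case using assms that(2) by (simp add: grow_0)
  next
    case (Suc i)
    then show ?case using sq[of i j] that by auto
  qed
  have right: "\<forall>i<n. ?G i j \<preceq>\<^sub>h ?G (Suc i) j" if "j \<le> n" for j
    using that
  proof (induction j)
    case (Suc j)
    then show ?case using up[of j] sq[of _ j] by (auto simp: less_imp_le)
  qed (use assms in auto)
  show ?thesis unfolding grid_def using right up by (auto simp: less_imp_le)
qed

lemma grid_length:
  assumes "grid n G" "i \<le> n" "j \<le> n"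
  shows "length (G i j) = length (G 0 0)"
proof -
  have "length (G i j) = length (G 0 j)" using assms(2)
  proof (induction i)
    case (Suc i)
    then show ?case using assms hstrip_length[of "G i j" "G (Suc i) j"] by (simp add: grid_def)
  qed simp
  also have "\<dots> = length (G 0 0)" using assms(3)
  proof (induction j)
    case (Suc j)
    then show ?case using assms hstrip_length[of "G 0 j" "G 0 (Suc j)"] by (simp add: grid_def)
  qed simp
  finally show ?thesis .
qed

lemma grid_signatures:
  assumes "grid n G" "i \<le> n" "j \<le> n" "n \<ge> 1"
  shows "G i j \<in> signatures (length (G 0 0))"
proof (cases i)
  case 0
  then have "G i j \<preceq>\<^sub>h G (Suc i) j" using assms by (simp add: grid_def)
  then show ?thesis using grid_length[OF assms(1-3)] hstrip_signatures_iff hstrip_length by simp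
next
  case (Suc i')
  then have "G i' j \<preceq>\<^sub>h G i j" using assms by (simp add: grid_def)
  then show ?thesis using grid_length[OF assms(1-3)] hstrip_signatures_iff by simp
qed

lemma grid_eq_grow:
  assumes "grid n G" "\<And>i. i \<le> n \<Longrightarrow> p i = G i 0" "\<And>j. j \<le> n \<Longrightarrow> q j = G 0 j"
  shows "i \<le> n \<Longrightarrow> j \<le> n \<Longrightarrow> grow p q i j = G i j"
proof (induction "i + j" arbitrary: i j rule: less_induct)
  case less
  consider "j = 0" | "i = 0" "j \<noteq> 0" | i' j' where "i = Suc i'" "j = Suc j'"
    by (metis not0_implies_Suc)
  then show ?case
  proof cases
    case 3
    then have "grow p q i' j' = G i' j'" "grow p q i j' = G i j'" "grow p q i' j = G i' j"
      using less by auto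
    then show ?thesis using assms(1) less.prems 3 by (simp add: grid_def)
  qed (use assms(2,3) less.prems gr0_conv_Suc in auto)
qed

text \<open>Half a turn of the patch combined with \<open>dual\<close> replaces each square by its
  reflection, which obeys the same rule.\<close>

lemma grid_dual:
  assumes G: "grid n G"
  shows "grid n (\<lambda>i j. dual (G (n - i) (n - j)))"
  unfolding grid_def
proof (intro conjI allI impI)
  fix i j assume "i < n" "j \<le> n"
  then show "dual (G (n - i) (n - j)) \<preceq>\<^sub>h dual (G (n - Suc i) (n - j))"
    using G[unfolded grid_def, THEN conjunct1, rule_format, of "n - Suc i" "n - j"]
    by (simp add: hstrip_dual Suc_diff_Suc)
next
  fix i j assume "i \<le> n" "j < n"
  then show "dual (G (n - i) (n - j)) \<preceq>\<^sub>h dual (G (n - i) (n - Suc j))"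
    using G[unfolded grid_def, THEN conjunct2, THEN conjunct1, rule_format, of "n - i" "n - Suc j"]
    by (simp add: hstrip_dual Suc_diff_Suc)
next
  fix i j assume ij: "i < n" "j < n"
  define a b where "a = n - Suc i" and "b = n - Suc j"
  have ab: "a < n" "b < n" "n - i = Suc a" "n - j = Suc b" using ij by (auto simp: a_def b_def)
  obtain c where "fomin_square (G a b) (G (Suc a) b) (G a (Suc b)) (G (Suc a) (Suc b)) c"
    using fomin_square_rule[of "G a b" "G (Suc a) b" "G a (Suc b)"] G ab by (auto simp: grid_def)
  then show "dual (G (n - Suc i) (n - Suc j))
      = fomin_rule (dual (G (n - i) (n - j))) (dual (G (n - Suc i) (n - j))) (dual (G (n - i) (n - Suc j)))"
    using fomin_rule_eq[OF fomin_square_dual] by (simp add: ab a_def[symmetric] b_def[symmetric])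
qed

text \<open>After the half turn the top and right edges are the initial ones, and initial edges
  determine a patch.\<close>

lemma grid_inject:
  assumes G: "grid n G" and H: "grid n H"
    and top: "\<And>i. i \<le> n \<Longrightarrow> G i n = H i n" and right: "\<And>j. j \<le> n \<Longrightarrow> G n j = H n j"
    and ij: "i \<le> n" "j \<le> n"
  shows "G i j = H i j"
proof -
  let ?g = "grow (\<lambda>i. dual (G (n - i) n)) (\<lambda>j. dual (G n (n - j))) (n - i) (n - j)"
  have "?g = dual (G (n - (n - i)) (n - (n - j)))" "?g = dual (H (n - (n - i)) (n - (n - j)))"
    by (rule grid_eq_grow[OF grid_dual[OF G]] grid_eq_grow[OF grid_dual[OF H]]; simp add: top right)+
  then show ?thesis using ij by (metis diff_diff_cancel dual_dual)
qed

lemma ex_grid_top_right: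
  assumes "\<And>i. i < n \<Longrightarrow> p i \<preceq>\<^sub>h p (Suc i)" "\<And>i. i < n \<Longrightarrow> q i \<preceq>\<^sub>h q (Suc i)" "p n = q n"
  obtains G where "grid n G" "\<And>i. i \<le> n \<Longrightarrow> G i n = p i" "\<And>j. j \<le> n \<Longrightarrow> G n j = q j"
proof -
  let ?p = "\<lambda>i. dual (p (n - i))" and ?q = "\<lambda>j. dual (q (n - j))"
  have "grid n (grow ?p ?q)"
  proof (rule grid_grow)
    fix i assume "i < n"
    then show "?p i \<preceq>\<^sub>h ?p (Suc i)" "?q i \<preceq>\<^sub>h ?q (Suc i)"
      using assms(1)[of "n - Suc i"] assms(2)[of "n - Suc i"] by (simp_all add: hstrip_dual Suc_diff_Suc)
  qed (use assms(3) in simp)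
  then show thesis
    by (rule that[OF grid_dual]) (use assms(3) in \<open>simp_all add: grow_0\<close>)
qed

text \<open>The passage from one \<open>n \<times> n\<close> block of a field to the block above it.\<close>

definition block_step :: "nat \<Rightarrow> tableau \<times> tableau \<Rightarrow> tableau \<times> tableau" where
  "block_step n = (\<lambda>(P, Q). (map (\<lambda>i. grow (nth P) (nth Q) i n) [0..<Suc n],
                             map (\<lambda>j. grow (nth P) (nth Q) n j) [0..<Suc n]))"

lemma tableau_pair_grid:
  "tableau_pair n l (P, Q) \<Longrightarrow> grid n (grow (nth P) (nth Q))"
  by (rule grid_grow) (auto simp: tableau_pair_def)

lemma grid_tableau_pair:
  assumes "grid n G" "n \<ge> 1" "P = map (\<lambda>i. G i n) [0..<Suc n]" "Q = map (\<lambda>j. G n j) [0..<Suc n]"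
    and eq: "G n 0 = G 0 n"
  shows "tableau_pair n (length (G 0 0)) (P, Q)"
  unfolding tableau_pair_def assms(3,4) using assms(1,2) eq grid_signatures[OF assms(1)]
  by (auto simp: grid_def simp del: upt_Suc)

lemma grid_tableau_pair':
  assumes "grid n G" "n \<ge> 1" "P = map (\<lambda>i. G i 0) [0..<Suc n]" "Q = map (\<lambda>j. G 0 j) [0..<Suc n]"
    and eq: "G n 0 = G 0 n"
  shows "tableau_pair n (length (G 0 0)) (P, Q)"
  unfolding tableau_pair_def assms(3,4) using assms(1,2) eq grid_signatures[OF assms(1)]
  by (auto simp: grid_def simp del: upt_Suc)

lemma block_step_tableau_pair:
  assumes "tableau_pair n l PQ" "n \<ge> 1"
  shows "tableau_pair n l (block_step n PQ)"
proof -
  obtain P Q where PQ: "PQ = (P, Q)" by (cases PQ)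
  have g: "grid n (grow (nth P) (nth Q))" using tableau_pair_grid assms PQ by blast
  have "grow (nth P) (nth Q) n 0 = grow (nth P) (nth Q) 0 n" "length (grow (nth P) (nth Q) 0 0) = l"
    using assms unfolding PQ by (auto simp: tableau_pair_def grow_0 signatures_def)
  then show ?thesis using grid_tableau_pair[OF g assms(2) refl refl] by (simp add: PQ block_step_def)
qed

lemma block_step_surj:
  assumes "tableau_pair n l PQ" "n \<ge> 1"
  obtains PQ' where "tableau_pair n l PQ'" "block_step n PQ' = PQ"
proof -
  obtain P Q where PQ: "PQ = (P, Q)" by (cases PQ)
  obtain G where G: "grid n G" "\<And>i. i \<le> n \<Longrightarrow> G i n = P ! i" "\<And>j. j \<le> n \<Longrightarrow> G n j = Q ! j"
    using ex_grid_top_right[of n "nth P" "nth Q"] assms unfolding PQ tableau_pair_def by auto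
  define P' where "P' = map (\<lambda>i. G i 0) [0..<Suc n]"
  define Q' where "Q' = map (\<lambda>j. G 0 j) [0..<Suc n]"
  have nth: "P' ! i = G i 0" "Q' ! i = G 0 i" if "i \<le> n" for i
    using that by (auto simp: P'_def Q'_def simp del: upt_Suc)
  have "G n 0 = G 0 n" using G(2)[of 0] G(3)[of 0] assms by (simp add: PQ tableau_pair_def)
  moreover have "length (G 0 0) = l"
    using grid_length[OF G(1), of n n] G(2)[of n] assms by (simp add: PQ tableau_pair_def signatures_def)
  ultimately have "tableau_pair n l (P', Q')"
    using grid_tableau_pair'[OF G(1) assms(2) P'_def Q'_def] by simp
  moreover have "block_step n (P', Q') = PQ"
    using grid_eq_grow[OF G(1) nth] G(2,3) assms
    by (auto simp: PQ block_step_def tableau_pair_def list_eq_iff_nth_eq less_Suc_eq_le simp del: upt_Suc)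
  ultimately show thesis by (rule that)
qed

lemma block_step_inject:
  assumes "tableau_pair n l PQ" "tableau_pair n l' PQ'" "block_step n PQ = block_step n PQ'"
  shows "PQ = PQ'"
proof -
  obtain P Q P' Q' where PQ: "PQ = (P, Q)" "PQ' = (P', Q')" by (cases PQ, cases PQ')
  let ?G = "grow (nth P) (nth Q)" and ?H = "grow (nth P') (nth Q')"
  have "?G i n = ?H i n \<and> ?G n i = ?H n i" if "i \<le> n" for i
    using assms(3) that by (auto simp: PQ block_step_def simp del: upt_Suc)
  then have eq: "?G i j = ?H i j" if "i \<le> n" "j \<le> n" for i j
    using grid_inject[of n ?G ?H] tableau_pair_grid assms(1,2) that unfolding PQ by blast
  have "P ! i = P' ! i" "Q ! i = Q' ! i" if "i \<le> n" for i
    using eq[of i 0] eq[of 0 i] that assms(1,2) by (auto simp: PQ tableau_pair_def grow_0)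
  then show ?thesis using assms(1,2) unfolding PQ tableau_pair_def
    by (auto simp: list_eq_iff_nth_eq less_Suc_eq_le)
qed

lemma fomin_field_block:
  assumes X: "fomin_field n l X"
  shows "i \<le> n \<Longrightarrow> j \<le> n \<Longrightarrow>
      grow (nth (fst (boundary n X))) (nth (snd (boundary n X))) i j = X (int i) (int j)"
    and "block_step n (boundary n X) = boundary n (translate 0 (int n) X)"
proof -
  have g: "grid n (\<lambda>i j. X (int i) (int j))"
    using X unfolding grid_def fomin_field_def of_nat_Suc add.commute[of 1] by blast
  show *: "grow (nth (fst (boundary n X))) (nth (snd (boundary n X))) i j = X (int i) (int j)"
    if "i \<le> n" "j \<le> n" for i j
    by (rule grid_eq_grow[OF g _ _ that]) (auto simp: boundary_nth)
  \<comment> \<open>On the cylinder \<open>(0, j + n)\<close> and \<open>(n, j)\<close> coincide: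
    the right edge of a block is the left edge of the block above it.\<close>
  have "X (0 + 1 * int n) (int j + int n - 1 * int n) = X 0 (int j + int n)" for j
    using X unfolding fomin_field_def by blast
  then show "block_step n (boundary n X) = boundary n (translate 0 (int n) X)"
    using * unfolding block_step_def case_prod_beta
    by (subst (5) boundary_def) (auto simp: translate_def less_Suc_eq_le simp del: upt_Suc)
qed

section \<open>Existence and uniqueness of the field with a given boundary\<close>

text \<open>The block step is injective, so equality on one block spreads downwards as well as
  upwards through the strip \<open>0 \<le> x \<le> n\<close>; the periodicity moves every point into
  this strip.\<close>

lemma fomin_field_unique:
  assumes X: "fomin_field n l X" "fomin_field n l' X'" "boundary n X = boundary n X'" and n: "n \<ge> 1"
  shows "X = X'"
proof -
  define s where "s X k = boundary n (translate 0 (k * int n) X)" for X k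
  have tr: "tableau_pair n l (s X k)" "tableau_pair n l' (s X' k)" for k
    using X by (auto simp: s_def intro: fomin_field_tableau_pair fomin_field_translate)
  have step: "s G (k + 1) = block_step n (s G k)" if "fomin_field n m G" for G m k
    using fomin_field_block(2)[OF fomin_field_translate[OF that]]
    by (simp add: s_def translate_translate algebra_simps)
  have s: "s X k = s X' k" for k
  proof (induction k rule: int_induct[of _ 0])
    case base then show ?case using X(3) by (simp add: s_def translate_0)
  next
    case (step1 k) then show ?case using step X by metis
  next
    case (step2 k)
    show ?case using step[OF X(1), of "k - 1"] step[OF X(2), of "k - 1"] step2
      block_step_inject[OF tr(1)[of "k - 1"] tr(2)[of "k - 1"]] by simp
  qed
  have eq: "X x y = X' x y" for x y
  proof -
    \<comment> \<open>\<open>(x, y)\<close> is the same point of the cylinder as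
      \<open>(x - q * n, t)\<close>, and the first coordinate of the latter is
      \<open>i\<close>.\<close>
    define q t where "q = x div int n" and "t = y + q * int n"
    define i j where "i = nat (x mod int n)" and "j = nat (t mod int n)"
    have ij: "i \<le> n" "j \<le> n" "int i = x - q * int n" "int j + (t div int n) * int n = t"
      using n by (auto simp: i_def j_def q_def nat_le_iff less_imp_le minus_div_mult_eq_mod)
    have val: "G x y = translate 0 ((t div int n) * int n) G (int i) (int j)" if "fomin_field n m G" for G m
    proof -
      have "G (x - q * int n + q * int n) (y + q * int n - q * int n) = G (x - q * int n) (y + q * int n)"
        using that unfolding fomin_field_def by blast
      then have "G x y = G (x - q * int n) t" by (simp add: t_def)
      then show ?thesis by (simp add: translate_def ij)
    qed
    show ?thesis
      using val[OF X(1)] val[OF X(2)] fomin_field_block(1)[OF fomin_field_translate[OF X(1)] ij(1,2)]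
        fomin_field_block(1)[OF fomin_field_translate[OF X(2)] ij(1,2)] s[of "t div int n"]
      by (metis s_def)
  qed
  show ?thesis using eq by blast
qed

lemma ex_fomin_field:
  assumes PQ: "tableau_pair n l PQ" and n: "n \<ge> 1"
  obtains X where "fomin_field n l X" "boundary n X = PQ"
proof -
  \<comment> \<open>Going down needs preimages under the block step. They exist because a patch can
    be grown from its top and right edges; \<open>D\<close> chooses them within the pairs of row
    length \<open>l\<close>.\<close>
  obtain D where D: "\<And>X. tableau_pair n l X \<Longrightarrow> tableau_pair n l (D X) \<and> block_step n (D X) = X"
  proof -
    have "\<forall>X. \<exists>Y. tableau_pair n l X \<longrightarrow> tableau_pair n l Y \<and> block_step n Y = X"
      using block_step_surj[OF _ n] by blast
    from choice[OF this] obtain D' where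
      "\<forall>X. tableau_pair n l X \<longrightarrow> tableau_pair n l (D' X) \<and> block_step n (D' X) = X" ..
    then show thesis by (intro that) blast
  qed
  define s where "s k = (if k \<ge> 0 then (block_step n ^^ nat k) PQ else (D ^^ nat (- k)) PQ)" for k :: int
  have s_pair: "tableau_pair n l (s k)" for k
  proof -
    have "tableau_pair n l ((block_step n ^^ m) PQ)" "tableau_pair n l ((D ^^ m) PQ)" for m
      by (induction m) (use PQ D n block_step_tableau_pair in auto)
    then show ?thesis by (simp add: s_def)
  qed
  have s_step: "s (k + 1) = block_step n (s k)" for k
  proof -
    consider "k \<ge> 0" | "k = -1" | "k < -1" by linarith
    then show ?thesis
    proof cases
      case 3
      then have "nat (- k) = Suc (nat (- (k + 1)))" by linarith
      then have "s k = D (s (k + 1))" using 3 by (simp add: s_def)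
      then show ?thesis using D[OF s_pair[of "k + 1"]] by simp
    qed (auto simp: s_def D PQ nat_add_distrib)
  qed
  define G where "G k = grow (nth (fst (s k))) (nth (snd (s k)))" for k
  have G_grid: "grid n (G k)" for k
    using tableau_pair_grid[of n l "fst (s k)" "snd (s k)"] s_pair[of k] by (simp add: G_def)
  have s_nth: "fst (s k) ! i = G k i 0" "snd (s k) ! i = G k 0 i" if "i \<le> n" for k i
    using s_pair[of k] by (auto simp: G_def grow_0 tableau_pair_def case_prod_beta)
  have s_nth': "fst (s (k + 1)) ! i = G k i n" "snd (s (k + 1)) ! i = G k n i" if "i \<le> n" for k i
    using that by (auto simp: G_def s_step block_step_def case_prod_beta simp del: upt_Suc)
  define X where "X x y = (let t = y + (x div int n) * int n in
      G (t div int n) (nat (x mod int n)) (nat (t mod int n)))" for x y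
  \<comment> \<open>The definition of \<open>X\<close> uses representatives with
    \<open>i < n\<close> and \<open>j < n\<close>. The values \<open>i = n\<close> and
    \<open>j = n\<close> are read in the next block, and agree because consecutive blocks share an
    edge.\<close>
  have X_eq: "X (q * int n + int i) (k * int n - q * int n + int j) = G k i j"
    if "i \<le> n" "j \<le> n" for q k i j
  proof -
    have *: "X (q * int n + int i) (k * int n - q * int n + int j) = G k i j" if "i < n" "j < n" for q k i j
      using that by (simp add: X_def Let_def)
    have **: "X (q * int n + int i) (k * int n - q * int n + int j) = G k i j" if "i < n" "j \<le> n" for q k i j
    proof (cases "j = n")
      case True
      have "X (q * int n + int i) ((k + 1) * int n - q * int n + int 0) = G (k + 1) i 0"
        by (rule *) (use that n in auto)
      then show ?thesis using True s_nth(1)[of i "k + 1"] s_nth'(1)[of i k] that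
        by (simp add: algebra_simps)
    qed (use * that in auto)
    show ?thesis
    proof (cases "i = n")
      case True
      have "X ((q + 1) * int n + int 0) ((k + 1) * int n - (q + 1) * int n + int j) = G (k + 1) 0 j"
        by (rule **) (use that n in auto)
      then show ?thesis using True s_nth(2)[of j "k + 1"] s_nth'(2)[of j k] that
        by (simp add: algebra_simps)
    qed (use ** that in auto)
  qed
  have coords: "\<exists>q k i j. i < n \<and> j < n \<and> x = q * int n + int i \<and> y = k * int n - q * int n + int j" for x y
  proof -
    let ?q = "x div int n" let ?t = "y + ?q * int n"
    have "nat (x mod int n) < n" "nat (?t mod int n) < n" using n by (auto simp: nat_less_iff)
    moreover have "x = ?q * int n + int (nat (x mod int n))"
      "y = (?t div int n) * int n - ?q * int n + int (nat (?t mod int n))"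
      using n by (auto simp: algebra_simps)
    ultimately show ?thesis by blast
  qed
  have "fomin_field n l X"
    unfolding fomin_field_def
  proof (intro conjI allI)
    fix x y k
    show "X (x + k * int n) (y - k * int n) = X x y" using n by (simp add: X_def algebra_simps)
  next
    fix x y
    obtain q k i j where ij: "i < n" "j < n"
      and x: "x = q * int n + int i" and y: "y = k * int n - q * int n + int j" using coords by blast
    have x1: "x + 1 = q * int n + int (Suc i)" and y1: "y + 1 = k * int n - q * int n + int (Suc j)"
      by (simp_all add: x y)
    have vals: "X x y = G k i j" "X (x + 1) y = G k (Suc i) j" "X x (y + 1) = G k i (Suc j)"
      "X (x + 1) (y + 1) = G k (Suc i) (Suc j)"
      unfolding x1 y1 unfolding x y using ij by (intro conjI X_eq; simp)+
    have "length (G k 0 0) = l"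
      using s_nth(1)[of 0 k] s_pair[of k] by (auto simp: tableau_pair_def signatures_def case_prod_beta)
    then show "X x y \<in> signatures l" using grid_signatures[OF G_grid[of k], of i j] ij vals by simp
    show "X x y \<preceq>\<^sub>h X (x + 1) y" "X x y \<preceq>\<^sub>h X x (y + 1)"
      "X (x + 1) (y + 1) = fomin_rule (X x y) (X (x + 1) y) (X x (y + 1))"
      unfolding vals using G_grid[of k] ij by (auto simp: grid_def)
  qed
  moreover have "boundary n X = PQ"
  proof -
    have "X (int i) 0 = fst PQ ! i \<and> X 0 (int i) = snd PQ ! i" if "i \<le> n" for i
      using X_eq[of i 0 0 0] X_eq[of 0 i 0 0] that s_nth[OF that, of 0] by (simp add: s_def)
    then show ?thesis using boundary_eq_iff[of "fst PQ" n "snd PQ" X] PQ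
      by (simp add: tableau_pair_def case_prod_beta)
  qed
  ultimately show thesis by (rule that)
qed

lemma field_of_eq:
  assumes X: "fomin_field n l X" "boundary n X = PQ" and n: "n \<ge> 1"
  shows "field_of n PQ = X"
proof -
  obtain P Q where PQ: "PQ = (P, Q)" by (cases PQ)
  have pair: "tableau_pair n l (P, Q)" using fomin_field_tableau_pair[OF X(1)] X(2) PQ by simp
  then have len: "length P = Suc n" "length Q = Suc n" "length (P ! 0) = l"
    by (auto simp: tableau_pair_def signatures_def)
  show ?thesis
    unfolding PQ field_of_def case_prod_conv boundary_eq_iff[OF len(1,2), symmetric] len(3)
    using X PQ fomin_field_unique n by (intro the_equality) (simp, metis)
qed

lemma fomin_field_field_of:
  assumes "tableau_pair n l PQ" "n \<ge> 1"
  shows "fomin_field n l (field_of n PQ)" "boundary n (field_of n PQ) = PQ"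
  using ex_fomin_field[OF assms] field_of_eq assms(2) by metis+

section \<open>Raising operators and the local rule\<close>

text \<open>A second difference of truncated row lengths. Since columns may be negative, cells
  cannot be counted from a fixed left end; far to the left, however, the three terms of each row are
  \<open>x\<close>, \<open>- 2 * x\<close> and \<open>x\<close>, and cancel.\<close>

definition excess :: "int list \<Rightarrow> int list \<Rightarrow> int list \<Rightarrow> int \<Rightarrow> int" where
  "excess kap mu lam x = (\<Sum>j<length mu. min (lam ! j) x - 2 * min (mu ! j) x + min (kap ! j) x)"

lemma sum_min_diff:
  "(\<Sum>j<length lam. min (lam ! j) x) - (\<Sum>j<length lam. min (lam ! j) (x - 1)) = conjugate lam x"
proof -
  have "(\<Sum>j<length lam. min (lam ! j) x) - (\<Sum>j<length lam. min (lam ! j) (x - 1))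
      = (\<Sum>j<length lam. of_bool (x \<le> lam ! j))"
    unfolding sum_subtractf[symmetric] by (rule sum.cong) auto
  also have "\<dots> = int (card {j \<in> {..<length lam}. x \<le> lam ! j})"
    by (simp add: of_bool_def sum.If_cases Int_def)
  also have "{j \<in> {..<length lam}. x \<le> lam ! j} = {j. j < length lam \<and> x \<le> lam ! j}" by auto
  finally show ?thesis by (simp add: conjugate_def)
qed

lemma excess_diff:
  assumes "length kap = length mu" "length lam = length mu"
  shows "excess kap mu lam x - excess kap mu lam (x - 1)
    = (conjugate lam x - conjugate mu x) - (conjugate mu x - conjugate kap x)"
proof -
  have "excess kap mu lam y = (\<Sum>j<length lam. min (lam ! j) y)
      - 2 * (\<Sum>j<length mu. min (mu ! j) y) + (\<Sum>j<length kap. min (kap ! j) y)" for y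
    unfolding excess_def assms sum.distrib sum_subtractf sum_distrib_left[symmetric] by simp
  then show ?thesis
    using sum_min_diff[of lam x] sum_min_diff[of mu x] sum_min_diff[of kap x] by simp
qed

lemma excess_low:
  assumes "length kap = length mu" "length lam = length mu"
    "\<And>k. k \<in> set lam \<union> set mu \<union> set kap \<Longrightarrow> x \<le> k"
  shows "excess kap mu lam x = 0"
proof -
  have "min (lam ! j) x - 2 * min (mu ! j) x + min (kap ! j) x = 0" if "j < length mu" for j
    using assms(3)[of "lam ! j"] assms(3)[of "mu ! j"] assms(3)[of "kap ! j"] assms(1,2) that by simp
  then show ?thesis unfolding excess_def by simp
qed

text \<open>Reading a semistandard tableau by columns, \<open>excess\<close> is the
  number of letters \<open>i + 1\<close> minus the number of letters \<open>i\<close> in the columns up to \<open>x\<close>; the unmatched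
  opening bracket that is changed sits in column \<open>x0\<close>, right after the last minimum.\<close>

definition raises_at :: "(int \<Rightarrow> int) \<Rightarrow> int \<Rightarrow> bool" where
  "raises_at A x0 \<longleftrightarrow> (\<forall>x. A (x0 - 1) \<le> A x) \<and> (\<forall>x\<ge>x0. A (x0 - 1) < A x)"

text \<open>The effect of \<open>e_i\<close> on the middle one of three consecutive signatures: the
  letter \<open>i + 1\<close> in column \<open>x0\<close> becomes \<open>i\<close>. The relation can
  also be read backwards, as \<open>f_i\<close> applied to \<open>mu'\<close>.\<close>

definition raises :: "int list \<Rightarrow> int list \<Rightarrow> int list \<Rightarrow> int list \<Rightarrow> bool" where
  "raises kap mu lam mu' \<longleftrightarrow> kap \<preceq>\<^sub>h mu \<and> mu \<preceq>\<^sub>h lam \<and> kap \<preceq>\<^sub>h mu' \<and> mu' \<preceq>\<^sub>h lam \<and>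
     (\<exists>x0. (\<forall>x. conjugate mu' x = conjugate mu x + of_bool (x = x0)) \<and> raises_at (excess kap mu lam) x0)"

text \<open>The pair of carries \<open>(c, d)\<close> is a row of letters \<open>i\<close>, \<open>i + 1\<close> travelling to the
  right. Between the change in the input at \<open>x0\<close> and the change in the output at \<open>x1\<close> the unmatched
  bracket sits in that row, where the change turns \<open>(c, d)\<close> into \<open>(c + 1, d - 1)\<close>.\<close>

lemma carry_raises:
  fixes a1 a2 b c d c' d' A :: "int \<Rightarrow> int"
  assumes bits: "\<And>x. a1 x \<in> {0, 1}" "\<And>x. a2 x \<in> {0, 1}" "\<And>x. b x \<in> {0, 1}"
    and c: "is_carry (\<lambda>x. a1 x + b x) c"
    and d: "is_carry (\<lambda>x. a2 x + (b x + c (x - 1) - c x)) d"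
    and c': "is_carry (\<lambda>x. (a1 x + of_bool (x = x0)) + b x) c'"
    and d': "is_carry (\<lambda>x. (a2 x - of_bool (x = x0)) + (b x + c' (x - 1) - c' x)) d'"
    and top: "\<forall>\<^sub>F x in at_top. d x = 0"
    and a0: "a1 x0 = 0" "a2 x0 = 1"
    and A: "\<And>x. A x - A (x - 1) = a2 x - a1 x" and A0: "raises_at A x0"
  obtains x1 where
    "\<And>x. (a1 x + of_bool (x = x0)) + c' (x - 1) - c' x = (a1 x + c (x - 1) - c x) + of_bool (x = x1)"
    "\<And>x. (a2 x - of_bool (x = x0)) + d' (x - 1) - d' x = (a2 x + d (x - 1) - d x) - of_bool (x = x1)"
    "\<And>x. b x + c' (x - 1) - c' x + d' (x - 1) - d' x = b x + c (x - 1) - c x + d (x - 1) - d x"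
    "raises_at (\<lambda>x. A x + c x - d x) x1"
proof -
  note crec = is_carry_rec[OF c] and drec = is_carry_rec[OF d]
    and c'rec = is_carry_rec[OF c'] and d'rec = is_carry_rec[OF d']
    and c0 = is_carry_nonneg[OF c] and d0 = is_carry_nonneg[OF d]
    and c'0 = is_carry_nonneg[OF c'] and d'0 = is_carry_nonneg[OF d']
  define m where "m = A (x0 - 1)"
  have mA: "m \<le> A x" for x using A0 by (simp add: m_def raises_at_def)
  have mA': "m + 1 \<le> A x" if "x0 \<le> x" for x
    using A0 that unfolding m_def raises_at_def by (metis zless_imp_add1_zle)
  have bits': "a1 x = 0 \<or> a1 x = 1" "a2 x = 0 \<or> a2 x = 1" "b x = 0 \<or> b x = 1" for x
    using bits[of x] by auto
  obtain N where N: "\<And>x. x \<le> N \<Longrightarrow> c x = 0 \<and> d x = 0 \<and> c' x = 0 \<and> d' x = 0"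
  proof -
    have "\<forall>\<^sub>F x in at_bot. c x = 0 \<and> d x = 0 \<and> c' x = 0 \<and> d' x = 0"
      using c d c' d' unfolding is_carry_def eventually_conj_iff by blast
    then show thesis using that by (auto simp: eventually_at_bot_linorder)
  qed
  have induct: "Q x" if "\<And>x. x \<le> N \<Longrightarrow> Q x" "\<And>x. Q (x - 1) \<Longrightarrow> Q x" for Q :: "int \<Rightarrow> bool" and x
  proof (cases "N \<le> x")
    case True
    then show ?thesis
    proof (induction x rule: int_ge_induct)
      case (step x)
      then show ?case using that(2)[of "x + 1"] by simp
    qed (use that in auto)
  qed (use that in auto)
  have d_le: "d x \<le> A x - m" for x
  proof (induction x rule: induct)
    case (1 x) then show ?case using N[OF 1] mA[of x] by simp
  next
    case (2 x)
    then show ?case using A[of x] mA[of x] drec[of x] crec[of x] bits'[of x] c0[of "x - 1"] by (auto simp: max_def split: if_splits)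
  qed
  \<comment> \<open>\<open>A'\<close> is the excess after the change, two lower from
    \<open>x0\<close> on, and its minimum is \<open>m - 1\<close>. The resulting bound on
    \<open>d'\<close> gives the strict inequality from \<open>x1\<close> on, where \<open>d'\<close>
    and \<open>d\<close> agree.\<close>
  define A' where "A' x = A x - (if x0 \<le> x then 2 else 0)" for x
  have A': "A' x - A' (x - 1) = (a2 x - of_bool (x = x0)) - (a1 x + of_bool (x = x0))" for x
    using A[of x] by (auto simp: A'_def)
  have mA'': "m - 1 \<le> A' x" for x using mA[of x] mA'[of x] by (auto simp: A'_def)
  have d'_le: "d' x \<le> A' x - (m - 1)" for x
  proof (induction x rule: induct)
    case (1 x) then show ?case using N[OF 1] mA''[of x] by simp
  next
    case (2 x)
    then show ?case using A'[of x] mA''[of x] d'rec[of x] c'rec[of x] bits'[of x] c'0[of "x - 1"] a0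
      by (cases "x = x0") (auto simp: max_def split: if_splits)
  qed
  have before: "x < x0 \<longrightarrow> c' x = c x \<and> d' x = d x" for x
  proof (induction x rule: induct)
    case (1 x) then show ?case using N[OF 1] by simp
  next
    case (2 x) then show ?case using crec[of x] c'rec[of x] drec[of x] d'rec[of x] by simp
  qed
  \<comment> \<open>Equality in the bound on \<open>d\<close> records that the unmatched bracket is
    among the \<open>d x\<close> letters carried. As \<open>A x > m\<close> from \<open>x0\<close>
    on, \<open>d x\<close> is positive, so there is a unit to exchange.\<close>
  define pending where "pending x \<longleftrightarrow> c' x = c x + 1 \<and> d' x = d x - 1 \<and> d x = A x - m" for x
  define out where "out e x \<longleftrightarrow>
    (a1 x + of_bool (x = x0)) + c' (x - 1) - c' x = (a1 x + c (x - 1) - c x) + e \<and>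
    (a2 x - of_bool (x = x0)) + d' (x - 1) - d' x = (a2 x + d (x - 1) - d x) - e \<and>
    b x + c' (x - 1) - c' x + d' (x - 1) - d' x = b x + c (x - 1) - c x + d (x - 1) - d x" for e x
  define switch where "switch x \<longleftrightarrow> out 1 x \<and> c' x = c x \<and> d' x = d x \<and> A (x - 1) + c (x - 1) - d (x - 1) = m" for x
  have start: "pending x0 \<and> out 0 x0 \<or> switch x0"
  proof -
    have "d (x0 - 1) = 0" using d_le[of "x0 - 1"] d0[of "x0 - 1"] by (simp add: m_def)
    moreover have "b x0 + c (x0 - 1) = 0 \<or> b x0 + c (x0 - 1) \<ge> 1" "b x0 \<ge> 0"
      using c0[of "x0 - 1"] bits'(3)[of x0] by auto
    ultimately show ?thesis
      using before[of "x0 - 1"] crec[of x0] c'rec[of x0] drec[of x0] d'rec[of x0] a0 A[of x0] c0[of "x0 - 1"]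
      unfolding pending_def out_def switch_def m_def by (elim disjE) simp_all
  qed
  have advance: "pending x \<and> out 0 x \<or> switch x" if "pending (x - 1)" "x0 < x" for x
  proof -
    have "A x \<ge> m + 1" using mA' that by simp
    then show ?thesis
      using that crec[of x] c'rec[of x] drec[of x] d'rec[of x] A[of x] c0[of "x - 1"] bits'[of x]
      unfolding pending_def out_def switch_def by (auto simp: max_def split: if_splits)
  qed
  \<comment> \<open>A bracket that never got off would keep \<open>d\<close> positive arbitrarily
    far to the right.\<close>
  have "\<exists>x1\<ge>x0. switch x1"
  proof (rule ccontr)
    assume no: "\<not> ?thesis"
    have "pending x" if "x0 \<le> x" for x
      using that
    proof (induction x rule: int_ge_induct)
      case base then show ?case using start no by auto
    next
      case (step x) then show ?case using advance[of "x + 1"] no by auto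
    qed
    then have "d x \<ge> 1" if "x0 \<le> x" for x using mA'[of x] that by (auto simp: pending_def)
    moreover obtain M where "\<And>x. M \<le> x \<Longrightarrow> d x = 0" using top by (auto simp: eventually_at_top_linorder)
    ultimately show False by (metis max.cobounded1 max.cobounded2 not_one_le_zero)
  qed
  then obtain x1 where x1: "x0 \<le> x1" "switch x1" "\<And>x. x0 \<le> x \<Longrightarrow> x < x1 \<Longrightarrow> \<not> switch x"
  proof -
    assume "\<exists>x1\<ge>x0. switch x1"
    then obtain k where "switch (x0 + int k)" by (metis zle_iff_zadd)
    define k0 where "k0 = (LEAST k. switch (x0 + int k))"
    have k0: "switch (x0 + int k0)" unfolding k0_def using \<open>switch (x0 + int k)\<close> by (rule LeastI)
    have "\<not> switch x" if "x0 \<le> x" "x < x0 + int k0" for x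
      using not_less_Least[of "nat (x - x0)" "\<lambda>k. switch (x0 + int k)"] that unfolding k0_def[symmetric] by auto
    with k0 show thesis by (intro that[of "x0 + int k0"]) auto
  qed
  have pend: "x < x1 \<longrightarrow> pending x \<and> out 0 x" if "x0 \<le> x" for x
    using that
  proof (induction x rule: int_ge_induct)
    case base then show ?case using start x1 by auto
  next
    case (step x) then show ?case using advance[of "x + 1"] x1 by auto
  qed
  have after: "c' x = c x \<and> d' x = d x" if "x1 \<le> x" for x
    using that
  proof (induction x rule: int_ge_induct)
    case base then show ?case using x1 by (simp add: switch_def)
  next
    case (step x)
    then show ?case using crec[of "x + 1"] c'rec[of "x + 1"] drec[of "x + 1"] d'rec[of "x + 1"] x1(1) by simp
  qed
  have "out (of_bool (x = x1)) x" for x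
  proof -
    consider "x < x0" | "x0 \<le> x" "x < x1" | "x = x1" | "x1 < x" by linarith
    then show ?thesis
    proof cases
      case 1 then show ?thesis using before[of x] before[of "x - 1"] x1(1) by (simp add: out_def)
    next
      case 2 then show ?thesis using pend[of x] by simp
    next
      case 3 then show ?thesis using x1 by (simp add: switch_def)
    next
      case 4 then show ?thesis using after[of x] after[of "x - 1"] x1(1) by (simp add: out_def)
    qed
  qed
  moreover have "raises_at (\<lambda>x. A x + c x - d x) x1"
    unfolding raises_at_def
  proof (intro conjI allI impI)
    have m1: "A (x1 - 1) + c (x1 - 1) - d (x1 - 1) = m" using x1 by (simp add: switch_def)
    fix x
    show "A (x1 - 1) + c (x1 - 1) - d (x1 - 1) \<le> A x + c x - d x"
      using m1 d_le[of x] c0[of x] by simp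
    show "A (x1 - 1) + c (x1 - 1) - d (x1 - 1) < A x + c x - d x" if "x1 \<le> x"
      using m1 d'_le[of x] after[OF that] x1(1) that c0[of x] by (simp add: A'_def)
  qed
  ultimately show thesis using that by (simp add: out_def)
qed

lemma excess_eqI:
  assumes "length kap = length mu" "length lam = length mu"
    and A: "\<And>x. A x - A (x - 1) = (conjugate lam x - conjugate mu x) - (conjugate mu x - conjugate kap x)"
    and A0: "\<forall>\<^sub>F x in at_bot. A x = 0"
  shows "A = excess kap mu lam"
proof
  fix x
  have "\<forall>\<^sub>F x in at_bot. \<forall>k \<in> set lam \<union> set mu \<union> set kap. x \<le> k"
    by (subst eventually_ball_finite) (auto simp: eventually_le_at_bot)
  then have "\<forall>\<^sub>F x in at_bot. excess kap mu lam x = 0"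
    by eventually_elim (use assms in \<open>auto intro!: excess_low\<close>)
  then have "\<forall>\<^sub>F x in at_bot. A x = excess kap mu lam x" using A0 by eventually_elim simp
  then obtain N where N: "\<And>x. x \<le> N \<Longrightarrow> A x = excess kap mu lam x"
    by (auto simp: eventually_at_bot_linorder)
  show "A x = excess kap mu lam x"
  proof (cases "N \<le> x")
    case True
    then show ?thesis
    proof (induction x rule: int_ge_induct)
      case (step x)
      then show ?case using A[of "x + 1"] excess_diff[OF assms(1,2), of "x + 1"] by simp
    qed (simp add: N)
  qed (simp add: N)
qed

text \<open>The edge from \<open>mu\<close> to \<open>mu1\<close> is an output of the first square
  and an input of the second, which accounts for the input bits \<open>b x + c (x - 1) - c x\<close>
  of the carry \<open>d\<close>. The output bits over the far edge do not change, hence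
  \<open>lam1' = lam1\<close>, and the change does not leave its column of the field.\<close>

lemma fomin_square_raises:
  assumes r: "raises kap mu lam mu'"
    and s1: "fomin_square kap mu kap1 mu1 c" and s2: "fomin_square mu lam mu1 lam1 d"
    and s1': "fomin_square kap mu' kap1 mu1' c'" and s2': "fomin_square mu' lam mu1' lam1' d'"
  shows "lam1' = lam1 \<and> raises kap1 mu1 lam1 mu1'"
proof -
  obtain x0 where x0: "\<And>x. conjugate mu' x = conjugate mu x + of_bool (x = x0)"
      and e: "raises_at (excess kap mu lam) x0"
    and h: "kap \<preceq>\<^sub>h mu" "mu \<preceq>\<^sub>h lam" "kap \<preceq>\<^sub>h mu'" "mu' \<preceq>\<^sub>h lam" using r by (auto simp: raises_def)
  have h1: "kap \<preceq>\<^sub>h kap1" "kap1 \<preceq>\<^sub>h mu1" "mu1 \<preceq>\<^sub>h lam1" "kap1 \<preceq>\<^sub>h mu1'" "mu1' \<preceq>\<^sub>h lam1'"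
    using s1 s2 s1' s2' by (auto simp: fomin_square_def)
  have len: "length kap = length mu" "length lam = length mu" "length kap1 = length mu" "length mu1 = length mu"
    "length lam1 = length mu" "length mu1' = length mu" "length lam1' = length mu"
    using h h1 s1 s2 s1' s2' by (auto simp: fomin_square_def hstrip_def)
  let ?a1 = "\<lambda>x. conjugate mu x - conjugate kap x" and ?a2 = "\<lambda>x. conjugate lam x - conjugate mu x"
  let ?b = "\<lambda>x. conjugate kap1 x - conjugate kap x"
  have mu1: "conjugate mu1 x = conjugate mu x + ?b x + c (x - 1) - c x" for x
    using s1 by (simp add: fomin_square_def)
  have lam1: "conjugate lam1 x = conjugate lam x + conjugate mu1 x - conjugate mu x + d (x - 1) - d x" for x
    using s2 by (simp add: fomin_square_def)
  have mu1': "conjugate mu1' x = conjugate mu' x + ?b x + c' (x - 1) - c' x" for x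
    using s1' by (simp add: fomin_square_def)
  have lam1': "conjugate lam1' x = conjugate lam x + conjugate mu1' x - conjugate mu' x + d' (x - 1) - d' x" for x
    using s2' by (simp add: fomin_square_def)
  have cs: "is_carry (\<lambda>x. ?a1 x + ?b x) c" "is_carry (\<lambda>x. ?a2 x + (?b x + c (x - 1) - c x)) d"
     "is_carry (\<lambda>x. (?a1 x + of_bool (x = x0)) + ?b x) c'"
     "is_carry (\<lambda>x. (?a2 x - of_bool (x = x0)) + (?b x + c' (x - 1) - c' x)) d'"
    using s1 s2 s1' s2' unfolding fomin_square_def mu1 mu1' x0 by (simp_all add: algebra_simps)
  have top: "\<forall>\<^sub>F x in at_top. d x = 0"
    using is_carry_at_top s2 hstrip_pair_eventually(2) unfolding fomin_square_def by blast
  have a0: "?a1 x0 = 0" "?a2 x0 = 1"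
    using hstrip_bits[OF h(1), of x0] hstrip_bits[OF h(2), of x0] hstrip_bits[OF h(3), of x0]
      hstrip_bits[OF h(4), of x0] x0[of x0] by auto
  obtain x1 where x1:
    "\<And>x. (?a1 x + of_bool (x = x0)) + c' (x - 1) - c' x = (?a1 x + c (x - 1) - c x) + of_bool (x = x1)"
    "\<And>x. (?a2 x - of_bool (x = x0)) + d' (x - 1) - d' x = (?a2 x + d (x - 1) - d x) - of_bool (x = x1)"
    "\<And>x. ?b x + c' (x - 1) - c' x + d' (x - 1) - d' x = ?b x + c (x - 1) - c x + d (x - 1) - d x"
    "raises_at (\<lambda>x. excess kap mu lam x + c x - d x) x1"
    using carry_raises[OF hstrip_bits[OF h(1)] hstrip_bits[OF h(2)] hstrip_bits[OF h1(1)] cs top a0 excess_diff[OF len(1,2)] e]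
    by blast
  have "lam1' = lam1"
  proof (rule conjugate_inject)
    show "lam1' \<in> signatures (length mu)" "lam1 \<in> signatures (length mu)"
      using hstrip_signatures h1 len by metis+
    fix x
    show "conjugate lam1' x = conjugate lam1 x" using x1(3)[of x] unfolding lam1 lam1' mu1 mu1' by simp
  qed
  moreover have "(\<lambda>x. excess kap mu lam x + c x - d x) = excess kap1 mu1 lam1"
  proof (rule excess_eqI)
    fix x
    show "excess kap mu lam x + c x - d x - (excess kap mu lam (x - 1) + c (x - 1) - d (x - 1))
      = (conjugate lam1 x - conjugate mu1 x) - (conjugate mu1 x - conjugate kap1 x)"
      using excess_diff[OF len(1,2), of x] unfolding lam1 mu1 by simp
  next
    have "\<forall>\<^sub>F x in at_bot. \<forall>k \<in> set lam \<union> set mu \<union> set kap. x \<le> k"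
      by (subst eventually_ball_finite) (auto simp: eventually_le_at_bot)
    moreover have "\<forall>\<^sub>F x in at_bot. c x = 0" "\<forall>\<^sub>F x in at_bot. d x = 0"
      using cs(1,2) unfolding is_carry_def by blast+
    ultimately show "\<forall>\<^sub>F x in at_bot. excess kap mu lam x + c x - d x = 0"
      by eventually_elim (use len in \<open>auto intro!: excess_low\<close>)
  qed (use len in auto)
  moreover have "conjugate mu1' x = conjugate mu1 x + of_bool (x = x1)" for x
    using x1(1)[of x] unfolding mu1 mu1' x0 by simp
  ultimately show ?thesis using h1 x1(4) unfolding raises_def by (intro conjI exI[of _ x1]) auto
qed

section \<open>The signature rule on sorted rows\<close>

definition height :: "nat \<Rightarrow> nat \<Rightarrow> nat list \<Rightarrow> nat \<Rightarrow> int" where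
  "height cl op w q = int (count_list (take q w) op) - int (count_list (take q w) cl)"

lemma height_0 [simp]: "height cl op w 0 = 0"
  by (simp add: height_def)

lemma height_Suc:
  "height cl op (x # w) (Suc q) = of_bool (x = op) - of_bool (x = cl) + height cl op w q"
  by (auto simp: height_def)

text \<open>The leftmost surviving opening bracket is the step out of the last minimum of the height
  path. The rightmost surviving closing bracket, in \<open>last_close\<close>, is the step into the
  first minimum.\<close>

definition first_open :: "nat \<Rightarrow> nat \<Rightarrow> nat list \<Rightarrow> nat \<Rightarrow> bool" where
  "first_open cl op w p \<longleftrightarrow> p < length w \<and> w ! p = op \<and>
     (\<forall>q\<le>length w. height cl op w p \<le> height cl op w q) \<and>
     (\<forall>q\<le>length w. p < q \<longrightarrow> height cl op w p < height cl op w q)"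

definition last_close :: "nat \<Rightarrow> nat \<Rightarrow> nat list \<Rightarrow> nat \<Rightarrow> bool" where
  "last_close cl op w p \<longleftrightarrow> p < length w \<and> w ! p = cl \<and>
     (\<forall>q\<le>length w. height cl op w (Suc p) \<le> height cl op w q) \<and>
     (\<forall>q\<le>p. height cl op w (Suc p) < height cl op w q)"

lemma first_open_unique:
  assumes "first_open cl op w p" "first_open cl op w p'"
  shows "p = p'"
proof (rule ccontr)
  assume "p \<noteq> p'"
  then consider "p < p'" | "p' < p" by linarith
  then show False
  proof cases
    case 1
    then have "height cl op w p < height cl op w p'" "height cl op w p' \<le> height cl op w p"
      using assms by (simp_all add: first_open_def)
    then show False by simp
  next
    case 2
    then have "height cl op w p' < height cl op w p" "height cl op w p \<le> height cl op w p'"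
      using assms by (simp_all add: first_open_def)
    then show False by simp
  qed
qed

lemma last_close_unique:
  assumes "last_close cl op w p" "last_close cl op w p'"
  shows "p = p'"
proof (rule ccontr)
  assume "p \<noteq> p'"
  then consider "Suc p \<le> p'" | "Suc p' \<le> p" by linarith
  then show False
  proof cases
    case 1
    then have "height cl op w (Suc p') < height cl op w (Suc p)" "height cl op w (Suc p) \<le> height cl op w (Suc p')"
      using assms by (simp_all add: last_close_def)
    then show False by simp
  next
    case 2
    then have "height cl op w (Suc p) < height cl op w (Suc p')" "height cl op w (Suc p') \<le> height cl op w (Suc p)"
      using assms by (simp_all add: last_close_def)
    then show False by simp
  qed
qed

lemma all_le_Suc_split: "(\<forall>q\<le>Suc n. P q) \<longleftrightarrow> P 0 \<and> (\<forall>q\<le>n. P (Suc q))"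
  by (metis Suc_le_mono le0 not0_implies_Suc)

lemma first_open_Cons:
  "first_open cl op (x # w) (Suc p) \<longleftrightarrow>
     first_open cl op w p \<and> of_bool (x = op) - of_bool (x = cl) + height cl op w p \<le> 0"
  by (simp add: first_open_def height_Suc all_le_Suc_split) auto

lemma first_open_Cons_0:
  "cl \<noteq> op \<Longrightarrow> first_open cl op (op # w) 0 \<longleftrightarrow> (\<forall>q\<le>length w. 0 \<le> height cl op w q)"
  by (force simp: first_open_def height_Suc all_le_Suc_split)

lemma last_close_Cons:
  "last_close cl op (x # w) (Suc p) \<longleftrightarrow>
     last_close cl op w p \<and> of_bool (x = op) - of_bool (x = cl) + height cl op w (Suc p) < 0"
  by (simp add: last_close_def height_Suc all_le_Suc_split) auto

lemma last_close_Cons_0: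
  "cl \<noteq> op \<Longrightarrow> last_close cl op (cl # w) 0 \<longleftrightarrow> (\<forall>q\<le>length w. 0 \<le> height cl op w q)"
  by (force simp: last_close_def height_Suc all_le_Suc_split)

lemma cancel_brackets_map:
  "cancel_brackets (map (apfst f) v) = map (apfst f) (cancel_brackets v)"
  by (induction v) (auto split: list.splits)

lemma uncancelled_Cons:
  "uncancelled cl op (x # w) = (if x = cl \<or> x = op
     then (case map (apfst Suc) (uncancelled cl op w) of [] \<Rightarrow> [(0, x = cl)]
       | b' # w' \<Rightarrow> if \<not> x = cl \<and> snd b' then w' else (0, x = cl) # b' # w')
     else map (apfst Suc) (uncancelled cl op w))"
proof -
  have "map (\<lambda>p. (p, (x # w) ! p = cl)) (filter (\<lambda>p. (x # w) ! p = cl \<or> (x # w) ! p = op) (map Suc [0..<length w]))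
    = map (apfst Suc) (map (\<lambda>p. (p, w ! p = cl)) (filter (\<lambda>p. w ! p = cl \<or> w ! p = op) [0..<length w]))"
    by (simp add: filter_map o_def)
  then show ?thesis
    unfolding uncancelled_def length_Cons upt_conv_Cons[OF zero_less_Suc] map_Suc_upt[symmetric] cancel_brackets_map[symmetric]
    by (simp split: list.split)
qed

text \<open>The cancellation works from the right end of the word, so the induction prepends a
  letter and shifts all later heights by its value. The invariant that carries it is that the
  minimal height equals minus the number of surviving closing brackets: it decides whether the
  extreme positions survive the shift.\<close>

lemma uncancelled_structure:
  assumes "cl \<noteq> op"
  obtains C O1 where "uncancelled cl op w = C @ O1" "\<forall>b\<in>set C. snd b" "\<forall>b\<in>set O1. \<not> snd b"
    "\<forall>q\<le>length w. - int (length C) \<le> height cl op w q"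
    "\<exists>q\<le>length w. height cl op w q = - int (length C)"
    "O1 = [] \<Longrightarrow> \<forall>q\<le>length w. height cl op w (length w) \<le> height cl op w q"
    "O1 \<noteq> [] \<Longrightarrow> first_open cl op w (fst (hd O1))"
    "C \<noteq> [] \<Longrightarrow> last_close cl op w (fst (last C))"
proof -
  have "\<exists>C O1. uncancelled cl op w = C @ O1 \<and> (\<forall>b\<in>set C. snd b) \<and> (\<forall>b\<in>set O1. \<not> snd b) \<and>
    (\<forall>q\<le>length w. - int (length C) \<le> height cl op w q) \<and>
    (\<exists>q\<le>length w. height cl op w q = - int (length C)) \<and>
    (O1 = [] \<longrightarrow> (\<forall>q\<le>length w. height cl op w (length w) \<le> height cl op w q)) \<and>
    (O1 \<noteq> [] \<longrightarrow> first_open cl op w (fst (hd O1))) \<and>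
    (C \<noteq> [] \<longrightarrow> last_close cl op w (fst (last C)))"
  proof (induction w)
    case Nil
    then show ?case by (simp add: uncancelled_def)
  next
    case (Cons x w)
    then obtain C O1 where u: "uncancelled cl op w = C @ O1" and C: "\<forall>b\<in>set C. snd b" and O1: "\<forall>b\<in>set O1. \<not> snd b"
      and lb: "\<forall>q\<le>length w. - int (length C) \<le> height cl op w q"
      and att: "\<exists>q\<le>length w. height cl op w q = - int (length C)"
      and none: "O1 = [] \<longrightarrow> (\<forall>q\<le>length w. height cl op w (length w) \<le> height cl op w q)"
      and fo: "O1 \<noteq> [] \<longrightarrow> first_open cl op w (fst (hd O1))"
      and lc: "C \<noteq> [] \<longrightarrow> last_close cl op w (fst (last C))" by blast
    let ?S = "map (apfst Suc) :: (nat \<times> bool) list \<Rightarrow> _"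
    have CS: "\<forall>b\<in>set (?S C). snd b" "\<forall>b\<in>set (?S O1). \<not> snd b" using C O1 by auto
    have hdS: "fst (hd (?S v)) = Suc (fst (hd v))" "fst (last (?S v)) = Suc (fst (last v))" if "v \<noteq> []" for v
      using that by (auto simp: hd_map last_map)
    obtain q0 where q0: "q0 \<le> length w" "height cl op w q0 = - int (length C)" using att by blast
    have fo_h: "height cl op w (fst (hd O1)) = - int (length C)" if "O1 \<noteq> []"
      using fo that q0 lb unfolding first_open_def by (metis less_imp_le order_antisym)
    have none_h: "height cl op w (length w) = - int (length C)" if "O1 = []"
      using none that q0 lb by (metis le_refl order_antisym)
    have lc_h: "height cl op w (Suc (fst (last C))) = - int (length C)" if "C \<noteq> []"
      using lc that q0 lb unfolding last_close_def by (metis Suc_leI order_antisym)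
    have h0: "0 \<le> height cl op w q" if "C = []" "q \<le> length w" for q using lb that by simp
    have lt: "- 1 - int (length C) < height cl op w q" if "q \<le> length w" for q
      using lb[rule_format, OF that] by linarith
    have h2: "1 - int (length C) \<le> 1 + height cl op w q" if "q \<le> length w" for q
      using lb[rule_format, OF that] by linarith
    have h1: "- int (length C) \<le> 1 + height cl op w q" if "q \<le> length w" for q
      using lb[rule_format, OF that] by linarith
    consider "x \<noteq> cl" "x \<noteq> op" | "x = cl" | "x = op" "C \<noteq> []" | "x = op" "C = []" by blast
    then show ?case
    proof cases
      case 1
      have "uncancelled cl op (x # w) = ?S C @ ?S O1" using 1 by (simp add: uncancelled_Cons u)
      moreover have "\<exists>q\<le>length (x # w). height cl op (x # w) q = - int (length (?S C))"
        using q0 1 by (intro exI[of _ "Suc q0"]) (simp add: height_Suc)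
      moreover have "?S C \<noteq> [] \<longrightarrow> last_close cl op (x # w) (fst (last (?S C)))"
        using 1 assms  lc lc_h hdS(2)[of C] by (simp add: last_close_Cons)
      moreover have "(\<forall>b\<in>set (?S C). snd b) \<and> (\<forall>b\<in>set (?S O1). \<not> snd b)" using CS  by simp
      moreover have "\<forall>q\<le>length (x # w). - int (length (?S C)) \<le> height cl op (x # w) q"
        using 1 assms lb h1  by (simp add: height_Suc all_le_Suc_split)
      moreover have "?S O1 = [] \<longrightarrow> (\<forall>q\<le>length (x # w). height cl op (x # w) (length (x # w)) \<le> height cl op (x # w) q)"
        using 1 assms lb h1 none_h  by (simp add: height_Suc all_le_Suc_split)
      moreover have "?S O1 \<noteq> [] \<longrightarrow> first_open cl op (x # w) (fst (hd (?S O1)))"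
        using 1 assms fo fo_h h0 hdS(1)[of O1]  by (simp add: first_open_Cons first_open_Cons_0)
      ultimately show ?thesis by blast
    next
      case 2
      have "uncancelled cl op (x # w) = ((0, True) # ?S C) @ ?S O1"
        using 2 by (cases "?S C @ ?S O1") (auto simp: uncancelled_Cons u)
      moreover have "\<exists>q\<le>length (x # w). height cl op (x # w) q = - int (length ((0, True) # ?S C))"
        using q0 2 assms by (intro exI[of _ "Suc q0"]) (simp add: height_Suc)
      moreover have "last_close cl op (x # w) (fst (last ((0, True) # ?S C)))"
        using 2 assms h0 lc lc_h hdS(2)[of C]
        by (cases "C = []") (simp_all add: last_close_Cons last_close_Cons_0)
      moreover have "\<forall>b\<in>set ((0, True) # ?S C). snd b" using CS by simp
      moreover have "\<forall>q\<le>length (x # w). - int (length ((0, True) # ?S C)) \<le> height cl op (x # w) q"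
        using 2 assms lt by (simp add: height_Suc all_le_Suc_split)
      moreover have "?S O1 = [] \<longrightarrow> (\<forall>q\<le>length (x # w). height cl op (x # w) (length (x # w)) \<le> height cl op (x # w) q)"
        using 2 assms lt none_h by (simp add: height_Suc all_le_Suc_split)
      moreover have "?S O1 \<noteq> [] \<longrightarrow> first_open cl op (x # w) (fst (hd (?S O1)))"
        using 2 assms fo fo_h hdS(1)[of O1] by (simp add: first_open_Cons)
      ultimately show ?thesis using CS(2) by blast
    next
      case 3
      then obtain b C' where b: "C = b # C'" by (cases C) auto
      have "uncancelled cl op (x # w) = ?S C' @ ?S O1" using 3 assms C b by (auto simp: uncancelled_Cons u)
      moreover have "\<exists>q\<le>length (x # w). height cl op (x # w) q = - int (length (?S C'))"
        using q0 3 assms b by (intro exI[of _ "Suc q0"]) (simp add: height_Suc)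
      moreover have "?S C' \<noteq> [] \<longrightarrow> last_close cl op (x # w) (fst (last (?S C')))"
        using 3 assms b lc lc_h by (cases C' rule: rev_cases) (simp_all add: last_close_Cons)
      moreover have "(\<forall>b\<in>set (?S C'). snd b) \<and> (\<forall>b\<in>set (?S O1). \<not> snd b)" using CS b by simp
      moreover have "\<forall>q\<le>length (x # w). - int (length (?S C')) \<le> height cl op (x # w) q"
        using 3 assms h2 b by (simp add: height_Suc all_le_Suc_split)
      moreover have "?S O1 = [] \<longrightarrow> (\<forall>q\<le>length (x # w). height cl op (x # w) (length (x # w)) \<le> height cl op (x # w) q)"
        using 3 assms h2 none_h b by (simp add: height_Suc all_le_Suc_split)
      moreover have "?S O1 \<noteq> [] \<longrightarrow> first_open cl op (x # w) (fst (hd (?S O1)))"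
        using 3 assms fo fo_h h0 hdS(1)[of O1] b by (simp add: first_open_Cons first_open_Cons_0)
      ultimately show ?thesis by blast
    next
      case 4
      have "uncancelled cl op (x # w) = [] @ ((0, False) # ?S O1)"
        using 4 assms O1 by (cases O1) (auto simp: uncancelled_Cons u)
      moreover have "\<exists>q\<le>length (x # w). height cl op (x # w) q = - int (length ([] :: (nat \<times> bool) list))"
        by (intro exI[of _ 0]) simp
      moreover have "[] \<noteq> [] \<longrightarrow> last_close cl op (x # w) (fst (last ([])))"
        using 4 assms  by simp
      moreover have "(\<forall>b\<in>set ([]). snd b) \<and> (\<forall>b\<in>set ((0, False) # ?S O1). \<not> snd b)" using CS  by simp
      moreover have "\<forall>q\<le>length (x # w). - int (length ([])) \<le> height cl op (x # w) q"
        using 4 assms h0 h1  by (simp add: height_Suc all_le_Suc_split)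
      moreover have "(0, False) # ?S O1 = [] \<longrightarrow> (\<forall>q\<le>length (x # w). height cl op (x # w) (length (x # w)) \<le> height cl op (x # w) q)"
        using 4 assms h0 h1 none_h  by (simp add: height_Suc all_le_Suc_split)
      moreover have "(0, False) # ?S O1 \<noteq> [] \<longrightarrow> first_open cl op (x # w) (fst (hd ((0, False) # ?S O1)))"
        using 4 assms fo fo_h h0 hdS(1)[of O1]  by (simp add: first_open_Cons first_open_Cons_0)
      ultimately show ?thesis by blast
    qed
  qed
  then show thesis using that by blast
qed

lemma raise_word_iff:
  assumes "cl \<noteq> op"
  shows "raise_word cl op w = Some w' \<longleftrightarrow> (\<exists>p. first_open cl op w p \<and> w' = w[p := cl])"
proof -
  obtain C O1 where u: "uncancelled cl op w = C @ O1" "\<forall>b\<in>set C. snd b" "\<forall>b\<in>set O1. \<not> snd b"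
    and none: "O1 = [] \<Longrightarrow> \<forall>q\<le>length w. height cl op w (length w) \<le> height cl op w q"
    and fo: "O1 \<noteq> [] \<Longrightarrow> first_open cl op w (fst (hd O1))"
    using uncancelled_structure[OF assms] by metis
  have "filter (\<lambda>b. \<not> snd b) (uncancelled cl op w) = O1" using u by (simp add: filter_id_conv)
  then have r: "raise_word cl op w = (case O1 of [] \<Rightarrow> None | b # _ \<Rightarrow> Some (w[fst b := cl]))"
    by (simp add: raise_word_def)
  show ?thesis
  proof (cases O1)
    case Nil
    have "\<not> first_open cl op w p" for p
    proof
      assume "first_open cl op w p"
      then have "height cl op w p < height cl op w (length w)" "p \<le> length w" by (auto simp: first_open_def)
      then show False using none[OF Nil] by (metis not_le)
    qed
    then show ?thesis using r Nil by simp
  next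
    case (Cons b O2)
    have f: "first_open cl op w (fst b)" using fo Cons by simp
    then have "(\<exists>p. first_open cl op w p \<and> w' = w[p := cl]) \<longleftrightarrow> w' = w[fst b := cl]"
      using first_open_unique by blast
    then show ?thesis using r Cons by auto
  qed
qed

lemma lower_word_iff:
  assumes "cl \<noteq> op"
  shows "lower_word cl op w = Some w' \<longleftrightarrow> (\<exists>p. last_close cl op w p \<and> w' = w[p := op])"
proof -
  obtain C O1 where u: "uncancelled cl op w = C @ O1" "\<forall>b\<in>set C. snd b" "\<forall>b\<in>set O1. \<not> snd b"
    and lb: "\<forall>q\<le>length w. - int (length C) \<le> height cl op w q"
    and lc: "C \<noteq> [] \<Longrightarrow> last_close cl op w (fst (last C))"
    using uncancelled_structure[OF assms] by metis
  have "filter snd (uncancelled cl op w) = C" using u by (simp add: filter_id_conv)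
  then have r: "lower_word cl op w = (case rev C of [] \<Rightarrow> None | b # _ \<Rightarrow> Some (w[fst b := op]))"
    by (simp add: lower_word_def)
  show ?thesis
  proof (cases C rule: rev_cases)
    case Nil
    have "\<not> last_close cl op w p" for p
    proof
      assume "last_close cl op w p"
      then have "height cl op w (Suc p) < height cl op w 0" "Suc p \<le> length w" by (auto simp: last_close_def)
      then show False using lb Nil by force
    qed
    then show ?thesis using r Nil by simp
  next
    case (snoc C1 b)
    have f: "last_close cl op w (fst b)" using lc snoc by simp
    then have "(\<exists>p. last_close cl op w p \<and> w' = w[p := op]) \<longleftrightarrow> w' = w[fst b := op]"
      using last_close_unique by blast
    then show ?thesis using r snoc by auto
  qed
qed

section \<open>Words made of rows and the heights inside a row\<close>

lemma concat_rev_split: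
  "j < length H \<Longrightarrow> concat (rev H) = concat (rev (drop (Suc j) H)) @ H ! j @ concat (rev (take j H))"
  by (subst id_take_nth_drop[of j H]) auto

lemma concat_rev_position:
  assumes "p < length (concat (rev H))"
  obtains j q where "j < length H" "q < length (H ! j)" "p = length (concat (rev (drop (Suc j) H))) + q"
  using assms
proof (induction H arbitrary: thesis)
  case (Cons r H)
  show ?case
  proof (cases "p < length (concat (rev H))")
    case True
    then obtain j q where "j < length H" "q < length (H ! j)" "p = length (concat (rev (drop (Suc j) H))) + q"
      using Cons.IH by blast
    then show thesis by (intro Cons.prems(1)[of "Suc j" q]) auto
  next
    case False
    then show thesis using Cons.prems(2) by (intro Cons.prems(1)[of 0 "p - length (concat (rev H))"]) auto
  qed
qed simp

lemma split_word_concat: "split_word (map length xs) (concat xs) = xs"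
  by (induction xs) auto

lemma concat_rev_update:
  assumes "j < length H" "q < length (H ! j)"
  shows "(concat (rev H))[length (concat (rev (drop (Suc j) H))) + q := v]
    = concat (rev (H[j := (H ! j)[q := v]]))"
  using assms concat_rev_split[of j H] concat_rev_split[of j "H[j := (H ! j)[q := v]]"]
  by (simp add: list_update_append)

definition balance :: "nat \<Rightarrow> nat \<Rightarrow> nat list \<Rightarrow> int" where
  "balance cl op r = int (count_list r op) - int (count_list r cl)"

definition base :: "nat \<Rightarrow> nat \<Rightarrow> nat list list \<Rightarrow> nat \<Rightarrow> int" where
  "base cl op H j = (\<Sum>k\<in>{j..<length H}. balance cl op (H ! k))"

text \<open>Rows are read from the last to the first, so row \<open>j\<close> starts at the height
  \<open>base\<close> of the rows after it. In a sorted row all closing brackets precede all opening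
  ones: the path goes down, turns at the valley, and goes up.\<close>

definition valley :: "nat \<Rightarrow> nat \<Rightarrow> nat list list \<Rightarrow> nat \<Rightarrow> int" where
  "valley cl op H j = base cl op H (Suc j) - int (count_list (H ! j) cl)"

lemma balance_append: "balance cl op (u @ v) = balance cl op u + balance cl op v"
  by (simp add: balance_def)

lemma balance_concat_rev_drop: "balance cl op (concat (rev (drop j H))) = base cl op H j"
proof (induction "length H - j" arbitrary: j)
  case 0
  then show ?case by (simp add: base_def balance_def)
next
  case (Suc d)
  then have "j < length H" "balance cl op (concat (rev (drop (Suc j) H))) = base cl op H (Suc j)" by auto
  then show ?case by (simp add: Cons_nth_drop_Suc[symmetric] balance_append base_def sum.atLeast_Suc_lessThan)
qed

lemma height_row:
  assumes "j < length H" "q \<le> length (H ! j)"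
  shows "height cl op (concat (rev H)) (length (concat (rev (drop (Suc j) H))) + q)
    = base cl op H (Suc j) + balance cl op (take q (H ! j))"
  using assms concat_rev_split[OF assms(1)]
  by (simp add: height_def balance_concat_rev_drop[symmetric] balance_def)

lemma height_end: "height cl op (concat (rev H)) (length (concat (rev H))) = base cl op H 0"
  using balance_concat_rev_drop[of cl op 0 H] by (simp add: height_def balance_def)

lemma offset_mono:
  assumes "j < length H" "q \<le> length (H ! j)"
  shows "length (concat (rev (drop (Suc j) H))) + q \<le> length (concat (rev (drop j H)))"
  using assms by (simp add: Cons_nth_drop_Suc[symmetric])

lemma offset_mono':
  assumes "i \<le> j"
  shows "length (concat (rev (drop j H))) \<le> length (concat (rev (drop i H)))"
proof -
  have "drop i H = take (j - i) (drop i H) @ drop j H"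
    using assms by (metis append_take_drop_id drop_drop le_add_diff_inverse2)
  then show ?thesis by (metis concat_append le_add1 length_append rev_append)
qed

lemma count_list_take_le: "count_list (take q r) x \<le> count_list r x"
  by (metis append_take_drop_id count_list_append le_add1)

lemma balance_take_ge: "- int (count_list r cl) \<le> balance cl op (take q r)"
  using count_list_take_le[of q r cl] by (simp add: balance_def)

lemma sorted_split:
  assumes "sorted (r :: nat list)"
  obtains A B where "r = A @ B" "\<forall>x\<in>set A. x \<le> c" "\<forall>x\<in>set B. c < x"
proof -
  have "r = filter (\<lambda>x. x \<le> c) r @ filter (\<lambda>x. c < x) r"
    using assms
  proof (induction r)
    case (Cons a r)
    show ?case
    proof (cases "a \<le> c")
      case False
      then have "filter (\<lambda>x. x \<le> c) r = []" "filter (\<lambda>x. c < x) r = r"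
        using Cons.prems by (auto simp: filter_empty_conv filter_id_conv)
      then show ?thesis using False by simp
    qed (use Cons in auto)
  qed simp
  then show thesis by (rule that) auto
qed

text \<open>The signature rule on sorted rows only depends on the heights at the valleys of the rows, that is,
  between the letters \<open>c\<close> and \<open>c + 1\<close> of a row.\<close>

definition row_open :: "nat \<Rightarrow> nat list list \<Rightarrow> nat \<Rightarrow> bool" where
  "row_open c H j \<longleftrightarrow> j < length H \<and> (\<forall>k<length H. valley c (Suc c) H j \<le> valley c (Suc c) H k) \<and>
     (\<forall>k<j. valley c (Suc c) H j < valley c (Suc c) H k) \<and> valley c (Suc c) H j < base c (Suc c) H 0"

text \<open>Rows of larger index are read earlier, so strictness for \<open>j < k\<close> selects
  the first minimum, as strictness for \<open>k < j\<close> selects the last one in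
  \<open>row_open\<close>. The comparison with 0 is with the start of the word, the one with
  \<open>base\<close> at 0 is with its end.\<close>

definition row_close :: "nat \<Rightarrow> nat list list \<Rightarrow> nat \<Rightarrow> bool" where
  "row_close c H j \<longleftrightarrow> j < length H \<and> (\<forall>k<length H. valley c (Suc c) H j \<le> valley c (Suc c) H k) \<and>
     (\<forall>k<length H. j < k \<longrightarrow> valley c (Suc c) H j < valley c (Suc c) H k) \<and> valley c (Suc c) H j < 0"

context
  fixes c :: nat and H :: "nat list list"
  assumes sorted_rows: "\<And>r. r \<in> set H \<Longrightarrow> sorted r"
begin

abbreviation (input) offset :: "nat \<Rightarrow> nat" where
  "offset j \<equiv> length (concat (rev (drop (Suc j) H)))"

lemma ex_valley_position:
  assumes "j < length H"
  obtains q where "q \<le> length (H ! j)" "height c (Suc c) (concat (rev H)) (offset j + q) = valley c (Suc c) H j"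
    "\<And>p. q < p \<Longrightarrow> p \<le> length (H ! j) \<Longrightarrow> H ! j ! q = Suc c \<Longrightarrow>
       valley c (Suc c) H j < height c (Suc c) (concat (rev H)) (offset j + p)"
    "\<And>p. p < q \<Longrightarrow> H ! j ! (q - 1) = c \<Longrightarrow>
       valley c (Suc c) H j < height c (Suc c) (concat (rev H)) (offset j + p)"
    "Suc c \<in> set (H ! j) \<Longrightarrow> q < length (H ! j) \<and> H ! j ! q = Suc c"
    "c \<in> set (H ! j) \<Longrightarrow> 0 < q \<and> H ! j ! (q - 1) = c"
    "\<And>p. p < length (H ! j) \<Longrightarrow> H ! j ! p = Suc c \<Longrightarrow> q \<le> p"
    "\<And>p. p < length (H ! j) \<Longrightarrow> H ! j ! p = c \<Longrightarrow> p < q"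
proof -
  have sr: "sorted (H ! j)" using assms sorted_rows by simp
  obtain A B where AB: "H ! j = A @ B" "\<forall>x\<in>set A. x \<le> c" "\<forall>x\<in>set B. c < x"
    using sorted_split[OF sr] by blast
  have sA: "sorted A" "sorted B" using sr AB(1) by (auto simp: sorted_append)
  have cntA: "count_list A (Suc c) = 0" "count_list B c = 0" using AB by (auto simp: count_list_0_iff)
  note h = height_row[OF assms, of _ c "Suc c"]
  \<comment> \<open>The valley is the cut between the letters up to \<open>c\<close> and the larger
    ones: no bracket opens in \<open>A\<close>, and none closes in \<open>B\<close>.\<close>
  show thesis
  proof (rule that[of "length A"])
    show "height c (Suc c) (concat (rev H)) (offset j + length A) = valley c (Suc c) H j"
      using h[of "length A"] AB(1) cntA by (simp add: balance_def valley_def)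
  next
    fix p assume p: "length A < p" "p \<le> length (H ! j)" "H ! j ! length A = Suc c"
    then obtain B' where B': "B = Suc c # B'" using AB(1) by (cases B) auto
    have "take p (H ! j) = A @ Suc c # take (p - length A - 1) B'"
      using p AB(1) B' by (simp add: take_Cons')
    moreover have "count_list (take (p - length A - 1) B') c = 0"
      using count_list_take_le[of "p - length A - 1" B' c] cntA B' by simp
    ultimately show "valley c (Suc c) H j < height c (Suc c) (concat (rev H)) (offset j + p)"
      using h[OF p(2)] AB(1) cntA B' by (simp add: balance_def valley_def)
  next
    fix p assume p: "p < length A" "H ! j ! (length A - 1) = c"
    then have "A \<noteq> []" by auto
    then have "last A = c" using AB(1) p by (simp add: nth_append last_conv_nth)
    note \<open>A \<noteq> []\<close> this
    then have A': "A = butlast A @ [c]" by (metis append_butlast_last_id)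
    have tk: "take p (H ! j) = take p (butlast A)" using p AB(1) by (simp add: take_butlast)
    have "count_list A c = count_list (butlast A) c + 1" by (subst A') simp
    then have "count_list (take p (butlast A)) c < count_list (H ! j) c"
      using count_list_take_le[of p "butlast A" c] cntA AB(1) by simp
    moreover have "p \<le> length (H ! j)" using p AB(1) by simp
    ultimately show "valley c (Suc c) H j < height c (Suc c) (concat (rev H)) (offset j + p)"
      using h[of p] tk by (simp add: balance_def valley_def)
  next
    assume "Suc c \<in> set (H ! j)"
    then have "Suc c \<in> set B" using AB by force
    then obtain x B' where B: "B = x # B'" by (cases B) auto
    then have "x = Suc c" using \<open>Suc c \<in> set B\<close> sA(2) AB(3) by (auto intro: antisym)
    then show "length A < length (H ! j) \<and> H ! j ! length A = Suc c" using B AB(1) by (simp add: nth_append)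
  next
    assume "c \<in> set (H ! j)"
    then have cA: "c \<in> set A" using AB by force
    then have ne: "A \<noteq> []" by auto
    have "c \<le> last A"
      using cA sA(1) by (cases A rule: rev_cases) (auto simp: sorted_append)
    then have "last A = c" using AB(2) ne by (simp add: antisym)
    then show "0 < length A \<and> H ! j ! (length A - 1) = c" using ne AB(1) by (simp add: nth_append last_conv_nth)
  next
    fix p assume "p < length (H ! j)" "H ! j ! p = Suc c"
    then show "length A \<le> p" using AB by (metis Suc_n_not_le_n not_le nth_append nth_mem)
  next
    fix p assume "p < length (H ! j)" "H ! j ! p = c"
    moreover have "c < c" if "length A \<le> p"
      using AB(3) nth_mem[of "p - length A" B] that calculation AB(1) by (auto simp: nth_append)
    ultimately show "p < length A" by fastforce
  qed (use AB(1) in simp)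
qed

lemma height_ge_valley:
  assumes "j < length H" "q \<le> length (H ! j)"
  shows "valley c (Suc c) H j \<le> height c (Suc c) (concat (rev H)) (offset j + q)"
  using height_row[OF assms] balance_take_ge[of "H ! j" c "Suc c" q] by (simp add: valley_def)

lemma offset_le: 
  assumes "j < length H" "q \<le> length (H ! j)"
  shows "offset j + q \<le> length (concat (rev H))"
  using offset_mono[OF assms] offset_mono'[of 0 j H] by simp

lemma offset_less:
  assumes "k < j" "j < length H" "q \<le> length (H ! j)"
  shows "offset j + q \<le> offset k"
  using offset_mono[OF assms(2,3)] offset_mono'[of "Suc k" j H] assms(1) by simp

lemma raise_word_rowsD:
  assumes "raise_word c (Suc c) (concat (rev H)) = Some w"
  obtains j q where "row_open c H j" "q < length (H ! j)" "H ! j ! q = Suc c"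
    "w = concat (rev (H[j := (H ! j)[q := c]]))"
proof -
  let ?h = "height c (Suc c) (concat (rev H))"
  obtain p where p: "first_open c (Suc c) (concat (rev H)) p" "w = (concat (rev H))[p := c]"
    using assms raise_word_iff[of c "Suc c"] by auto
  obtain j q where j: "j < length H" "q < length (H ! j)" "p = offset j + q"
    using concat_rev_position[of p H] p(1) unfolding first_open_def by metis
  have min: "\<And>i. i \<le> length (concat (rev H)) \<Longrightarrow> ?h p \<le> ?h i"
    "\<And>i. i \<le> length (concat (rev H)) \<Longrightarrow> p < i \<Longrightarrow> ?h p < ?h i" "concat (rev H) ! p = Suc c" "p < length (concat (rev H))"
    using p(1) by (auto simp: first_open_def)
  have letter: "H ! j ! q = Suc c"
    using min(3) j concat_rev_split[OF j(1)] by (simp add: nth_append)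
  obtain q' where q': "q' \<le> length (H ! j)" "?h (offset j + q') = valley c (Suc c) H j"
    using ex_valley_position[OF j(1)] by metis
  have hp: "?h p = valley c (Suc c) H j"
    using min(1)[OF offset_le[OF j(1) q'(1)]] q' height_ge_valley[of j q] j by simp
  have "row_open c H j"
    unfolding row_open_def
  proof (intro conjI allI impI)
    fix k assume k: "k < length H"
    obtain q' where "q' \<le> length (H ! k)" "?h (offset k + q') = valley c (Suc c) H k"
      using ex_valley_position[OF k] by metis
    then show "valley c (Suc c) H j \<le> valley c (Suc c) H k" using min(1)[OF offset_le[OF k]] hp by metis
  next
    fix k assume kj: "k < j"
    then have k: "k < length H" using j by simp
    obtain q' where q': "q' \<le> length (H ! k)" "?h (offset k + q') = valley c (Suc c) H k"
      using ex_valley_position[OF k] by metis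
    have "p < offset k + q'" using offset_less[OF kj j(1), of "Suc q"] j by simp
    then show "valley c (Suc c) H j < valley c (Suc c) H k" using min(2)[OF offset_le[OF k q'(1)]] hp q'(2) by simp
  next
    show "valley c (Suc c) H j < base c (Suc c) H 0" using min(2)[OF order_refl min(4)] hp height_end[of c "Suc c" H] by simp
  qed (rule j)
  then show thesis using that letter concat_rev_update[OF j(1,2)] p(2) j by metis
qed

lemma raise_word_rowsI:
  assumes "row_open c H j"
  obtains q where "q < length (H ! j)" "H ! j ! q = Suc c"
    "raise_word c (Suc c) (concat (rev H)) = Some (concat (rev (H[j := (H ! j)[q := c]])))"
proof -
  let ?h = "height c (Suc c) (concat (rev H))" and ?v = "valley c (Suc c) H"
  have r: "j < length H" "\<And>k. k < length H \<Longrightarrow> ?v j \<le> ?v k" "\<And>k. k < j \<Longrightarrow> ?v j < ?v k" "?v j < base c (Suc c) H 0"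
    using assms by (auto simp: row_open_def)
  \<comment> \<open>Without a letter \<open>c + 1\<close> the path leaves row \<open>j\<close> at
    its valley, so row \<open>j - 1\<close>, read next, or the end of the word if
    \<open>j = 0\<close>, would be at least as low.\<close>
  have mem: "Suc c \<in> set (H ! j)"
  proof (rule ccontr)
    assume "Suc c \<notin> set (H ! j)"
    then have "?v j = base c (Suc c) H j" using r(1)
      by (simp add: valley_def base_def balance_def sum.atLeast_Suc_lessThan count_list_0_iff)
    moreover have "base c (Suc c) H j \<ge> ?v (j - 1)" if "0 < j" using that by (simp add: valley_def)
    ultimately show False using r(3)[of "j - 1"] r(4) by (cases j) auto
  qed
  obtain q where q: "q \<le> length (H ! j)" "?h (offset j + q) = ?v j"
    "\<And>p. q < p \<Longrightarrow> p \<le> length (H ! j) \<Longrightarrow> H ! j ! q = Suc c \<Longrightarrow> ?v j < ?h (offset j + p)"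
    "q < length (H ! j)" "H ! j ! q = Suc c"
    using ex_valley_position[OF r(1)] mem by metis
  have other: "?v j \<le> ?h i \<and> (offset j + q < i \<longrightarrow> ?v j < ?h i)" if "i \<le> length (concat (rev H))" for i
  proof (cases "i < length (concat (rev H))")
    case True
    then obtain k p where k: "k < length H" "p < length (H ! k)" "i = offset k + p"
      using concat_rev_position by metis
    have ge: "?v k \<le> ?h i" using height_ge_valley[OF k(1)] k by simp
    consider "k < j" | "k = j" | "j < k" by linarith
    then show ?thesis
    proof cases
      case 1
      then show ?thesis using r(3) ge by force
    next
      case 2
      then show ?thesis using ge q(3)[of p] q(5) k by auto
    next
      case 3
      then have "i \<le> offset j" using offset_less[of j k p] k by simp
      then show ?thesis using ge r(2)[OF k(1)] by simp
    qed
  next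
    case False
    then show ?thesis using that r(4) height_end[of c "Suc c" H] by simp
  qed
  have "first_open c (Suc c) (concat (rev H)) (offset j + q)"
    unfolding first_open_def q(2)
  proof (intro conjI)
    show "offset j + q < length (concat (rev H))" using offset_le[of j "Suc q"] r(1) q(4) by simp
    show "concat (rev H) ! (offset j + q) = Suc c"
      using concat_rev_split[OF r(1)] q(4,5) by (simp add: nth_append)
  qed (use other in auto)
  then have "raise_word c (Suc c) (concat (rev H)) = Some ((concat (rev H))[offset j + q := c])"
    using raise_word_iff[of c "Suc c"] by auto
  then show thesis using that q(4,5) concat_rev_update[OF r(1) q(4)] by metis
qed

lemma lower_word_rowsD:
  assumes "lower_word c (Suc c) (concat (rev H)) = Some w"
  obtains j q where "row_close c H j" "q < length (H ! j)" "H ! j ! q = c"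
    "w = concat (rev (H[j := (H ! j)[q := Suc c]]))"
proof -
  let ?h = "height c (Suc c) (concat (rev H))"
  obtain p where p: "last_close c (Suc c) (concat (rev H)) p" "w = (concat (rev H))[p := Suc c]"
    using assms lower_word_iff[of c "Suc c"] by auto
  have min: "\<And>i. i \<le> length (concat (rev H)) \<Longrightarrow> ?h (Suc p) \<le> ?h i"
    "\<And>i. i \<le> p \<Longrightarrow> ?h (Suc p) < ?h i" "concat (rev H) ! p = c" "p < length (concat (rev H))"
    using p(1) by (auto simp: last_close_def)
  obtain j q where j: "j < length H" "q < length (H ! j)" "p = offset j + q"
    using concat_rev_position[of p H] min(4) by metis
  have letter: "H ! j ! q = c"
    using min(3) j concat_rev_split[OF j(1)] by (simp add: nth_append)
  obtain q' where q': "q' \<le> length (H ! j)" "?h (offset j + q') = valley c (Suc c) H j"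
    using ex_valley_position[OF j(1)] by metis
  have hp: "?h (Suc p) = valley c (Suc c) H j"
    using min(1)[OF offset_le[OF j(1) q'(1)]] q' height_ge_valley[of j "Suc q"] j by simp
  have "row_close c H j"
    unfolding row_close_def
  proof (intro conjI allI impI)
    fix k assume k: "k < length H"
    obtain q' where q': "q' \<le> length (H ! k)" "?h (offset k + q') = valley c (Suc c) H k"
      using ex_valley_position[OF k] by metis
    then show "valley c (Suc c) H j \<le> valley c (Suc c) H k" using min(1)[OF offset_le[OF k]] hp by metis
    assume "j < k"
    then have "offset k + q' \<le> p" using offset_less[OF _ k q'(1), of j] j by simp
    then show "valley c (Suc c) H j < valley c (Suc c) H k" using min(2) hp q'(2) by metis
  next
    show "valley c (Suc c) H j < 0" using min(2)[of 0] hp by simp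
  qed (rule j)
  then show thesis using that letter concat_rev_update[OF j(1,2)] p(2) j by metis
qed

lemma lower_word_rowsI:
  assumes "row_close c H j"
  obtains q where "q < length (H ! j)" "H ! j ! q = c"
    "lower_word c (Suc c) (concat (rev H)) = Some (concat (rev (H[j := (H ! j)[q := Suc c]])))"
proof -
  let ?h = "height c (Suc c) (concat (rev H))" and ?v = "valley c (Suc c) H"
  have r: "j < length H" "\<And>k. k < length H \<Longrightarrow> ?v j \<le> ?v k" "\<And>k. k < length H \<Longrightarrow> j < k \<Longrightarrow> ?v j < ?v k" "?v j < 0"
    using assms by (auto simp: row_close_def)
  \<comment> \<open>Without a letter \<open>c\<close> the path enters row \<open>j\<close> at its
    valley, so row \<open>j + 1\<close>, read before, or the start of the word, would be at least as
    low.\<close>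
  have mem: "c \<in> set (H ! j)"
  proof (rule ccontr)
    assume "c \<notin> set (H ! j)"
    then have *: "?v j = base c (Suc c) H (Suc j)" by (simp add: valley_def count_list_0_iff)
    show False
    proof (cases "Suc j < length H")
      case True
      then have "?v (Suc j) \<le> ?v j"
        unfolding * by (simp add: valley_def base_def balance_def sum.atLeast_Suc_lessThan)
      then show False using r(3)[OF True] by simp
    next
      case False
      then show False using r(4) * by (simp add: base_def)
    qed
  qed
  obtain q1 where q1: "q1 \<le> length (H ! j)" "?h (offset j + q1) = ?v j"
    "\<And>p. p < q1 \<Longrightarrow> H ! j ! (q1 - 1) = c \<Longrightarrow> ?v j < ?h (offset j + p)"
    "0 < q1" "H ! j ! (q1 - 1) = c"
    using ex_valley_position[OF r(1)] mem by metis
  then obtain q where q: "q1 = Suc q" by (cases q1) auto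
  have other: "?v j \<le> ?h i \<and> (i \<le> offset j + q \<longrightarrow> ?v j < ?h i)" if "i \<le> length (concat (rev H))" for i
  proof (cases "i < length (concat (rev H))")
    case True
    then obtain k p where k: "k < length H" "p < length (H ! k)" "i = offset k + p"
      using concat_rev_position by metis
    have ge: "?v k \<le> ?h i" using height_ge_valley[OF k(1)] k by simp
    consider "j < k" | "k = j" | "k < j" by linarith
    then show ?thesis
    proof cases
      case 1
      then show ?thesis using r(3)[OF k(1)] ge by force
    next
      case 2
      then show ?thesis using ge q1(3)[of p] q1(5) k q by auto
    next
      case 3
      then have "offset j + Suc q \<le> i" using offset_less[of k j "Suc q"] k r(1) q1(1) q by simp
      then show ?thesis using ge r(2)[OF k(1)] by simp
    qed
  next
    case False
    then have i: "i = length (concat (rev H))" using that by simp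
    have "?v j \<le> base c (Suc c) H 0"
    proof -
      have "0 < length H" using r(1) by linarith
      then have "?v 0 \<le> base c (Suc c) H 0" 
        by (simp add: valley_def base_def balance_def sum.atLeast_Suc_lessThan)
      then show ?thesis using r(2)[of 0] \<open>0 < length H\<close> by simp
    qed
    moreover have "offset j + Suc q \<le> i" unfolding i using offset_le[of j "Suc q"] r(1) q1(1) q by simp
    ultimately show ?thesis using i height_end[of c "Suc c" H] by simp
  qed
  have "last_close c (Suc c) (concat (rev H)) (offset j + q)"
    unfolding last_close_def add_Suc_right[symmetric] q[symmetric] q1(2)
  proof (intro conjI)
    show len: "offset j + q < length (concat (rev H))" using offset_le[of j "Suc q"] r(1) q1(1) q by simp
    show "concat (rev H) ! (offset j + q) = c"
      using concat_rev_split[OF r(1)] q1(1,5) q by (simp add: nth_append)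
    show "\<forall>i\<le>offset j + q. ?v j < ?h i" using other len by simp
  qed (use other in auto)
  then have "lower_word c (Suc c) (concat (rev H)) = Some ((concat (rev H))[offset j + q := Suc c])"
    using lower_word_iff[of c "Suc c"] by auto
  moreover have "q < length (H ! j)" "H ! j ! q = c" using q q1 by auto
  ultimately show thesis using that concat_rev_update[OF r(1)] by metis
qed

end

section \<open>Kashiwara operators on skew tableaux\<close>

lemma row_of_content_Suc:
  "row_of_content (Suc n) m = row_of_content n m @ replicate (m (Suc n)) (Suc n)"
  by (simp add: row_of_content_def)

lemma set_row_of_content: "set (row_of_content n m) \<subseteq> {1..n}"
  by (auto simp: row_of_content_def simp del: upt_Suc)

lemma sorted_row_of_content: "sorted (row_of_content n m)"
proof (induction n)
  case (Suc n)
  then show ?case using set_row_of_content[of n m]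
    by (fastforce simp: row_of_content_Suc sorted_append sorted_replicate)
qed (simp add: row_of_content_def)

lemma count_list_replicate: "count_list (replicate k x) y = (if x = y then k else 0)"
  by (induction k) auto

lemma count_list_row_of_content:
  "count_list (row_of_content n m) i = (if i \<in> {1..n} then m i else 0)"
proof (induction n)
  case (Suc n)
  then show ?case by (auto simp: row_of_content_Suc count_list_replicate le_Suc_eq)
qed (simp add: row_of_content_def)

lemma length_filter_row_of_content:
  assumes "\<And>i. i < n \<Longrightarrow> f i \<le> f (Suc i)"
  shows "int (length (filter (\<lambda>x. x \<le> i) (row_of_content n (\<lambda>i. nat (f i - f (i - 1)))))) = f (min i n) - (f 0 :: int)"
  using assms
proof (induction n)
  case (Suc n)
  have "int (length (filter (\<lambda>x. x \<le> i) (row_of_content n (\<lambda>i. nat (f i - f (i - 1)))))) = f (min i n) - f 0"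
    using Suc by simp
  then show ?case using Suc.prems[of n] by (cases "Suc n \<le> i") (auto simp: row_of_content_Suc min_def not_le)
qed (simp add: row_of_content_def)

lemma length_filter_update:
  assumes "q < length r"
  shows "length (filter Q (r[q := v])) + of_bool (Q (r ! q)) = length (filter Q r) + of_bool (Q v)"
  using arg_cong[OF id_take_nth_drop[OF assms], of "\<lambda>s. length (filter Q s)"]
    upd_conv_take_nth_drop[OF assms, of v] by simp

lemma length_filter_sort: "length (filter Q (sort r)) = length (filter Q r)"
  by (metis mset_filter mset_sort size_mset)

definition semistandard :: "nat \<Rightarrow> nat \<Rightarrow> tableau \<Rightarrow> bool" where
  "semistandard n l P \<longleftrightarrow> length P = Suc n \<and> (\<forall>i\<le>n. P ! i \<in> signatures l) \<and> (\<forall>i<n. P ! i \<preceq>\<^sub>h P ! Suc i)"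

lemma tableau_pair_iff:
  "tableau_pair n l (P, Q) \<longleftrightarrow> semistandard n l P \<and> semistandard n l Q \<and> P ! 0 = Q ! 0 \<and> P ! n = Q ! n"
  by (auto simp: tableau_pair_def semistandard_def)

lemma semistandard_mono:
  assumes "semistandard n l P" "i < n" "j < l"
  shows "P ! i ! j \<le> P ! Suc i ! j"
proof -
  have "P ! i \<preceq>\<^sub>h P ! Suc i" "length (P ! Suc i) = l"
    using assms by (auto simp: semistandard_def signatures_def)
  then show ?thesis using assms(3) by (simp add: hstrip_def)
qed

context
  fixes n l :: nat and P :: tableau
  assumes P: "semistandard n l P"
begin

lemma P_length: "length P = Suc n" "i \<le> n \<Longrightarrow> length (P ! i) = l"
  using P by (auto simp: semistandard_def signatures_def)

lemma length_tableau_rows: "length (tableau_rows P) = l"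
  using P_length by (simp add: tableau_rows_def)

lemma tableau_rows_nth:
  "j < l \<Longrightarrow> tableau_rows P ! j = row_of_content n (\<lambda>i. nat (P ! i ! j - P ! (i - 1) ! j))"
  using P_length by (simp add: tableau_rows_def)

lemma sorted_tableau_rows: "r \<in> set (tableau_rows P) \<Longrightarrow> sorted r"
  by (auto simp: tableau_rows_def sorted_row_of_content)

lemma count_tableau_rows:
  assumes "1 \<le> i" "i \<le> n" "j < l"
  shows "int (count_list (tableau_rows P ! j) i) = P ! i ! j - P ! (i - 1) ! j"
  using semistandard_mono[OF P, of "i - 1" j] assms by (simp add: tableau_rows_nth count_list_row_of_content)

lemma filter_tableau_rows:
  assumes "i \<le> n" "j < l"
  shows "int (length (filter (\<lambda>x. x \<le> i) (tableau_rows P ! j))) = P ! i ! j - P ! 0 ! j"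
  using length_filter_row_of_content[of n "\<lambda>i. P ! i ! j" i] semistandard_mono[OF P _ assms(2)] assms
  by (simp add: tableau_rows_nth)

text \<open>Exchanging a letter \<open>i + 1\<close> for \<open>i\<close>, or conversely, changes
  the number of letters up to \<open>a\<close> only for \<open>a = i\<close>. Hence one entry of one
  signature in the chain moves by one.\<close>

lemma tableau_of_rows_update:
  assumes j: "j < l" and q: "q < length (tableau_rows P ! j)" "tableau_rows P ! j ! q = u"
    and uv: "u = Suc i \<and> v = i \<and> d = 1 \<or> u = i \<and> v = Suc i \<and> d = -1"
  shows "tableau_of_rows n (P ! 0) (map sort ((tableau_rows P)[j := (tableau_rows P ! j)[q := v]]))
    = P[i := (P ! i)[j := P ! i ! j + d]]"
proof (rule nth_equalityI)
  let ?H = "tableau_rows P" let ?K = "map sort (?H[j := (?H ! j)[q := v]])"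
  show "length (tableau_of_rows n (P ! 0) ?K) = length (P[i := (P ! i)[j := P ! i ! j + d]])"
    by (simp add: tableau_of_rows_def P_length del: upt_Suc)
  fix a assume "a < length (tableau_of_rows n (P ! 0) ?K)"
  then have a: "a \<le> n" by (simp add: tableau_of_rows_def del: upt_Suc)
  have row: "tableau_of_rows n (P ! 0) ?K ! a = map2 (\<lambda>k r. k + int (length (filter (\<lambda>x. x \<le> a) r))) (P ! 0) ?K"
    using a by (simp add: tableau_of_rows_def del: upt_Suc)
  have lens: "length (P ! 0) = l" "length ?K = l" "length (P ! a) = l"
    using P_length a length_tableau_rows by simp_all
  show "tableau_of_rows n (P ! 0) ?K ! a = P[i := (P ! i)[j := P ! i ! j + d]] ! a"
  proof (rule nth_equalityI)
    show "length (tableau_of_rows n (P ! 0) ?K ! a) = length (P[i := (P ! i)[j := P ! i ! j + d]] ! a)"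
    proof -
      have "length (tableau_of_rows n (P ! 0) ?K ! a) = l" using lens by (simp add: row)
      moreover have "length (P[i := (P ! i)[j := P ! i ! j + d]] ! a) = l"
        using a P_length by (cases "a = i") simp_all
      ultimately show ?thesis by simp
    qed
    fix k assume "k < length (tableau_of_rows n (P ! 0) ?K ! a)"
    then have k: "k < l" using lens by (simp add: row)
    have "int (length (filter (\<lambda>x. x \<le> a) (?K ! k))) = P ! a ! k - P ! 0 ! k + (if a = i \<and> k = j then d else 0)"
    proof (cases "k = j")
      case True
      have "int (length (filter (\<lambda>x. x \<le> a) ((?H ! j)[q := v])))
          = int (length (filter (\<lambda>x. x \<le> a) (?H ! j))) + (if a = i then d else 0)"
      proof -
        consider "a = i" | "Suc i \<le> a" | "Suc a \<le> i" by linarith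
        then show ?thesis
          using length_filter_update[OF q(1), of "\<lambda>x. x \<le> a" v] q(2) uv by cases auto
      qed
      then show ?thesis using True filter_tableau_rows[OF a j] k
        by (simp add: length_tableau_rows length_filter_sort)
    next
      case False
      then show ?thesis using filter_tableau_rows[OF a k] k
        by (auto simp: length_tableau_rows length_filter_sort)
    qed
    moreover have "tableau_of_rows n (P ! 0) ?K ! a ! k = P ! 0 ! k + int (length (filter (\<lambda>x. x \<le> a) (?K ! k)))"
      using k lens by (simp add: row)
    ultimately show "tableau_of_rows n (P ! 0) ?K ! a ! k = P[i := (P ! i)[j := P ! i ! j + d]] ! a ! k"
      using a k P_length by (cases "a = i"; cases "k = j") simp_all
  qed
qed

lemma act_skew_ED:
  assumes "act_skew n (E i) P = Some P'" "1 \<le> i"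
  obtains j where "row_open i (tableau_rows P) j" "i < n" "P' = P[i := (P ! i)[j := P ! i ! j + 1]]"
proof -
  let ?H = "tableau_rows P"
  obtain w where w: "raise_word i (Suc i) (concat (rev ?H)) = Some w"
    "P' = tableau_of_rows n (P ! 0) (map sort (rev (split_word (rev (map length ?H)) w)))"
    using assms by (auto simp: act_skew_def act_hwt_def reading_word_def)
  obtain j q where j: "row_open i ?H j" "q < length (?H ! j)" "?H ! j ! q = Suc i"
    "w = concat (rev (?H[j := (?H ! j)[q := i]]))"
    using raise_word_rowsD[OF sorted_tableau_rows w(1)] by metis
  have jl: "j < l" using j(1) by (simp add: row_open_def length_tableau_rows)
  \<comment> \<open>The letter that is changed occurs in a row over the alphabet, which excludes
    operators of too large an index.\<close>
  have "Suc i \<in> {1..n}"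
    using j(2,3) tableau_rows_nth[OF jl] set_row_of_content nth_mem by (metis subsetD)
  moreover have "rev (map length ?H) = map length (rev (?H[j := (?H ! j)[q := i]]))"
    using list_update_id[of "map length ?H" j] jl by (simp add: rev_map[symmetric] map_update length_tableau_rows)
  then have "P' = P[i := (P ! i)[j := P ! i ! j + 1]]"
    using tableau_of_rows_update[OF jl j(2,3)] w(2) j(4) by (simp add: split_word_concat)
  ultimately show thesis using that j(1) by simp
qed

lemma act_skew_EI:
  assumes "row_open i (tableau_rows P) j" "1 \<le> i"
  shows "act_skew n (E i) P = Some (P[i := (P ! i)[j := P ! i ! j + 1]])"
proof -
  let ?H = "tableau_rows P"
  obtain q where q: "q < length (?H ! j)" "?H ! j ! q = Suc i"
    "raise_word i (Suc i) (concat (rev ?H)) = Some (concat (rev (?H[j := (?H ! j)[q := i]])))"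
    using raise_word_rowsI[OF sorted_tableau_rows assms(1)] by metis
  have jl: "j < l" using assms(1) by (simp add: row_open_def length_tableau_rows)
  have "rev (map length ?H) = map length (rev (?H[j := (?H ! j)[q := i]]))"
    using list_update_id[of "map length ?H" j] jl by (simp add: rev_map[symmetric] map_update length_tableau_rows)
  then show ?thesis
    using tableau_of_rows_update[OF jl q(1,2)] q(3) assms(2)
    by (simp add: act_skew_def act_hwt_def reading_word_def split_word_concat)
qed

lemma act_skew_FD:
  assumes "act_skew n (F i) P = Some P'" "1 \<le> i"
  obtains j where "row_close i (tableau_rows P) j" "P' = P[i := (P ! i)[j := P ! i ! j - 1]]"
proof -
  let ?H = "tableau_rows P"
  obtain w where w: "lower_word i (Suc i) (concat (rev ?H)) = Some w"
    "P' = tableau_of_rows n (P ! 0) (map sort (rev (split_word (rev (map length ?H)) w)))"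
    using assms by (auto simp: act_skew_def act_hwt_def reading_word_def)
  obtain j q where j: "row_close i ?H j" "q < length (?H ! j)" "?H ! j ! q = i"
    "w = concat (rev (?H[j := (?H ! j)[q := Suc i]]))"
    using lower_word_rowsD[OF sorted_tableau_rows w(1)] by metis
  have jl: "j < l" using j(1) by (simp add: row_close_def length_tableau_rows)
  have "rev (map length ?H) = map length (rev (?H[j := (?H ! j)[q := Suc i]]))"
    using list_update_id[of "map length ?H" j] jl by (simp add: rev_map[symmetric] map_update length_tableau_rows)
  then have "P' = P[i := (P ! i)[j := P ! i ! j - 1]]"
    using tableau_of_rows_update[OF jl j(2,3), of i "Suc i" "-1"] w(2) j(4) by (simp add: split_word_concat)
  then show thesis using that j(1) by simp
qed

lemma act_skew_FI:
  assumes "row_close i (tableau_rows P) j" "1 \<le> i"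
  shows "act_skew n (F i) P = Some (P[i := (P ! i)[j := P ! i ! j - 1]])"
proof -
  let ?H = "tableau_rows P"
  obtain q where q: "q < length (?H ! j)" "?H ! j ! q = i"
    "lower_word i (Suc i) (concat (rev ?H)) = Some (concat (rev (?H[j := (?H ! j)[q := Suc i]])))"
    using lower_word_rowsI[OF sorted_tableau_rows assms(1)] by metis
  have jl: "j < l" using assms(1) by (simp add: row_close_def length_tableau_rows)
  have "rev (map length ?H) = map length (rev (?H[j := (?H ! j)[q := Suc i]]))"
    using list_update_id[of "map length ?H" j] jl by (simp add: rev_map[symmetric] map_update length_tableau_rows)
  then show ?thesis
    using tableau_of_rows_update[OF jl q(1,2), of i "Suc i" "-1"] q(3) assms(2)
    by (simp add: act_skew_def act_hwt_def reading_word_def split_word_concat)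
qed

end

section \<open>Three consecutive signatures: row reading against column reading\<close>

definition total_excess :: "int list \<Rightarrow> int list \<Rightarrow> int list \<Rightarrow> int" where
  "total_excess kap mu lam = (\<Sum>k<length mu. lam ! k - 2 * mu ! k + kap ! k)"

lemma excess_high:
  assumes "length kap = length mu" "length lam = length mu"
    "\<And>k. k \<in> set lam \<union> set mu \<union> set kap \<Longrightarrow> k \<le> x"
  shows "excess kap mu lam x = total_excess kap mu lam"
proof -
  have "min (lam ! j) x - 2 * min (mu ! j) x + min (kap ! j) x = lam ! j - 2 * mu ! j + kap ! j" if "j < length mu" for j
    using assms(3)[of "lam ! j"] assms(3)[of "mu ! j"] assms(3)[of "kap ! j"] assms(1,2) that by simp
  then show ?thesis unfolding excess_def total_excess_def by simp
qed

lemma excess_constant: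
  assumes "length kap = length mu" "length lam = length mu"
  obtains lo hi where "\<And>x. x \<le> lo \<Longrightarrow> excess kap mu lam x = 0"
    "\<And>x. hi \<le> x \<Longrightarrow> excess kap mu lam x = total_excess kap mu lam"
proof -
  let ?S = "insert 0 (set lam \<union> set mu \<union> set kap)"
  have "Min ?S \<le> k" "k \<le> Max ?S" if "k \<in> set lam \<union> set mu \<union> set kap" for k
    using that by (auto intro: Min_le Max_ge)
  then show thesis
    using that[of "Min ?S" "Max ?S"] excess_low[OF assms] excess_high[OF assms] by (meson order_trans)
qed

text \<open>Cut at column \<open>mu ! j\<close>. By interlacing, the rows above \<open>j\<close>
  extend to this column in all three signatures and contribute 0, while the rows below
  \<open>j\<close> lie entirely within the cut. In row \<open>j\<close> only the strip
  \<open>mu ! j - kap ! j\<close> remains visible.\<close>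

lemma excess_at_part:
  assumes "kap \<preceq>\<^sub>h mu" "mu \<preceq>\<^sub>h lam" "j < length mu"
  shows "excess kap mu lam (mu ! j)
    = (\<Sum>k\<in>{Suc j..<length mu}. (lam ! k - mu ! k) - (mu ! k - kap ! k)) - (mu ! j - kap ! j)"
proof -
  let ?g = "\<lambda>k. min (lam ! k) (mu ! j) - 2 * min (mu ! k) (mu ! j) + min (kap ! k) (mu ! j)"
  have len: "length lam = length mu" "length kap = length mu" using assms by (auto simp: hstrip_def)
  have sig: "mu \<in> signatures (length mu)" using hstrip_signatures(2)[OF assms(1)] .
  have km: "\<And>k. k < length mu \<Longrightarrow> kap ! k \<le> mu ! k" "\<And>k. Suc k < length mu \<Longrightarrow> mu ! Suc k \<le> kap ! k"
    and ml: "\<And>k. k < length mu \<Longrightarrow> mu ! k \<le> lam ! k" "\<And>k. Suc k < length mu \<Longrightarrow> lam ! Suc k \<le> mu ! k"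
    using assms(1,2) len by (auto simp: hstrip_def)
  have "{..<length mu} = {..<j} \<union> {j} \<union> {Suc j..<length mu}" using assms(3) by auto
  then have "excess kap mu lam (mu ! j) = sum ?g ({..<j} \<union> {j} \<union> {Suc j..<length mu})"
    by (simp add: excess_def)
  also have "\<dots> = sum ?g {..<j} + ?g j + sum ?g {Suc j..<length mu}"
    by (subst sum.union_disjoint, simp, simp, force, subst sum.union_disjoint) auto
  also have "sum ?g {..<j} = 0"
  proof (rule sum.neutral, rule ballI)
    fix k assume "k \<in> {..<j}"
    then have "mu ! j \<le> mu ! Suc k" "Suc k < length mu" "mu ! j \<le> mu ! k"
      using signaturesD(2)[OF sig, of "Suc k" j] signaturesD(2)[OF sig, of k j] assms(3) by auto
    then show "?g k = 0" using km(2)[of k] ml(1)[of k] by simp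
  qed
  also have "sum ?g {Suc j..<length mu} = (\<Sum>k\<in>{Suc j..<length mu}. (lam ! k - mu ! k) - (mu ! k - kap ! k))"
  proof (rule sum.cong)
    fix k assume k: "k \<in> {Suc j..<length mu}"
    then have "lam ! k \<le> mu ! (k - 1)" "mu ! (k - 1) \<le> mu ! j"
      using ml(2)[of "k - 1"] signaturesD(2)[OF sig, of j "k - 1"] by auto
    then show "?g k = (lam ! k - mu ! k) - (mu ! k - kap ! k)"
      using k ml(1)[of k] km(1)[of k] by simp
  qed simp
  also have "?g j = - (mu ! j - kap ! j)" using km(1) ml(1) assms(3) by simp
  finally show ?thesis by simp
qed

text \<open>The bridge between the two readings: the row word and the column function take the same
  values at the places where the signature rule looks for its minimum.\<close>

lemma valley_eq_excess:
  assumes P: "semistandard n l P" and i: "1 \<le> i" "i < n"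
  shows "j < l \<Longrightarrow> valley i (Suc i) (tableau_rows P) j = excess (P ! (i - 1)) (P ! i) (P ! Suc i) (P ! i ! j)"
    and "base i (Suc i) (tableau_rows P) 0 = total_excess (P ! (i - 1)) (P ! i) (P ! Suc i)"
proof -
  have h: "P ! (i - 1) \<preceq>\<^sub>h P ! i" "P ! i \<preceq>\<^sub>h P ! Suc i" and len: "length (P ! i) = l"
    using P i by (auto simp: semistandard_def signatures_def dest: spec[of _ "i - 1"])
  have bal: "balance i (Suc i) (tableau_rows P ! k) = (P ! Suc i ! k - P ! i ! k) - (P ! i ! k - P ! (i - 1) ! k)"
    if "k < l" for k
    using count_tableau_rows[OF P, of i k] count_tableau_rows[OF P, of "Suc i" k] i that by (simp add: balance_def)
  show "valley i (Suc i) (tableau_rows P) j = excess (P ! (i - 1)) (P ! i) (P ! Suc i) (P ! i ! j)" if "j < l"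
    unfolding valley_def base_def length_tableau_rows[OF P]
    using excess_at_part[OF h, of j] len that bal count_tableau_rows[OF P, of i j] i by simp
  show "base i (Suc i) (tableau_rows P) 0 = total_excess (P ! (i - 1)) (P ! i) (P ! Suc i)"
    unfolding base_def length_tableau_rows[OF P] total_excess_def len
    by (rule sum.cong) (use bal in auto)
qed

text \<open>Constancy near both ends makes the minimum attained; \<open>A z < b\<close> prevents it
  from being attained arbitrarily far to the right.\<close>

lemma ex_last_minimum:
  fixes A :: "int \<Rightarrow> int"
  assumes lo: "\<And>x. x \<le> lo \<Longrightarrow> A x = a" and hi: "\<And>x. hi \<le> x \<Longrightarrow> A x = b" and z: "A z < b"
  obtains y where "\<And>x. A y \<le> A x" "\<And>x. y < x \<Longrightarrow> A y < A x"
proof -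
  let ?I = "{min lo hi..max lo hi}"
  define m where "m = Min (A ` ?I)"
  have fin: "finite (A ` ?I)" "A ` ?I \<noteq> {}" by auto
  have m: "m \<le> A x" for x
  proof -
    consider "x \<in> ?I" | "x < min lo hi" | "max lo hi < x" by (metis atLeastAtMost_iff not_le)
    then have "A x \<in> A ` ?I"
    proof cases
      case 2
      then have "A x = A (min lo hi)" using lo[of x] lo[of "min lo hi"] by simp
      then show ?thesis by simp
    next
      case 3
      then have "A x = A (max lo hi)" using hi[of x] hi[of "max lo hi"] by simp
      then show ?thesis by simp
    qed auto
    then show ?thesis unfolding m_def using fin by (intro Min_le)
  qed
  let ?S = "{x \<in> ?I. A x = m}"
  have "m \<in> A ` ?I" unfolding m_def using fin by (intro Min_in)
  then have S: "finite ?S" "?S \<noteq> {}" by (auto intro: finite_subset[of _ ?I])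
  define y where "y = Max ?S"
  have y: "A y = m" "y \<in> ?I" using Max_in[OF S] by (auto simp: y_def)
  have "m < A x" if "y < x" for x
  proof -
    have "A x \<noteq> m"
    proof
      assume x: "A x = m"
      have "b > m" using z m[of z] by simp
      then have "\<not> hi \<le> x" using hi[of x] x by auto
      then have "x \<in> ?I" using that y(2) by auto
      then have "x \<le> y" using x S(1) by (simp add: y_def)
      then show False using that by simp
    qed
    then show ?thesis using m[of x] by simp
  qed
  then show thesis using that[of y] m y(1) by simp
qed

lemma ex_first_minimum:
  fixes A :: "int \<Rightarrow> int"
  assumes lo: "\<And>x. x \<le> lo \<Longrightarrow> A x = a" and hi: "\<And>x. hi \<le> x \<Longrightarrow> A x = b" and z: "A z < a"
  obtains y where "\<And>x. A y \<le> A x" "\<And>x. x < y \<Longrightarrow> A y < A x"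
proof -
  obtain y where y: "\<And>x. A (- y) \<le> A (- x)" "\<And>x. y < x \<Longrightarrow> A (- y) < A (- x)"
    using ex_last_minimum[of "- hi" "\<lambda>x. A (- x)" b "- lo" a "- z"] lo hi z by auto
  have "A (- y) \<le> A x" for x using y(1)[of "- x"] by simp
  moreover have "A (- y) < A x" if "x < - y" for x using y(2)[of "- x"] that by simp
  ultimately show thesis by (rule that)
qed

lemma ex_part_of_conjugate_less:
  assumes "mu \<in> signatures l" "conjugate mu (y + 1) < conjugate mu y"
  obtains j where "j < l" "mu ! j = y"
proof -
  define j where "j = nat (conjugate mu (y + 1))"
  have "int j < conjugate mu y" "\<not> int j < conjugate mu (y + 1)" "j < l"
    using assms conjugate_bounds[of mu y] conjugate_bounds[of mu "y + 1"]
    by (auto simp: j_def signatures_def)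
  then have "y \<le> mu ! j" "\<not> y + 1 \<le> mu ! j" using conjugate_gt_iff[OF assms(1)] by auto
  then show thesis using that[of j] \<open>j < l\<close> by simp
qed

text \<open>The excess rises at \<open>y + 1\<close> and does not rise at \<open>y\<close>. If the
  columns \<open>y\<close> and \<open>y + 1\<close> of \<open>mu\<close> had equal height,
  antitonicity of the columns of \<open>lam\<close> and \<open>kap\<close> would force the bits of
  \<open>y + 1\<close> on \<open>y\<close> as well, and the excess would rise there.\<close>

lemma last_minimum_is_part:
  assumes h: "kap \<preceq>\<^sub>h mu" "mu \<preceq>\<^sub>h lam"
    and y: "\<And>x. excess kap mu lam y \<le> excess kap mu lam x" "\<And>x. y < x \<Longrightarrow> excess kap mu lam y < excess kap mu lam x"
  obtains j where "j < length mu" "mu ! j = y"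
proof -
  have len: "length kap = length mu" "length lam = length mu" using h by (auto simp: hstrip_def)
  have "conjugate mu (y + 1) < conjugate mu y"
    using excess_diff[OF len, of "y + 1"] excess_diff[OF len, of y] y(1)[of "y - 1"] y(2)[of "y + 1"]
      hstrip_bits[OF h(1), of "y + 1"] hstrip_bits[OF h(1), of y] hstrip_bits[OF h(2), of "y + 1"] hstrip_bits[OF h(2), of y]
      conjugate_antimono[of y "y + 1" mu] conjugate_antimono[of y "y + 1" lam] conjugate_antimono[of y "y + 1" kap]
    by auto
  then show thesis using ex_part_of_conjugate_less[OF hstrip_signatures(2)[OF h(1)]] that by metis
qed

lemma first_minimum_is_part:
  assumes h: "kap \<preceq>\<^sub>h mu" "mu \<preceq>\<^sub>h lam"
    and y: "\<And>x. excess kap mu lam y \<le> excess kap mu lam x" "\<And>x. x < y \<Longrightarrow> excess kap mu lam y < excess kap mu lam x"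
  obtains j where "j < length mu" "mu ! j = y"
proof -
  have len: "length kap = length mu" "length lam = length mu" using h by (auto simp: hstrip_def)
  have "conjugate mu (y + 1) < conjugate mu y"
    using excess_diff[OF len, of "y + 1"] excess_diff[OF len, of y] y(2)[of "y - 1"] y(1)[of "y + 1"]
      hstrip_bits[OF h(1), of "y + 1"] hstrip_bits[OF h(1), of y] hstrip_bits[OF h(2), of "y + 1"] hstrip_bits[OF h(2), of y]
      conjugate_antimono[of y "y + 1" mu] conjugate_antimono[of y "y + 1" lam] conjugate_antimono[of y "y + 1" kap]
    by auto
  then show thesis using ex_part_of_conjugate_less[OF hstrip_signatures(2)[OF h(1)]] that by metis
qed

lemma conjugate_update:
  assumes "j < length mu"
  shows "conjugate (mu[j := mu ! j + 1]) x = conjugate mu x + of_bool (x = mu ! j + 1)"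
proof -
  let ?S = "{k. k < length mu \<and> x \<le> mu ! k}"
  have "{k. k < length (mu[j := mu ! j + 1]) \<and> x \<le> mu[j := mu ! j + 1] ! k} = (if x = mu ! j + 1 then insert j ?S else ?S)"
    using assms by (auto simp: nth_list_update split: if_splits)
  moreover have "finite ?S" "x = mu ! j + 1 \<Longrightarrow> j \<notin> ?S" by auto
  ultimately show ?thesis by (simp add: conjugate_def)
qed

lemma signatures_update:
  assumes "mu \<in> signatures l" "j < l" "\<And>k. k < j \<Longrightarrow> mu ! j + 1 \<le> mu ! k"
  shows "mu[j := mu ! j + 1] \<in> signatures l"
proof -
  have "mu[j := mu ! j + 1] ! k \<le> mu[j := mu ! j + 1] ! i" if "i < k" "k < l" for i k
  proof -
    have "mu ! k \<le> mu ! i" using signaturesD(2)[OF assms(1), of i k] that by simp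
    then show ?thesis using signaturesD(1)[OF assms(1)] assms(2) assms(3)[of i] that
      by (cases "i = j"; cases "k = j") auto
  qed
  then show ?thesis using signaturesD(1)[OF assms(1)] by (simp add: signatures_def sorted_wrt_iff_nth_less)
qed

lemma hstrip_update:
  assumes h: "kap \<preceq>\<^sub>h mu" "mu \<preceq>\<^sub>h lam" and sig: "mu' \<in> signatures (length mu)"
    and mu': "\<And>x. conjugate mu' x = conjugate mu x + of_bool (x = x0)"
    and x0: "conjugate mu x0 = conjugate kap x0" "conjugate lam x0 = conjugate mu x0 + 1"
  shows "kap \<preceq>\<^sub>h mu'" "mu' \<preceq>\<^sub>h lam"
proof -
  have s: "kap \<in> signatures (length mu)" "lam \<in> signatures (length mu)"
    using hstrip_signatures[OF h(1)] hstrip_signatures[OF h(2)] hstrip_length[OF h(2)] by auto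
  have bits: "conjugate mu x - conjugate kap x = 0 \<or> conjugate mu x - conjugate kap x = 1"
    "conjugate lam x - conjugate mu x = 0 \<or> conjugate lam x - conjugate mu x = 1" for x
    using hstrip_bits[OF h(1), of x] hstrip_bits[OF h(2), of x] by auto
  show "kap \<preceq>\<^sub>h mu'" unfolding hstrip_iff[OF s(1) sig] mu'
  proof
    show "conjugate kap x \<le> conjugate mu x + of_bool (x = x0) \<and> conjugate mu x + of_bool (x = x0) \<le> conjugate kap x + 1" for x
      using bits(1)[of x] x0 by (cases "x = x0") auto
  qed
  show "mu' \<preceq>\<^sub>h lam" unfolding hstrip_iff[OF sig s(2)] mu'
  proof
    show "conjugate mu x + of_bool (x = x0) \<le> conjugate lam x \<and> conjugate lam x \<le> conjugate mu x + of_bool (x = x0) + 1" for x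
      using bits(2)[of x] x0 by (cases "x = x0") auto
  qed
qed

text \<open>The last minimum of the excess is some part \<open>mu ! k\<close>, so comparing parts
  suffices. Parts decrease with the index, and therefore the smallest index among the minimal parts
  gives the last column.\<close>

lemma raisesI:
  assumes h: "kap \<preceq>\<^sub>h mu" "mu \<preceq>\<^sub>h lam" and j: "j < length mu"
    and min: "\<And>k. k < length mu \<Longrightarrow> excess kap mu lam (mu ! j) \<le> excess kap mu lam (mu ! k)"
      "\<And>k. k < j \<Longrightarrow> excess kap mu lam (mu ! j) < excess kap mu lam (mu ! k)"
      "excess kap mu lam (mu ! j) < total_excess kap mu lam"
  shows "raises kap mu lam (mu[j := mu ! j + 1])"
proof -
  let ?A = "excess kap mu lam"
  have len: "length kap = length mu" "length lam = length mu" using h by (auto simp: hstrip_def)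
  have sig: "mu \<in> signatures (length mu)" using hstrip_signatures(2)[OF h(1)] .
  obtain y where y: "\<And>x. ?A y \<le> ?A x" "\<And>x. y < x \<Longrightarrow> ?A y < ?A x"
    using excess_constant[OF len] ex_last_minimum[of _ ?A] min(3) by metis
  obtain k where k: "k < length mu" "mu ! k = y" using last_minimum_is_part[OF h y] by blast
  have "?A y = ?A (mu ! j)" using min(1)[OF k(1)] y(1)[of "mu ! j"] k(2) by simp
  then have "\<not> k < j" "\<not> y < mu ! j" using min(2)[of k] y(2)[of "mu ! j"] k(2) by auto
  then have yj: "y = mu ! j" using signaturesD(2)[OF sig, of j k] k by simp
  then have r: "raises_at ?A (mu ! j + 1)" using y by (simp add: raises_at_def)
  \<comment> \<open>Equal parts have equal excess, so strictness makes \<open>j\<close> the first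
    row of its length, to which a cell can be added.\<close>
  have "mu ! j + 1 \<le> mu ! k" if "k < j" for k
    using min(2)[OF that] signaturesD(2)[OF sig, of k j] that j by (cases "mu ! j = mu ! k") auto
  then have sig': "mu[j := mu ! j + 1] \<in> signatures (length mu)" using signatures_update[OF sig j] by blast
  have "conjugate mu (mu ! j + 1) = conjugate kap (mu ! j + 1)"
    "conjugate lam (mu ! j + 1) = conjugate mu (mu ! j + 1) + 1"
    using r excess_diff[OF len, of "mu ! j + 1"] hstrip_bits[OF h(1), of "mu ! j + 1"] hstrip_bits[OF h(2), of "mu ! j + 1"]
    by (auto simp: raises_at_def dest: spec[of _ "mu ! j + 1"])
  then show ?thesis
    using hstrip_update[OF h sig' conjugate_update[OF j]] h r conjugate_update[OF j] unfolding raises_def by blast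
qed

lemma excess_raise:
  assumes len: "length kap = length mu" "length lam = length mu" "length mu' = length mu"
    and mu': "\<And>x. conjugate mu' x = conjugate mu x + of_bool (x = x0)"
  shows "excess kap mu' lam x = excess kap mu lam x - (if x0 \<le> x then 2 else 0)"
proof -
  obtain lo hi where "\<And>x. x \<le> lo \<Longrightarrow> excess kap mu lam x = 0"
    using excess_constant[OF len(1,2)] by metis
  then have "\<forall>\<^sub>F x in at_bot. excess kap mu lam x - (if x0 \<le> x then 2 else 0) = 0"
    unfolding eventually_at_bot_linorder by (intro exI[of _ "min lo (x0 - 1)"]) auto
  then have "(\<lambda>x. excess kap mu lam x - (if x0 \<le> x then 2 else 0)) = excess kap mu' lam"
    using len excess_diff[OF len(1,2)] by (intro excess_eqI) (auto simp: mu' algebra_simps)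
  then show ?thesis by metis
qed

lemma raisesI':
  assumes h: "kap \<preceq>\<^sub>h mu" "mu \<preceq>\<^sub>h lam" and j: "j < length mu"
    and min: "\<And>k. k < length mu \<Longrightarrow> excess kap mu lam (mu ! j) \<le> excess kap mu lam (mu ! k)"
      "\<And>k. k < length mu \<Longrightarrow> j < k \<Longrightarrow> excess kap mu lam (mu ! j) < excess kap mu lam (mu ! k)"
      "excess kap mu lam (mu ! j) < 0"
  shows "raises kap (mu[j := mu ! j - 1]) lam mu"
proof -
  let ?A = "excess kap mu lam" let ?mu = "mu[j := mu ! j - 1]"
  have len: "length kap = length mu" "length lam = length mu" "length ?mu = length mu" using h by (auto simp: hstrip_def)
  have sigs: "mu \<in> signatures (length mu)" "kap \<in> signatures (length mu)" "lam \<in> signatures (length mu)"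
    using hstrip_signatures[OF h(1)] hstrip_signatures[OF h(2)] len by auto
  obtain y where y: "\<And>x. ?A y \<le> ?A x" "\<And>x. x < y \<Longrightarrow> ?A y < ?A x"
    using excess_constant[OF len(1,2)] ex_first_minimum[of _ ?A] min(3) by metis
  obtain k where k: "k < length mu" "mu ! k = y" using first_minimum_is_part[OF h y] by blast
  have "?A y = ?A (mu ! j)" using min(1)[OF k(1)] y(1)[of "mu ! j"] k(2) by simp
  then have "\<not> j < k" "\<not> mu ! j < y" using min(2)[of k] y(2)[of "mu ! j"] k by auto
  then have yj: "y = mu ! j" using signaturesD(2)[OF sigs(1), of k j] k j by simp
  have upd: "?mu[j := ?mu ! j + 1] = mu" using j by simp
  have conj: "conjugate mu x = conjugate ?mu x + of_bool (x = y)" for x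
    using conjugate_update[of j ?mu x] j by (simp add: yj)
  have A': "excess kap ?mu lam x = ?A x + (if y \<le> x then 2 else 0)" for x
  proof -
    have "?A x = excess kap ?mu lam x - (if y \<le> x then 2 else 0)"
      by (rule excess_raise[OF _ _ _ conj]) (simp_all only: len)
    then show ?thesis by linarith
  qed
  have diff: "?A (y - 1) > ?A y" using y(2)[of "y - 1"] by simp
  have bits: "conjugate mu y = conjugate kap y + 1" "conjugate lam y = conjugate mu y"
    using diff excess_diff[OF len(1,2), of y] hstrip_bits[OF h(1), of y] hstrip_bits[OF h(2), of y] by auto
  \<comment> \<open>Removing the cell in column \<open>y\<close> adds 2 from \<open>y\<close> on. As
    the excess falls by exactly 1 at \<open>y\<close>, its last minimum moves to
    \<open>y - 1\<close>, where \<open>raises_at\<close> wants it.\<close>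
  then have "?A (y - 1) = ?A y + 1" using excess_diff[OF len(1,2), of y] by simp
  then have "raises_at (excess kap ?mu lam) y"
    unfolding raises_at_def A'
  proof (intro conjI allI impI)
    fix x
    show "?A (y - 1) + (if y \<le> y - 1 then 2 else 0) \<le> ?A x + (if y \<le> x then 2 else 0)"
      using y(1)[of x] y(2)[of x] \<open>?A (y - 1) = ?A y + 1\<close> by (cases "y \<le> x") simp_all
    show "?A (y - 1) + (if y \<le> y - 1 then 2 else 0) < ?A x + (if y \<le> x then 2 else 0)" if "y \<le> x"
      using y(1)[of x] \<open>?A (y - 1) = ?A y + 1\<close> that by simp
  qed
  moreover have "?mu \<in> signatures (length mu)"
  proof -
    have less: "mu ! k < mu ! j" if "j < k" "k < length mu" for k
      using min(2)[of k] signaturesD(2)[OF sigs(1), of j k] that by (cases "mu ! j = mu ! k") auto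
    have "?mu ! k \<le> ?mu ! i" if "i < k" "k < length mu" for i k
      using less[of k] signaturesD(2)[OF sigs(1), of i k] that j by (auto simp: nth_list_update)
    then show ?thesis by (simp add: signatures_def sorted_wrt_iff_nth_less)
  qed
  note sig' = this
  have bits': "conjugate mu x - conjugate kap x = 0 \<or> conjugate mu x - conjugate kap x = 1"
    "conjugate lam x - conjugate mu x = 0 \<or> conjugate lam x - conjugate mu x = 1"
    "conjugate ?mu x = conjugate mu x - of_bool (x = y)" for x
    using hstrip_bits[OF h(1), of x] hstrip_bits[OF h(2), of x] conj[of x] by auto
  have "conjugate kap x \<le> conjugate ?mu x \<and> conjugate ?mu x \<le> conjugate kap x + 1 \<and>
      conjugate ?mu x \<le> conjugate lam x \<and> conjugate lam x \<le> conjugate ?mu x + 1" for x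
    unfolding bits'(3) using bits'(1,2)[of x] bits by (cases "x = y") auto
  then have "kap \<preceq>\<^sub>h ?mu" "?mu \<preceq>\<^sub>h lam"
    unfolding hstrip_iff[OF sigs(2) sig'] hstrip_iff[OF sig' sigs(3)] by blast+
  ultimately show ?thesis using h conj unfolding raises_def by blast
qed

text \<open>The same row \<open>j\<close> is seen from both ends: for \<open>mu\<close> it carries
  the last minimum, which is the rule for \<open>e_i\<close>, and for \<open>mu'\<close> the first
  minimum, which is the rule for \<open>f_i\<close>.\<close>

lemma raisesE:
  assumes r: "raises kap mu lam mu'"
  obtains j where "j < length mu" "mu' = mu[j := mu ! j + 1]" "mu = mu'[j := mu' ! j - 1]"
    "\<And>k. k < length mu \<Longrightarrow> excess kap mu lam (mu ! j) \<le> excess kap mu lam (mu ! k)"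
    "\<And>k. k < j \<Longrightarrow> excess kap mu lam (mu ! j) < excess kap mu lam (mu ! k)"
    "excess kap mu lam (mu ! j) < total_excess kap mu lam"
    "\<And>k. k < length mu \<Longrightarrow> excess kap mu' lam (mu' ! j) \<le> excess kap mu' lam (mu' ! k)"
    "\<And>k. k < length mu \<Longrightarrow> j < k \<Longrightarrow> excess kap mu' lam (mu' ! j) < excess kap mu' lam (mu' ! k)"
    "excess kap mu' lam (mu' ! j) < 0"
proof -
  let ?A = "excess kap mu lam" and ?A' = "excess kap mu' lam"
  obtain x0 where conj: "\<And>x. conjugate mu' x = conjugate mu x + of_bool (x = x0)" and at: "raises_at ?A x0"
    and h: "kap \<preceq>\<^sub>h mu" "mu \<preceq>\<^sub>h lam" "kap \<preceq>\<^sub>h mu'" "mu' \<preceq>\<^sub>h lam" using r by (auto simp: raises_def)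
  have len: "length kap = length mu" "length lam = length mu" "length mu' = length mu" using h by (auto simp: hstrip_def)
  have sig: "mu \<in> signatures (length mu)" "mu' \<in> signatures (length mu)"
    using hstrip_signatures(2)[OF h(1)] hstrip_signatures(2)[OF h(3)] len by auto
  \<comment> \<open>The new cell lies on top of column \<open>x0\<close>, hence in the row whose
    index, counted from 0, is the old height of that column.\<close>
  define j where "j = nat (conjugate mu x0)"
  have cj: "int j = conjugate mu x0" using conjugate_bounds[of mu x0] by (simp add: j_def)
  have j: "j < length mu" using conjugate_bounds(2)[of mu' x0] conj[of x0] cj len by simp
  have le: "x \<le> mu' ! k \<longleftrightarrow> x \<le> mu ! k \<or> x = x0 \<and> k = j" if "k < length mu" for x k
    using conjugate_gt_iff[OF sig(1) that, of x] conjugate_gt_iff[OF sig(2) that, of x] conj[of x] cj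
    by (cases "x = x0") auto
  have other: "mu' ! k = mu ! k" if "k < length mu" "k \<noteq> j" for k
    using le[OF that(1)] that(2) by (meson order_antisym order_refl)
  have "\<not> x0 \<le> mu ! j" using conjugate_gt_iff[OF sig(1) j, of x0] cj by simp
  then have "mu' ! j = x0" using le[OF j, of "mu' ! j"] le[OF j, of x0] by auto
  moreover have "x0 - 1 \<le> mu ! j" using le[OF j, of "x0 - 1"] calculation by auto
  ultimately have x0: "mu ! j = x0 - 1" "mu' ! j = x0" using \<open>\<not> x0 \<le> mu ! j\<close> by auto
  have up: "mu' = mu[j := mu ! j + 1]"
    using len j other x0 by (auto simp: list_eq_iff_nth_eq nth_list_update)
  then have down: "mu = mu'[j := mu' ! j - 1]" using j by simp
  have ge: "x0 \<le> mu ! k" if "k < j" for k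
    using conjugate_gt_iff[OF sig(1), of k x0] that j cj by simp
  have lt: "mu ! k < x0" if "j < k" "k < length mu" for k
    using conjugate_gt_iff[OF sig(1) that(2), of x0] that cj by simp
  have A': "?A' x = ?A x - (if x0 \<le> x then 2 else 0)" for x
    by (rule excess_raise[OF len conj])
  obtain lo hi where lohi: "\<And>x. x \<le> lo \<Longrightarrow> ?A x = 0" "\<And>x. hi \<le> x \<Longrightarrow> ?A x = total_excess kap mu lam"
    using excess_constant[OF len(1,2)] by metis
  have a0: "?A x0 = ?A (x0 - 1) + 1"
    using at excess_diff[OF len(1,2), of x0] hstrip_bits[OF h(1), of x0] hstrip_bits[OF h(2), of x0]
    by (auto simp: raises_at_def dest: spec[of _ x0])
  have min1: "\<And>x. ?A (x0 - 1) \<le> ?A x" and min2: "\<And>x. x0 \<le> x \<Longrightarrow> ?A (x0 - 1) < ?A x"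
    using at by (auto simp: raises_at_def)
  have min': "?A' x0 \<le> ?A' x" for x
    using min1[of x] min2[of x] by (auto simp: A' a0)
  have min'': "?A' x0 < ?A' x" if "x < x0" for x
    using min1[of x] that by (simp add: A' a0)
  show thesis
  proof (rule that[OF j up down])
    show "?A (mu ! j) < total_excess kap mu lam" using min2[of "max x0 hi"] lohi(2)[of "max x0 hi"] by (simp add: x0)
    have "?A' (min lo (x0 - 1)) = 0" using lohi(1)[of "min lo (x0 - 1)"] by (simp add: A')
    then show "?A' (mu' ! j) < 0" using min''[of "min lo (x0 - 1)"] by (simp add: x0)
    show "?A' (mu' ! j) < ?A' (mu' ! k)" if "k < length mu" "j < k" for k
      using lt[of k] min''[of "mu ! k"] that other[of k] by (simp add: x0)
  qed (use min1 min2 min' ge x0 in auto)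
qed

text \<open>The graph of \<open>e_i\<close> on chains of signatures. Being a relation, it describes
  \<open>f_i\<close> by exchanging its arguments, and it makes no mention of words.\<close>

definition raise_step :: "nat \<Rightarrow> tableau \<Rightarrow> tableau \<Rightarrow> bool" where
  "raise_step i P P' \<longleftrightarrow> length P' = length P \<and> (\<forall>k<length P. k \<noteq> i \<longrightarrow> P' ! k = P ! k) \<and>
     raises (P ! (i - 1)) (P ! i) (P ! Suc i) (P' ! i)"

lemma raise_step_update:
  assumes "length P = Suc n" "1 \<le> i" "i < n"
  shows "raise_step i P P' \<longleftrightarrow> (\<exists>mu'. P' = P[i := mu'] \<and> raises (P ! (i - 1)) (P ! i) (P ! Suc i) mu')"
    and "raise_step i P' P \<longleftrightarrow> (\<exists>mu'. P' = P[i := mu'] \<and> raises (P ! (i - 1)) mu' (P ! Suc i) (P ! i))"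
proof -
  have eq: "P' = P[i := P' ! i] \<longleftrightarrow> length P' = length P \<and> (\<forall>k<length P. k \<noteq> i \<longrightarrow> P' ! k = P ! k)"
    using assms by (auto simp: list_eq_iff_nth_eq nth_list_update)
  have nth: "P[i := mu'] ! i = mu'" "P[i := mu'] ! (i - 1) = P ! (i - 1)" "P[i := mu'] ! Suc i = P ! Suc i" for mu'
    using assms by auto
  show "raise_step i P P' \<longleftrightarrow> (\<exists>mu'. P' = P[i := mu'] \<and> raises (P ! (i - 1)) (P ! i) (P ! Suc i) mu')"
    unfolding raise_step_def using eq nth by metis
  have "raise_step i P' P \<longleftrightarrow> P' = P[i := P' ! i] \<and> raises (P' ! (i - 1)) (P' ! i) (P' ! Suc i) (P ! i)"
    unfolding raise_step_def eq by (auto dest: sym)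
  then show "raise_step i P' P \<longleftrightarrow> (\<exists>mu'. P' = P[i := mu'] \<and> raises (P ! (i - 1)) mu' (P ! Suc i) (P ! i))"
    using nth by metis
qed

lemma act_skew_E_iff:
  assumes P: "semistandard n l P" and i: "1 \<le> i"
  shows "act_skew n (E i) P = Some P' \<longleftrightarrow> i < n \<and> raise_step i P P'"
proof (cases "i < n")
  case True
  let ?k = "P ! (i - 1)" and ?m = "P ! i" and ?l = "P ! Suc i"
  have h: "?k \<preceq>\<^sub>h ?m" "?m \<preceq>\<^sub>h ?l" and len: "length ?m = l" "length P = Suc n"
    using P i True by (auto simp: semistandard_def signatures_def dest: spec[of _ "i - 1"])
  have ro: "row_open i (tableau_rows P) j \<longleftrightarrow> j < l \<and> (\<forall>k<l. excess ?k ?m ?l (?m ! j) \<le> excess ?k ?m ?l (?m ! k)) \<and>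
     (\<forall>k<j. excess ?k ?m ?l (?m ! j) < excess ?k ?m ?l (?m ! k)) \<and> excess ?k ?m ?l (?m ! j) < total_excess ?k ?m ?l" for j
    unfolding row_open_def length_tableau_rows[OF P]
    using valley_eq_excess[OF P i True] by (auto; metis less_trans)
  show ?thesis unfolding raise_step_update(1)[OF len(2) i True]
  proof safe
    assume "act_skew n (E i) P = Some P'"
    then obtain j where j: "row_open i (tableau_rows P) j" "P' = P[i := ?m[j := ?m ! j + 1]]"
      using act_skew_ED[OF P _ i] by metis
    then have "raises ?k ?m ?l (?m[j := ?m ! j + 1])"
      using raisesI[OF h, of j] len unfolding ro by simp
    then show "\<exists>mu'. P' = P[i := mu'] \<and> raises ?k ?m ?l mu'" using j by blast
  next
    fix mu' assume "raises ?k ?m ?l mu'"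
    then obtain j where "row_open i (tableau_rows P) j" "mu' = ?m[j := ?m ! j + 1]"
      unfolding ro len(1)[symmetric] by (rule raisesE) blast
    then show "act_skew n (E i) P = Some (P[i := mu'])" using act_skew_EI[OF P _ i] by simp
  qed (rule True)
next
  case False
  then show ?thesis using act_skew_ED[OF P _ i] by metis
qed

lemma act_skew_F_iff:
  assumes P: "semistandard n l P" and i: "1 \<le> i" "i < n"
  shows "act_skew n (F i) P = Some P' \<longleftrightarrow> raise_step i P' P"
proof -
  let ?k = "P ! (i - 1)" and ?m = "P ! i" and ?l = "P ! Suc i"
  have h: "?k \<preceq>\<^sub>h ?m" "?m \<preceq>\<^sub>h ?l" and len: "length ?m = l" "length P = Suc n"
    using P i by (auto simp: semistandard_def signatures_def dest: spec[of _ "i - 1"])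
  have rc: "row_close i (tableau_rows P) j \<longleftrightarrow> j < l \<and> (\<forall>k<l. excess ?k ?m ?l (?m ! j) \<le> excess ?k ?m ?l (?m ! k)) \<and>
     (\<forall>k<l. j < k \<longrightarrow> excess ?k ?m ?l (?m ! j) < excess ?k ?m ?l (?m ! k)) \<and> excess ?k ?m ?l (?m ! j) < 0" for j
    unfolding row_close_def length_tableau_rows[OF P]
    using valley_eq_excess(1)[OF P i] by auto
  show ?thesis unfolding raise_step_update(2)[OF len(2) i]
  proof safe
    assume "act_skew n (F i) P = Some P'"
    then obtain j where j: "row_close i (tableau_rows P) j" "P' = P[i := ?m[j := ?m ! j - 1]]"
      using act_skew_FD[OF P _ i(1)] by metis
    then have "raises ?k (?m[j := ?m ! j - 1]) ?l ?m"
      using raisesI'[OF h, of j] len unfolding rc by simp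
    then show "\<exists>mu'. P' = P[i := mu'] \<and> raises ?k mu' ?l ?m" using j by blast
  next
    fix mu' assume r: "raises ?k mu' ?l ?m"
    then have "length mu' = l" using len by (auto simp: raises_def hstrip_def)
    with r obtain j where "row_close i (tableau_rows P) j" "mu' = ?m[j := ?m ! j - 1]"
      unfolding rc by (elim raisesE) blast
    then show "act_skew n (F i) P = Some (P[i := mu'])" using act_skew_FI[OF P _ i(1)] by simp
  qed
qed

section \<open>Linearization of the box-ball system\<close>

lemma vacancy_add: "vacancy (k + a) mu i = vacancy k mu i + a"
  by (simp add: vacancy_def)

lemma vacancy_add_mset: "vacancy k (add_mset m mu) i = vacancy k mu i - 2 * int (min m i)"
  by (simp add: vacancy_def)

abbreviation vac :: "int \<Rightarrow> (nat \<times> int) multiset \<Rightarrow> nat \<Rightarrow> int" where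
  "vac k M \<equiv> vacancy k (image_mset fst M)"

text \<open>The carrier of the box-ball system has seats \<open>1, 2, \<dots>\<close>. A ball takes the first empty seat, and at
  an empty site the ball on the first occupied seat leaves. A ball taking seat \<open>m + 1\<close> extends a string
  of length \<open>m\<close>.\<close>

definition occ :: "nat set \<Rightarrow> nat \<Rightarrow> int" where
  "occ W i = int (card (W \<inter> {1..i}))"

lemma occ_insert:
  assumes "j \<notin> W" "1 \<le> j"
  shows "occ (insert j W) i = occ W i + of_bool (j \<le> i)"
  using assms by (auto simp: occ_def Int_insert_left)

lemma occ_remove:
  assumes "j \<in> W" "1 \<le> j"
  shows "occ (W - {j}) i = occ W i - of_bool (j \<le> i)"
  using occ_insert[of j "W - {j}" i] assms by (simp add: insert_absorb)

lemma occ_full: "{1..i} \<subseteq> W \<Longrightarrow> occ W i = int i"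
  by (simp add: occ_def Int_absorb1)

lemma occ_ge_iff: "occ W i \<ge> int i \<longleftrightarrow> {1..i} \<subseteq> W"
proof
  assume "occ W i \<ge> int i"
  then have "card {1..i} \<le> card (W \<inter> {1..i})" by (simp add: occ_def)
  then have "W \<inter> {1..i} = {1..i}" by (intro card_seteq) auto
  then show "{1..i} \<subseteq> W" by blast
qed (simp add: occ_full)

lemma occ_empty: "(\<And>j. j \<in> W \<Longrightarrow> i < j) \<Longrightarrow> occ W i = 0"
  unfolding occ_def by (fastforce simp: card_eq_0_iff)

lemma count_replace:
  "count (add_mset (a, x) (M - {#(c, y)#})) (m, J)
     = of_bool (m = a \<and> J = x) + (count M (m, J) - of_bool (m = c \<and> J = y))"
  by auto

text \<open>The two summands are chosen such that boarding and leaving have the same effect: when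
  the ball concerned moves to or from seat \<open>j\<close>, the level rises by one for
  \<open>i < j\<close> and stays unchanged for \<open>i \<ge> j\<close>.\<close>

definition level :: "int \<Rightarrow> nat set \<Rightarrow> (nat \<times> int) multiset \<Rightarrow> nat \<Rightarrow> int" where
  "level k W M i = vac k M i + occ W i"

text \<open>Since \<open>occ W m \<le> m\<close>, the upper bound on riggings allows a string of
  length \<open>m\<close> to be singular only if the seats \<open>1..m\<close> are all taken. The
  last clause provides a singular string at the end of the run starting at seat 1. Together they say
  that the longest singular string has length \<open>j - 1\<close>, where \<open>j\<close> is the
  first empty seat.\<close>

definition seating :: "int \<Rightarrow> nat set \<Rightarrow> (nat \<times> int) multiset \<Rightarrow> bool" where
  "seating k W M \<longleftrightarrow> finite W \<and> 0 \<notin> W \<and>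
     (\<forall>m J. (m, J) \<in># M \<longrightarrow> 1 \<le> m \<and> J \<le> level k W M m - int m) \<and>
     (\<forall>e\<in>W. Suc e \<notin> W \<longrightarrow> (e, level k W M e - int e) \<in># M)"

lemma seating_ball:
  assumes S: "seating (k - 1) W M" and b: "b k = 1"
    and j: "1 \<le> j" "{1..<j} \<subseteq> W" "j \<notin> W"
  defines "M1 \<equiv> KKR_step b k M"
  shows "vac k M1 i = vac (k - 1) M i + 1 - 2 * of_bool (j \<le> i)"
    and "level k (insert j W) M1 i = level (k - 1) W M i + 1 - of_bool (j \<le> i)"
    and "seating k (insert j W) M1"
    and "count M1 (m, J) = count M (m, J) + of_bool (m = j \<and> J = vac k M1 j)
           - of_bool (1 < j \<and> m = j - 1 \<and> J = vac (k - 1) M (j - 1))"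
    and "1 < j \<Longrightarrow> (j - 1, vac (k - 1) M (j - 1)) \<in># M"
proof -
  let ?p = "vac (k - 1) M"
  let ?S = "{m. (m, ?p m) \<in># M}"
  have fin: "finite W" and W0: "0 \<notin> W"
    and S1: "\<And>m J. (m, J) \<in># M \<Longrightarrow> 1 \<le> m \<and> J \<le> level (k - 1) W M m - int m"
    and S2: "\<And>e. e \<in> W \<Longrightarrow> Suc e \<notin> W \<Longrightarrow> (e, level (k - 1) W M e - int e) \<in># M"
    using S by (auto simp: seating_def)
  have less: "m < j" if "m \<in> ?S" for m
  proof -
    have "1 \<le> m" "occ W m \<ge> int m" using S1[of m "?p m"] that by (auto simp: level_def)
    then have "{1..m} \<subseteq> W" by (simp only: occ_ge_iff)
    then show ?thesis using j(1,3) by (meson atLeastAtMost_iff not_less subsetD)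
  qed
  show mem: "(j - 1, ?p (j - 1)) \<in># M" if "1 < j"
  proof -
    have "{1..j - 1} = {1..<j}" using j by auto
    then have "occ W (j - 1) = int (j - 1)" using j by (intro occ_full) simp
    moreover have "j - 1 \<in> W" using j(2) that by force
    ultimately show ?thesis using S2[of "j - 1"] j that by (auto simp: level_def)
  qed
  have "Max (insert 0 ?S) = j - 1"
  proof (rule Max_eqI)
    show "finite (insert 0 ?S)" using less by (auto intro: finite_subset[of _ "{..<j}"])
    show "y \<le> j - 1" if "y \<in> insert 0 ?S" for y using that less[of y] by auto
    show "j - 1 \<in> insert 0 ?S" using mem j by (cases "1 < j") auto
  qed
  then have M1: "M1 = add_mset (j, vacancy k (add_mset j (image_mset fst (M - {#(j - 1, ?p (j - 1))#}))) j)
      (M - {#(j - 1, ?p (j - 1))#})"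
    using j b by (simp add: M1_def KKR_step_def Let_def)
  then have fstM1: "image_mset fst M1 = add_mset j (image_mset fst (M - {#(j - 1, ?p (j - 1))#}))" by simp
  with M1 have M1': "M1 = add_mset (j, vac k M1 j) (M - {#(j - 1, ?p (j - 1))#})" by simp
  have nmem: "(0, J) \<notin># M" for J using S1[of 0 J] by auto
  show vac: "vac k M1 i = ?p i + 1 - 2 * of_bool (j \<le> i)" for i
  proof (cases "1 < j")
    case True
    have "?p i = vac (k - 1) (add_mset (j - 1, ?p (j - 1)) (M - {#(j - 1, ?p (j - 1))#})) i"
      using mem[OF True] by simp
    then have "?p i = vac (k - 1) (M - {#(j - 1, ?p (j - 1))#}) i - 2 * int (min (j - 1) i)"
      by (simp only: image_mset_add_mset vacancy_add_mset fst_conv)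
    then show ?thesis unfolding fstM1 vacancy_add_mset
      using vacancy_add[of "k - 1" 1 "image_mset fst (M - {#(j - 1, ?p (j - 1))#})" i] True
      by (auto simp: of_nat_diff)
  next
    case False
    \<comment> \<open>For \<open>j = 1\<close> the string to be extended has length 0; such strings
      are never stored, so the difference removes nothing.\<close>
    then have "M - {#(j - 1, ?p (j - 1))#} = M" using nmem by (simp add: diff_single_trivial)
    then show ?thesis unfolding fstM1 vacancy_add_mset
      using vacancy_add[of "k - 1" 1 "image_mset fst M" i] False j by auto
  qed
  show lev: "level k (insert j W) M1 i = level (k - 1) W M i + 1 - of_bool (j \<le> i)" for i
    unfolding level_def vac using occ_insert[OF j(3,1), of i] by simp
  show cnt: "count M1 (m, J) = count M (m, J) + of_bool (m = j \<and> J = vac k M1 j)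
           - of_bool (1 < j \<and> m = j - 1 \<and> J = ?p (j - 1))" for m J
  proof -
    have "count M1 (m, J) = of_bool (m = j \<and> J = vac k M1 j)
        + (count M (m, J) - of_bool (m = j - 1 \<and> J = ?p (j - 1)))"
      by (subst M1') (rule count_replace)
    moreover have "count M (m, J) = 0" if "\<not> 1 < j" "m = j - 1"
      using nmem j that by (simp add: not_in_iff)
    ultimately show ?thesis using j by (cases "m = j - 1"; cases "1 < j") auto
  qed
  have memM1: "(m, J) \<in># M1 \<Longrightarrow> m = j \<and> J = vac k M1 j \<or> (m, J) \<in># M" for m J
    by (subst (asm) M1') (auto dest: in_diffD)
  have levj: "level k (insert j W) M1 j = vac k M1 j + int j"
    unfolding level_def using j by (subst occ_full) (auto simp: le_less)
  show "seating k (insert j W) M1"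
    unfolding seating_def
  proof (intro conjI allI impI ballI)
    show "finite (insert j W)" "0 \<notin> insert j W" using fin W0 j by auto
    fix m J assume "(m, J) \<in># M1"
    then consider "m = j" "J = vac k M1 j" | "(m, J) \<in># M" using memM1 by blast
    then have "1 \<le> m \<and> J \<le> level k (insert j W) M1 m - int m"
    proof cases
      case 1
      then show ?thesis using levj j(1) by simp
    next
      case 2
      then show ?thesis using S1[OF 2] lev[of m] by (cases "j \<le> m") simp_all
    qed
    then show "1 \<le> m" "J \<le> level k (insert j W) M1 m - int m" by simp_all
  next
    fix e assume e: "e \<in> insert j W" "Suc e \<notin> insert j W"
    show "(e, level k (insert j W) M1 e - int e) \<in># M1"
    proof (cases "e = j")
      case True
      then show ?thesis using levj by (subst M1') simp
    next
      case False
      then have "e \<in> W" "Suc e \<notin> W" using e by auto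
      moreover have "j < e"
      proof (rule ccontr)
        assume "\<not> j < e"
        then have "Suc e \<in> {1..<j}" using False e by (auto simp: not_less)
        then show False using j e by blast
      qed
      ultimately have "(e, level k (insert j W) M1 e - int e) \<in># M" using S2[of e] lev[of e] by simp
      moreover have "count M1 (e, I) = count M (e, I)" for I using \<open>j < e\<close> cnt[of e I] by auto
      ultimately show ?thesis by (simp add: count_greater_zero_iff[symmetric] del: count_greater_zero_iff)
    qed
  qed
qed

lemma seating_empty:
  assumes S: "seating (k - 1) W M" and b: "b k \<noteq> 1"
  shows "KKR_step b k M = M"
    and "vac k M i = vac (k - 1) M i + 1"
    and "W \<noteq> {} \<Longrightarrow> level k (W - {Min W}) M i = level (k - 1) W M i + 1 - of_bool (Min W \<le> i)"
    and "seating k (W - {Min W}) M"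
proof -
  show "KKR_step b k M = M" using b by (simp add: KKR_step_def)
  have fin: "finite W" and W0: "0 \<notin> W"
    and S1: "\<And>m J. (m, J) \<in># M \<Longrightarrow> 1 \<le> m \<and> J \<le> level (k - 1) W M m - int m"
    and S2: "\<And>e. e \<in> W \<Longrightarrow> Suc e \<notin> W \<Longrightarrow> (e, level (k - 1) W M e - int e) \<in># M"
    using S by (auto simp: seating_def)
  show vac: "vac k M i = vac (k - 1) M i + 1" for i
    using vacancy_add[of "k - 1" 1 "image_mset fst M" i] by simp
  have min: "Min W \<in> W" "1 \<le> Min W" "\<And>e. e \<in> W \<Longrightarrow> Min W \<le> e" if "W \<noteq> {}"
    using that fin W0 Min_in[of W] by (auto simp: Suc_le_eq intro!: gr0I)
  show lev: "level k (W - {Min W}) M i = level (k - 1) W M i + 1 - of_bool (Min W \<le> i)" if "W \<noteq> {}" for i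
    unfolding level_def vac using occ_remove[of "Min W" W i] min[OF that] by simp
  \<comment> \<open>\<open>Min {}\<close> is an unspecified number, but removing it from the empty
    set is harmless.\<close>
  have lev0: "level k (W - {Min W}) M i = level (k - 1) W M i + 1" if "W = {}" for i
    using that unfolding level_def vac by simp
  show "seating k (W - {Min W}) M"
    unfolding seating_def
  proof (intro conjI allI impI ballI)
    show "finite (W - {Min W})" "0 \<notin> W - {Min W}" using fin W0 by auto
    fix m J assume "(m, J) \<in># M"
    then show "1 \<le> m" "J \<le> level k (W - {Min W}) M m - int m"
      using S1[of m J] lev[of m] lev0[of m] by (cases "W = {}"; auto)+
  next
    fix e assume e: "e \<in> W - {Min W}" "Suc e \<notin> W - {Min W}"
    then have ne: "W \<noteq> {}" by auto
    then have "Min W < e" using min(3)[of e] e by force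
    then have "Suc e \<notin> W" using e by auto
    then show "(e, level k (W - {Min W}) M e - int e) \<in># M"
      using S2[of e] lev[OF ne, of e] \<open>Min W < e\<close> e by simp
  qed
qed

lemma ex_first_empty_seat:
  assumes "finite (W :: nat set)"
  obtains j where "1 \<le> j" "{1..<j} \<subseteq> W" "j \<notin> W"
proof -
  define j where "j = (LEAST j. 1 \<le> j \<and> j \<notin> W)"
  obtain N where "N \<notin> insert 0 W" using assms ex_new_if_finite[of "insert 0 W"] by auto
  then have "1 \<le> N \<and> N \<notin> W" by auto
  then have "1 \<le> j \<and> j \<notin> W" unfolding j_def by (rule LeastI)
  moreover have "{1..<j} \<subseteq> W"
  proof
    fix i assume "i \<in> {1..<j}"
    then show "i \<in> W" using not_less_Least[of i "\<lambda>j. 1 \<le> j \<and> j \<notin> W", folded j_def] by simp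
  qed
  ultimately show thesis using that by blast
qed

text \<open>The carriers of a state and of its time evolution are compared at the same site: a ball that leaves a
  seat of the first carrier becomes a ball of the new state, which takes the seat with the same number.\<close>

definition coupled :: "int \<Rightarrow> nat set \<Rightarrow> nat set \<Rightarrow> (nat \<times> int) multiset \<Rightarrow> (nat \<times> int) multiset \<Rightarrow> bool" where
  "coupled k W W' M M' \<longleftrightarrow> seating k W M \<and> seating k W' M' \<and>
     (\<forall>e\<in>W. \<forall>i. 1 \<le> i \<and> i \<le> e \<longrightarrow> (i \<in> W \<longleftrightarrow> i \<notin> W')) \<and>
     (\<forall>i. vac k M' i = vac k M i + 2 * occ W i) \<and>
     (\<forall>m r. 1 \<le> m \<longrightarrow> int (count M' (m, r)) + (of_bool (m \<in> W) - of_bool (Suc m \<in> W)) * of_bool (r = level k W M m)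
        = int (count M (m, r - int m)))"

text \<open>The correction in the count clause of \<open>coupled\<close> means that a maximal run
  \<open>s..e\<close> of occupied seats stands for a string that has length \<open>e\<close> in
  \<open>M\<close> and still \<open>s - 1\<close> in \<open>M'\<close>: the new configuration lags
  behind by one box per seat. A boarding ball creates or lengthens the run at seat 1, possibly
  joining it to the next run, while \<open>M'\<close> stays as it is.\<close>

lemma coupled_ball:
  assumes C: "coupled (k - 1) W W' M M'" and b: "b k = 1" "b' k \<noteq> 1"
  obtains j where "j \<notin> W"
    "coupled k (insert j W) (W' - {Min W'}) (KKR_step b k M) (KKR_step b' k M')"
proof -
  have S: "seating (k - 1) W M" and S': "seating (k - 1) W' M'"
    and alt: "\<And>e i. e \<in> W \<Longrightarrow> 1 \<le> i \<Longrightarrow> i \<le> e \<Longrightarrow> i \<in> W \<longleftrightarrow> i \<notin> W'"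
    and vac: "\<And>i. vac (k - 1) M' i = vac (k - 1) M i + 2 * occ W i"
    and cnt: "\<And>m r. 1 \<le> m \<Longrightarrow> int (count M' (m, r)) + (of_bool (m \<in> W) - of_bool (Suc m \<in> W)) * of_bool (r = level (k - 1) W M m)
        = int (count M (m, r - int m))"
    using C by (auto simp: coupled_def)
  have fin: "finite W" "finite W'" "0 \<notin> W'" using S S' by (auto simp: seating_def)
  obtain j where j: "1 \<le> j" "{1..<j} \<subseteq> W" "j \<notin> W" using ex_first_empty_seat[OF fin(1)] .
  note st = seating_ball[where b = b, OF S b(1) j]
  note st' = seating_empty[where b = b', OF S' b(2)]
  let ?M1 = "KKR_step b k M" and ?W1 = "insert j W" and ?W1' = "W' - {Min W'}"
  \<comment> \<open>Seats below \<open>j\<close> are full in \<open>W\<close>, hence empty in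
    \<open>W'\<close>. If \<open>W\<close> has a ball beyond \<open>j\<close>, then seat
    \<open>j\<close> is taken in \<open>W'\<close> and is the one vacated now; otherwise the
    alternation has to hold only up to \<open>j\<close>.\<close>
  have low: "i \<notin> W'" if "i < j" for i
  proof (cases "i = 0")
    case False
    then have "i \<in> W" using j(2) that by force
    then show ?thesis using alt[of i i] False by simp
  qed (use fin in simp)
  have Min_j: "Min W' = j" if "j \<in> W'"
    using that low fin by (intro Min_eqI) (auto simp: not_less[symmetric])
  have levj: "level (k - 1) W M j = vac k ?M1 j + int j"
    using st(2)[of j] j unfolding level_def by (subst (asm) occ_full) (auto simp: le_less)
  have "{1..j - 1} = {1..<j}" using j by auto
  then have levj1: "level (k - 1) W M (j - 1) = vac (k - 1) M (j - 1) + int (j - 1)"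
    using j \<open>{1..j - 1} = {1..<j}\<close> unfolding level_def by (subst occ_full) simp_all
  have "coupled k ?W1 ?W1' ?M1 (KKR_step b' k M')"
    unfolding coupled_def st'(1)
  proof (intro conjI allI ballI impI)
    show "seating k ?W1 ?M1" by (rule st(3))
    show "seating k ?W1' M'" by (rule st'(4))
    fix i
    show "vac k M' i = vac k ?M1 i + 2 * occ ?W1 i"
      unfolding st'(2) st(1) vac occ_insert[OF j(3,1)] by simp
  next
    fix e i assume e: "e \<in> ?W1" "1 \<le> i \<and> i \<le> e"
    consider "i < j" | "i = j" | "j < i" by linarith
    then show "i \<in> ?W1 \<longleftrightarrow> i \<notin> ?W1'"
    proof cases
      case 1 then show ?thesis using low j e by auto
    next
      case 2 then show ?thesis using Min_j by auto
    next
      case 3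
      then have "e \<in> W" "j < e" using e by auto
      then have "j \<in> W'" using alt[of e j] j by auto
      then show ?thesis using Min_j alt[OF \<open>e \<in> W\<close>, of i] e 3 by auto
    qed
  next
    fix m :: nat and r :: int assume m: "1 \<le> m"
    have full: "i \<in> W" if "1 \<le> i" "i < j" for i using j that by auto
    consider "m = j" | "Suc m = j" | "j < m" | "Suc m < j" by linarith
    then show "int (count M' (m, r)) + (of_bool (m \<in> ?W1) - of_bool (Suc m \<in> ?W1)) * of_bool (r = level k ?W1 ?M1 m)
        = int (count ?M1 (m, r - int m))"
    proof cases
      case 1
      then show ?thesis using cnt[OF m, of r] st(2)[of j] st(4)[of j "r - int j"] j levj
        by (auto simp: algebra_simps split: if_splits)
    next
      case 2
      then have mem: "(m, vac (k - 1) M m) \<in># M" using st(5) m by auto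
      show ?thesis using cnt[OF m, of r] st(2)[of m] st(4)[of m "r - int m"] j levj1 2 m mem full[of m]
        by (auto simp: of_nat_diff Suc_le_eq)
    next
      case 3
      then show ?thesis using cnt[OF m, of r] st(2)[of m] st(4)[of m "r - int m"] by auto
    next
      case 4
      then show ?thesis using cnt[OF m, of r] st(4)[of m "r - int m"] full[of m] full[of "Suc m"] m by auto
    qed
  qed
  with j show thesis using that by blast
qed

text \<open>The ball leaves seat \<open>j = Min W\<close>. Seats below \<open>j\<close> are empty in
  \<open>W\<close>, hence full in \<open>W'\<close>, and \<open>j\<close> is empty in
  \<open>W'\<close>, so the new ball takes the seat of the same number and a string of
  \<open>M'\<close> catches up by one box.\<close>

lemma coupled_no_ball:
  assumes C: "coupled (k - 1) W W' M M'" and b: "b k \<noteq> 1" "b' k = 1" and ne: "W \<noteq> {}"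
  obtains W1' where "coupled k (W - {Min W}) W1' (KKR_step b k M) (KKR_step b' k M')"
proof -
  have S: "seating (k - 1) W M" and S': "seating (k - 1) W' M'"
    and alt: "\<And>e i. e \<in> W \<Longrightarrow> 1 \<le> i \<Longrightarrow> i \<le> e \<Longrightarrow> i \<in> W \<longleftrightarrow> i \<notin> W'"
    and vac: "\<And>i. vac (k - 1) M' i = vac (k - 1) M i + 2 * occ W i"
    and cnt: "\<And>m r. 1 \<le> m \<Longrightarrow> int (count M' (m, r)) + (of_bool (m \<in> W) - of_bool (Suc m \<in> W)) * of_bool (r = level (k - 1) W M m)
        = int (count M (m, r - int m))"
    using C by (auto simp: coupled_def)
  define j where "j = Min W"
  have fin: "finite W" "0 \<notin> W" using S by (auto simp: seating_def)
  have jW: "j \<in> W" "\<And>i. i \<in> W \<Longrightarrow> j \<le> i" using fin ne by (auto simp: j_def)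
  have j1: "1 \<le> j" using jW fin by (cases j) auto
  have j': "{1..<j} \<subseteq> W'" "j \<notin> W'"
  proof -
    show "{1..<j} \<subseteq> W'" 
    proof
      fix i assume i: "i \<in> {1..<j}"
      then have "i \<notin> W" using jW(2)[of i] by auto
      then show "i \<in> W'" using alt[OF jW(1), of i] i by simp
    qed
    show "j \<notin> W'" using alt[OF jW(1), of j] jW j1 by simp
  qed
  note st = seating_empty[where b = b, OF S b(1), folded j_def]
  note st' = seating_ball[where b = b', OF S' b(2) j1 j']
  let ?M1' = "KKR_step b' k M'" and ?W1 = "W - {j}" and ?W1' = "insert j W'"
  have vac1: "vac k ?M1' i = vac k M i + 2 * occ ?W1 i" for i
    unfolding st(2) st'(1) vac occ_remove[OF jW(1) j1] by simp
  have "j < e" if "e \<in> ?W1" for e using jW(2)[of e] that by auto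
  moreover have "j - 1 < e" if "e \<in> W" for e using jW(2)[OF that] j1 by simp
  ultimately have "occ ?W1 j = 0" "occ W (j - 1) = 0" by (auto intro: occ_empty)
  then have levj: "vac k ?M1' j = level (k - 1) W M j"
    and levj1: "vac (k - 1) M' (j - 1) = level (k - 1) W M (j - 1)"
    using st(3)[OF ne, of j] vac1[of j] vac[of "j - 1"] by (auto simp: level_def)
  have "coupled k ?W1 ?W1' (KKR_step b k M) ?M1'"
    unfolding coupled_def st(1)
  proof (intro conjI allI ballI impI)
    show "seating k ?W1 M" by (rule st(4))
    show "seating k ?W1' ?M1'" by (rule st'(3))
    show "vac k ?M1' i = vac k M i + 2 * occ ?W1 i" for i by (rule vac1)
  next
    fix e i assume e: "e \<in> ?W1" "1 \<le> i \<and> i \<le> e"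
    then show "i \<in> ?W1 \<longleftrightarrow> i \<notin> ?W1'" using alt[of e i] by auto
  next
    fix m :: nat and r :: int assume m: "1 \<le> m"
    have none: "i \<notin> W" if "i < j" for i using jW(2)[of i] that by auto
    consider "m = j" | "Suc m = j" | "j < m" | "Suc m < j" by linarith
    then show "int (count ?M1' (m, r)) + (of_bool (m \<in> ?W1) - of_bool (Suc m \<in> ?W1)) * of_bool (r = level k ?W1 M m)
        = int (count M (m, r - int m))"
    proof cases
      case 1
      then show ?thesis using cnt[OF m, of r] st(3)[OF ne, of j] st'(4)[of j r] j1 jW(1) levj
        by (auto simp: algebra_simps split: if_splits)
    next
      case 2
      then have mem: "(m, vac (k - 1) M' m) \<in># M'" using st'(5) m by auto
      show ?thesis using cnt[OF m, of r] st'(4)[of m r] levj1 2 m mem none[of m] jW(1)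
        by (auto simp: Suc_le_eq)
    next
      case 3
      then have "level k ?W1 M m = level (k - 1) W M m" "count ?M1' (m, r) = count M' (m, r)"
        using st(3)[OF ne, of m] st'(4)[of m r] by auto
      then show ?thesis using cnt[OF m, of r] 3 by simp
    next
      case 4
      then show ?thesis using cnt[OF m, of r] st'(4)[of m r] none[of m] none[of "Suc m"] m by auto
    qed
  qed
  then show thesis using that unfolding j_def by blast
qed

text \<open>With \<open>W\<close> empty the alternation and the correction of the counts are void,
  so the second carrier may unload while both vacancy numbers grow by one.\<close>

lemma coupled_record:
  assumes C: "coupled (k - 1) {} W' M M'" and b: "b k \<noteq> 1" "b' k \<noteq> 1"
  shows "coupled k {} (W' - {Min W'}) (KKR_step b k M) (KKR_step b' k M')"
proof -
  have S: "seating (k - 1) {} M" and S': "seating (k - 1) W' M'" using C by (auto simp: coupled_def)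
  note st = seating_empty[where b = b, OF S b(1)] and st' = seating_empty[where b = b', OF S' b(2)]
  show ?thesis unfolding coupled_def st(1) st'(1) st(2) st'(2)
    using C st(4) st'(4) by (simp add: coupled_def)
qed

section \<open>From the coupled scan to the rigged configurations\<close>

lemma fold_KKR_step_trivial:
  "(\<And>k. k \<in> set ks \<Longrightarrow> b k \<noteq> 1) \<Longrightarrow> fold (KKR_step b) ks M = M"
  by (induction ks arbitrary: M) (auto simp: KKR_step_def)

text \<open>Vacancy numbers refer to the absolute site and empty sites leave the strings alone, so
  scanning a wider interval gives the same result. Two states can then be scanned over a common
  interval.\<close>

lemma KKR_eq_fold:
  assumes "{x. b x = 1} \<subseteq> {lo..hi}"
  defines "strings \<equiv> rev (sorted_list_of_multiset (fold (KKR_step b) [lo..hi] {#}))"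
  shows "KKR b = (map fst strings, map snd strings)"
proof -
  let ?S = "{x. b x = 1}"
  have "fold (KKR_step b) [lo..hi] {#} = (if ?S = {} then {#} else fold (KKR_step b) [Min ?S..Max ?S] {#})"
  proof (cases "?S = {}")
    case True
    then have "b k \<noteq> 1" for k by blast
    then show ?thesis using True by (simp add: fold_KKR_step_trivial)
  next
    case False
    have fin: "finite ?S" using assms(1) finite_subset by blast
    then have mem: "Min ?S \<in> {lo..hi}" "Max ?S \<in> {lo..hi}" "Min ?S \<le> Max ?S"
      using assms(1) Min_in[OF fin False] Max_in[OF fin False] by auto
    have "[lo..hi] = [lo..Min ?S - 1] @ [Min ?S..Max ?S] @ [Max ?S + 1..hi]"
      using mem upto_split1[of lo "Min ?S" hi] upto_split2[of "Min ?S" "Max ?S" hi] by simp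
    moreover have "fold (KKR_step b) [lo..Min ?S - 1] M = M" "fold (KKR_step b) [Max ?S + 1..hi] M = M" for M
      using Min_le[OF fin] Max_ge[OF fin] by (force intro!: fold_KKR_step_trivial)+
    ultimately show ?thesis unfolding if_not_P[OF False] by (simp only: fold_append o_apply)
  qed
  then show ?thesis by (simp add: KKR_def strings_def Let_def)
qed

lemma sorted_list_of_multiset_image_mono:
  assumes "mono_on (set_mset M) f"
  shows "sorted_list_of_multiset (image_mset f M) = map f (sorted_list_of_multiset M)"
proof -
  have "sorted (map f (sorted_list_of_multiset M))"
    using assms by (intro sorted_map_mono) auto
  then have "sort (map f (sorted_list_of_multiset M)) = map f (sorted_list_of_multiset M)"
    by (rule sorted_sort_id)
  then show ?thesis
    by (metis mset_map mset_sorted_list_of_multiset sorted_list_of_multiset_mset)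
qed

lemma count_image_mset_inject: "inj f \<Longrightarrow> count (image_mset f M) (f x) = count M x"
  by (induction M) (auto simp: inj_eq)

text \<open>The number of occupied seats equals the carry \<open>c\<close>. At a site beyond which
  all balls and carries vanish the first carrier is empty, and there the count clause of the
  coupling becomes an exact shift of the riggings by the lengths.\<close>

theorem KKR_evolution:
  fixes b :: "int \<Rightarrow> int"
  assumes bits: "\<And>x. b x \<in> {0, 1}" and c: "is_carry (\<lambda>x. b x + b x) c"
    and bot: "\<forall>\<^sub>F x in at_bot. b x = 0" and top: "\<forall>\<^sub>F x in at_top. b x = 0"
    and K: "KKR b = (mu, J)"
  shows "KKR (\<lambda>x. b x + c (x - 1) - c x) = (mu, map2 (+) J (map int mu))"
proof -
  define b' where "b' x = b x + c (x - 1) - c x" for x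
  note crec = is_carry_rec[OF c] and c0 = is_carry_nonneg[OF c]
  have "\<forall>\<^sub>F x in at_bot. c x = 0" using c unfolding is_carry_def by blast
  then have "\<forall>\<^sub>F x in at_bot. b x = 0 \<and> c x = 0" using bot by (simp add: eventually_conj_iff)
  then obtain lo where lo: "\<And>x. x \<le> lo \<Longrightarrow> b x = 0 \<and> c x = 0" by (auto simp: eventually_at_bot_linorder)
  have "\<forall>\<^sub>F x in at_top. c x = 0" by (rule is_carry_at_top[OF c]) (use top in \<open>simp\<close>)
  then have "\<forall>\<^sub>F x in at_top. b x = 0 \<and> c x = 0" using top by (simp add: eventually_conj_iff)
  then obtain hi0 where hi0: "\<And>x. x \<ge> hi0 \<Longrightarrow> b x = 0 \<and> c x = 0" by (auto simp: eventually_at_top_linorder)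
  define hi where "hi = max lo hi0"
  let ?M = "\<lambda>k. fold (KKR_step b) [lo..k] {#}" and ?M' = "\<lambda>k. fold (KKR_step b') [lo..k] {#}"
  have "\<exists>W W'. int (card W) = c k \<and> coupled k W W' (?M k) (?M' k)" if "lo - 1 \<le> k" for k
    using that
  proof (induction k rule: int_ge_induct)
    case base
    have "coupled (lo - 1) {} {} {#} {#}" by (simp add: coupled_def seating_def occ_def)
    moreover have "int (card {}) = c (lo - 1)" using lo by simp
    ultimately show ?case by fastforce
  next
    case (step k)
    then obtain W W' where card: "int (card W) = c k" and C: "coupled k W W' (?M k) (?M' k)" by blast
    have fin: "finite W" using C by (simp add: coupled_def seating_def)
    have M: "?M (k + 1) = KKR_step b (k + 1) (?M k)" "?M' (k + 1) = KKR_step b' (k + 1) (?M' k)"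
      using step.hyps by (auto simp: upto_rec2)
    have C: "coupled (k + 1 - 1) W W' (?M k) (?M' k)" using C by simp
    consider "b (k + 1) = 1" | "b (k + 1) = 0" "W \<noteq> {}" | "b (k + 1) = 0" "W = {}" using bits[of "k + 1"] by auto
    then show ?case
    proof cases
      case 1
      then have "c (k + 1) = c k + 1" using crec[of "k + 1"] c0[of k] by simp
      then have "b' (k + 1) \<noteq> 1" using 1 by (simp add: b'_def)
      then obtain j where "j \<notin> W" "coupled (k + 1) (insert j W) (W' - {Min W'}) (?M (k + 1)) (?M' (k + 1))"
        using coupled_ball[where b = b and b' = b', OF C 1] unfolding M by blast
      moreover have "int (card (insert j W)) = c (k + 1)"
        using \<open>c (k + 1) = c k + 1\<close> card fin \<open>j \<notin> W\<close> by simp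
      ultimately show ?thesis by blast
    next
      case 2
      then have "c k \<ge> 1" using card fin by (metis One_nat_def Suc_leI card_gt_0_iff of_nat_1 of_nat_le_iff)
      then have ck: "c (k + 1) = c k - 1" using crec[of "k + 1"] 2 by simp
      then have "b (k + 1) \<noteq> 1" "b' (k + 1) = 1" using 2 by (simp_all add: b'_def)
      then obtain W1' where "coupled (k + 1) (W - {Min W}) W1' (?M (k + 1)) (?M' (k + 1))"
        using coupled_no_ball[where b = b and b' = b', OF C] 2 unfolding M by blast
      moreover have "int (card (W - {Min W})) = c (k + 1)"
        using ck card fin 2 Min_in[OF fin 2(2)] \<open>c k \<ge> 1\<close> by (simp add: of_nat_diff)
      ultimately show ?thesis by blast
    next
      case 3
      then have "c k = 0" using card by simp
      then have ck: "c (k + 1) = 0" using crec[of "k + 1"] 3 by simp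
      then have "b (k + 1) \<noteq> 1" "b' (k + 1) \<noteq> 1" using 3 \<open>c k = 0\<close> by (simp_all add: b'_def)
      then have "coupled (k + 1) {} (W' - {Min W'}) (?M (k + 1)) (?M' (k + 1))"
        using coupled_record[where b = b and b' = b' and k = "k + 1"] C 3 unfolding M by blast
      then show ?thesis using ck by (metis card.empty of_nat_0)
    qed
  qed
  moreover have "lo - 1 \<le> hi" by (simp add: hi_def)
  ultimately obtain W W' where card: "int (card W) = c hi" and C: "coupled hi W W' (?M hi) (?M' hi)"
    by blast
  have "c hi = 0" using hi0[of hi] by (simp add: hi_def)
  moreover have "finite W" using C by (simp add: coupled_def seating_def)
  ultimately have W: "W = {}" using card by simp
  \<comment> \<open>\<open>g\<close> is monotone for the lexicographic order, so the shift of the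
    riggings does not disturb the order in which \<open>KKR\<close> lists the strings.\<close>
  define g where "g = (\<lambda>(m, J). (m :: nat, J + int m))"
  have g: "inj g" "mono g"
    by (auto simp: g_def inj_on_def mono_def less_eq_prod_def)
  have "?M' hi = image_mset g (?M hi)"
  proof (rule multiset_eqI)
    fix s :: "nat \<times> int"
    obtain m r where s: "s = (m, r)" by (cases s)
    have "count (image_mset g (?M hi)) s = count (?M hi) (m, r - int m)"
    proof -
      have "s = g (m, r - int m)" by (simp add: s g_def)
      then show ?thesis using count_image_mset_inject[OF g(1)] by metis
    qed
    moreover have "count (?M' hi) s = count (?M hi) (m, r - int m)"
    proof (cases "m = 0")
      case True
      then have "(0, J) \<notin># ?M hi" "(0, J) \<notin># ?M' hi" for J
        using C by (auto simp: coupled_def seating_def) 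
      then show ?thesis by (simp add: s True not_in_iff)
    next
      case False
      then show ?thesis using C by (simp add: coupled_def W s)
    qed
    ultimately show "count (?M' hi) s = count (image_mset g (?M hi)) s" by simp
  qed
  then have sl: "sorted_list_of_multiset (?M' hi) = map g (sorted_list_of_multiset (?M hi))"
    using sorted_list_of_multiset_image_mono[of "?M hi" g] g(2) by (auto simp: mono_on_def mono_def)
  have "{x. b x = 1} \<subseteq> {lo..hi}"
    using lo hi0 by (auto simp: hi_def) (metis linear max.coboundedI2 zero_neq_one)+
  then have 1: "KKR b = (map fst (rev (sorted_list_of_multiset (?M hi))), map snd (rev (sorted_list_of_multiset (?M hi))))"
    by (rule KKR_eq_fold)
  have "{x. b' x = 1} \<subseteq> {lo..hi}"
  proof -
    have "b' x = 0" if "x \<le> lo" for x using lo[of x] lo[of "x - 1"] that by (simp add: b'_def)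
    moreover have "b' x = 0" if "x > hi" for x
      using hi0[of x] hi0[of "x - 1"] that by (simp add: b'_def hi_def)
    ultimately show ?thesis by (auto simp: not_le[symmetric]) (metis le_less_linear less_imp_le zero_neq_one)+
  qed
  then have 2: "KKR b' = (map fst (rev (sorted_list_of_multiset (?M' hi))), map snd (rev (sorted_list_of_multiset (?M' hi))))"
    by (rule KKR_eq_fold)
  define xs where "xs = rev (sorted_list_of_multiset (?M hi))"
  have "rev (sorted_list_of_multiset (?M' hi)) = map g xs" by (simp add: sl xs_def rev_map)
  then have "KKR b' = (map fst (map g xs), map snd (map g xs))" using 2 by (simp only:)
  moreover have "map fst (map g xs) = map fst xs" by (simp add: g_def case_prod_beta)
  moreover have "map snd (map g xs) = map2 (+) (map snd xs) (map int (map fst xs))"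
    by (induction xs) (auto simp: g_def)
  ultimately have "KKR b' = (mu, map2 (+) J (map int mu))"
    using 1 K by (simp only: xs_def[symmetric] prod.inject)
  then show ?thesis by (simp only: b'_def[abs_def])
qed

section \<open>Commutation with the cyclic RSK map\<close>

lemma fomin_field_squares:
  assumes "fomin_field n l X"
  obtains c where "fomin_square (X x y) (X (x + 1) y) (X x (y + 1)) (X (x + 1) (y + 1)) c"
  using assms fomin_square_rule[of "X x y" "X (x + 1) y" "X x (y + 1)"]
  unfolding fomin_field_def by metis

text \<open>Going up by one row of squares: columns left of \<open>i\<close> receive the same inputs
  as before, the two squares around column \<open>i\<close> pass the change on within that column
  and return the old right edge, and so the columns beyond \<open>i\<close> also receive the same
  inputs.\<close>

lemma raises_propagate:
  assumes X: "fomin_field n l X" and Y: "fomin_field n l Y" and i: "1 \<le> i" "i < n"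
    and bottom: "\<And>x. x \<le> n \<Longrightarrow> x \<noteq> i \<Longrightarrow> Y (int x) 0 = X (int x) 0"
    and left: "\<And>y. y \<le> n \<Longrightarrow> Y 0 (int y) = X 0 (int y)"
    and r: "raises (X (int i - 1) 0) (X (int i) 0) (X (int i + 1) 0) (Y (int i) 0)"
    and y: "y \<le> n"
  shows "(\<forall>x\<le>n. x \<noteq> i \<longrightarrow> Y (int x) (int y) = X (int x) (int y)) \<and>
    raises (X (int i - 1) (int y)) (X (int i) (int y)) (X (int i + 1) (int y)) (Y (int i) (int y))"
  using y
proof (induction y)
  case 0
  then show ?case using bottom r by simp
next
  case (Suc y)
  then have IH: "\<And>x. x \<le> n \<Longrightarrow> x \<noteq> i \<Longrightarrow> Y (int x) (int y) = X (int x) (int y)"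
    and IHr: "raises (X (int i - 1) (int y)) (X (int i) (int y)) (X (int i + 1) (int y)) (Y (int i) (int y))" by auto
  have rule: "Z (x + 1) (int (Suc y)) = fomin_rule (Z x (int y)) (Z (x + 1) (int y)) (Z x (int (Suc y)))"
    if "fomin_field n l Z" for Z x
    using that unfolding fomin_field_def of_nat_Suc by (metis add.commute)
  have low: "x < i \<Longrightarrow> Y (int x) (int (Suc y)) = X (int x) (int (Suc y))" for x
  proof (induction x)
    case 0
    then show ?case using left[of "Suc y"] Suc.prems by simp
  next
    case (Suc x)
    then show ?case using rule[OF X, of "int x"] rule[OF Y, of "int x"] IH[of x] IH[of "Suc x"] i
      by (simp add: add.commute)
  qed
  have i1: "int (i - 1) = int i - 1" using i by simp
  obtain c d c' d' where
    s: "fomin_square (X (int i - 1) (int y)) (X (int i) (int y)) (X (int i - 1) (int (Suc y))) (X (int i) (int (Suc y))) c"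
       "fomin_square (X (int i) (int y)) (X (int i + 1) (int y)) (X (int i) (int (Suc y))) (X (int i + 1) (int (Suc y))) d"
       "fomin_square (Y (int i - 1) (int y)) (Y (int i) (int y)) (Y (int i - 1) (int (Suc y))) (Y (int i) (int (Suc y))) c'"
       "fomin_square (Y (int i) (int y)) (Y (int i + 1) (int y)) (Y (int i) (int (Suc y))) (Y (int i + 1) (int (Suc y))) d'"
    using fomin_field_squares[OF X, of "int i - 1" "int y"] fomin_field_squares[OF X, of "int i" "int y"]
      fomin_field_squares[OF Y, of "int i - 1" "int y"] fomin_field_squares[OF Y, of "int i" "int y"]
    by (metis add.commute diff_add_cancel of_nat_Suc)
  have eqs: "Y (int i - 1) (int y) = X (int i - 1) (int y)" "Y (int i + 1) (int y) = X (int i + 1) (int y)"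
    "Y (int i - 1) (int (Suc y)) = X (int i - 1) (int (Suc y))"
    using IH[of "i - 1"] IH[of "Suc i"] low[of "i - 1"] i i1 by (auto simp: add.commute)
  have res: "Y (int i + 1) (int (Suc y)) = X (int i + 1) (int (Suc y)) \<and>
    raises (X (int i - 1) (int (Suc y))) (X (int i) (int (Suc y))) (X (int i + 1) (int (Suc y))) (Y (int i) (int (Suc y)))"
    using fomin_square_raises[OF IHr s(1,2) s(3,4)[unfolded eqs]] .
  have high: "i < x \<Longrightarrow> x \<le> n \<Longrightarrow> Y (int x) (int (Suc y)) = X (int x) (int (Suc y))" for x
  proof (induction x)
    case (Suc x)
    show ?case
    proof (cases "x = i")
      case True
      then show ?thesis using res by (simp add: add.commute)
    next
      case False
      then show ?thesis using Suc rule[OF X, of "int x"] rule[OF Y, of "int x"] IH[of x] IH[of "Suc x"]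
        by (simp add: add.commute)
    qed
  qed simp
  show ?case using low high res by (metis nat_neq_iff)
qed

section \<open>Translations acting on pairs\<close>

text \<open>An action of the integer translations. \<open>cRSK\<close>, \<open>iota1\<close> and
  \<open>iota2\<close> all belong to it, hence commute with each other and have explicit
  inverses.\<close>

definition shift :: "nat \<Rightarrow> int \<Rightarrow> int \<Rightarrow> tableau \<times> tableau \<Rightarrow> tableau \<times> tableau" where
  "shift n u v PQ = boundary n (translate u v (field_of n PQ))"

lemma cRSK_shift: "cRSK n = shift n (int n) 0" and iota1_shift: "iota1 n = shift n 1 0"
  and iota2_shift: "iota2 n = shift n 0 1"
  by (rule ext, simp add: shift_def cRSK_eq_boundary iota1_eq_boundary iota2_eq_boundary)+

lemma field_of_shift:
  assumes "tableau_pair n l PQ" "n \<ge> 1"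
  shows "field_of n (shift n u v PQ) = translate u v (field_of n PQ)"
  unfolding shift_def
  by (rule field_of_eq[OF fomin_field_translate[OF fomin_field_field_of(1)[OF assms]] refl assms(2)])

lemma tableau_pair_shift:
  assumes "tableau_pair n l PQ" "n \<ge> 1"
  shows "tableau_pair n l (shift n u v PQ)"
  unfolding shift_def
  by (rule fomin_field_tableau_pair[OF fomin_field_translate[OF fomin_field_field_of(1)[OF assms]]])

lemma shift_shift:
  assumes "tableau_pair n l PQ" "n \<ge> 1"
  shows "shift n u v (shift n u' v' PQ) = shift n (u + u') (v + v') PQ"
  using field_of_shift[OF assms] by (simp add: shift_def translate_translate)

lemma shift_0:
  assumes "tableau_pair n l PQ" "n \<ge> 1"
  shows "shift n 0 0 PQ = PQ"
  using fomin_field_field_of(2)[OF assms] by (simp add: shift_def translate_0)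

text \<open>Resolves the inverse in the definition of the index 0 operators: it is the translation
  by the opposite vector.\<close>

lemma inv_into_shift:
  assumes PQ: "tableau_pair n l PQ" and n: "n \<ge> 1"
  shows "inv_into (SST_pairs n) (shift n u v) PQ = shift n (- u) (- v) PQ"
proof (rule inv_into_f_eq)
  show "inj_on (shift n u v) (SST_pairs n)"
  proof (rule inj_onI)
    fix A B assume "A \<in> SST_pairs n" "B \<in> SST_pairs n" and eq: "shift n u v A = shift n u v B"
    then obtain l l' where "tableau_pair n l A" "tableau_pair n l' B" by (auto simp: SST_pairs_iff)
    then show "A = B"
      using shift_shift[OF _ n, of _ _ "- u" "- v" u v] shift_0[OF _ n] arg_cong[OF eq, of "shift n (- u) (- v)"]
      by (metis add.left_inverse)
  qed
  show "shift n (- u) (- v) PQ \<in> SST_pairs n" using tableau_pair_shift[OF PQ n] by (auto simp: SST_pairs_iff)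
  show "shift n u v (shift n (- u) (- v) PQ) = PQ"
    using shift_shift[OF PQ n, of u v "- u" "- v"] shift_0[OF PQ n] by simp
qed

text \<open>\<open>(n + i, 0)\<close> and \<open>(i, n)\<close> are the same point of the cylinder,
  so \<open>cRSK\<close> reads the top and right edges of the first block.\<close>

lemma cRSK_nth:
  assumes "fomin_field n l X" "field_of n PQ = X" "i \<le> n"
  shows "fst (cRSK n PQ) ! i = X (int i) (int n)" "snd (cRSK n PQ) ! i = X (int n) (int i)"
proof -
  have "X (int i + 1 * int n) (int n - 1 * int n) = X (int i) (int n)"
    using assms(1) unfolding fomin_field_def by blast
  then show "fst (cRSK n PQ) ! i = X (int i) (int n)" "snd (cRSK n PQ) ! i = X (int n) (int i)"
    using assms(2,3) by (simp_all add: cRSK_eq_boundary boundary_nth translate_def)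
qed

lemma tableau_pair_cRSK: "tableau_pair n l PQ \<Longrightarrow> n \<ge> 1 \<Longrightarrow> tableau_pair n l (cRSK n PQ)"
  by (simp add: cRSK_shift tableau_pair_shift)

lemma tableau_pair_swap: "tableau_pair n l (prod.swap PQ) \<longleftrightarrow> tableau_pair n l PQ"
  by (cases PQ) (auto simp: tableau_pair_iff)

lemma cRSK_swap:
  assumes PQ: "tableau_pair n l PQ" and n: "n \<ge> 1"
  shows "cRSK n (prod.swap PQ) = prod.swap (cRSK n PQ)"
proof -
  let ?X = "field_of n PQ" let ?Y = "\<lambda>x y. ?X y x"
  note X = fomin_field_field_of[OF PQ n]
  have Y: "fomin_field n l ?Y" by (rule fomin_field_transpose[OF X(1)])
  have "boundary n ?Y = prod.swap (boundary n ?X)" by (simp add: boundary_def)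
  then have fY: "field_of n (prod.swap PQ) = ?Y" using field_of_eq[OF Y _ n] X(2) by simp
  have "tableau_pair n l (cRSK n PQ)" "tableau_pair n l (cRSK n (prod.swap PQ))"
    using tableau_pair_cRSK[OF _ n] PQ by (simp_all add: tableau_pair_swap)
  then have len: "length (fst (cRSK n PQ)) = Suc n" "length (snd (cRSK n PQ)) = Suc n"
    "length (fst (cRSK n (prod.swap PQ))) = Suc n" "length (snd (cRSK n (prod.swap PQ))) = Suc n"
    by (auto simp: tableau_pair_def case_prod_beta)
  have "fst (cRSK n (prod.swap PQ)) = snd (cRSK n PQ)" "snd (cRSK n (prod.swap PQ)) = fst (cRSK n PQ)"
    by (rule nth_equalityI; simp add: len less_Suc_eq_le cRSK_nth[OF X(1) refl] cRSK_nth[OF Y fY])+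
  then show ?thesis by (simp add: prod_eq_iff)
qed

lemma raise_step_tableau_pair:
  assumes r: "raise_step i P P'" and i: "1 \<le> i" "i < n"
  shows "tableau_pair n l (P, Q) \<longleftrightarrow> tableau_pair n l (P', Q)"
proof (cases "length P = Suc n")
  case True
  have len: "length P' = Suc n" and same: "\<And>k. k \<le> n \<Longrightarrow> k \<noteq> i \<Longrightarrow> P' ! k = P ! k"
    and h: "P ! (i - 1) \<preceq>\<^sub>h P ! i" "P ! i \<preceq>\<^sub>h P ! Suc i" "P ! (i - 1) \<preceq>\<^sub>h P' ! i" "P' ! i \<preceq>\<^sub>h P ! Suc i"
    using r True by (auto simp: raise_step_def raises_def)
  have "semistandard n l P \<longleftrightarrow> semistandard n l P'"
  proof -
    have sig: "P ! k \<in> signatures l \<longleftrightarrow> P' ! k \<in> signatures l" if "k \<le> n" for k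
      using same[OF that] hstrip_signatures_iff[OF h(2), of l] hstrip_signatures_iff[OF h(4), of l]
        hstrip_length[OF h(2)] hstrip_length[OF h(4)] by (cases "k = i") auto
    have st: "P ! k \<preceq>\<^sub>h P ! Suc k \<longleftrightarrow> P' ! k \<preceq>\<^sub>h P' ! Suc k" if "k < n" for k
    proof -
      consider "k = i" | "Suc k = i" | "k \<noteq> i" "Suc k \<noteq> i" by blast
      then show ?thesis using same[of k] same[of "Suc k"] h that i by cases auto
    qed
    show ?thesis using True len sig st by (simp add: semistandard_def)
  qed
  then show ?thesis using same[of 0] same[of n] i by (simp add: tableau_pair_iff)
next
  case False
  then show ?thesis using r by (simp add: tableau_pair_def raise_step_def)
qed

text \<open>The change, propagated up to row \<open>n\<close>, is the change of the new first
  tableau. The new second tableau lies in column \<open>n\<close> of the field, which differs from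
  column \<open>i\<close>.\<close>

lemma raise_step_cRSK:
  assumes P: "tableau_pair n l (P, Q)" and P': "tableau_pair n l (P', Q)"
    and r: "raise_step i P P'" and i: "1 \<le> i" "i < n"
  shows "raise_step i (fst (cRSK n (P, Q))) (fst (cRSK n (P', Q)))"
    and "snd (cRSK n (P', Q)) = snd (cRSK n (P, Q))"
proof -
  have n: "n \<ge> 1" using i by simp
  let ?X = "field_of n (P, Q)" and ?Y = "field_of n (P', Q)"
  note X = fomin_field_field_of[OF P n] and Y = fomin_field_field_of[OF P' n]
  have bX: "?X (int k) 0 = P ! k" "?X 0 (int k) = Q ! k" and bY: "?Y (int k) 0 = P' ! k" "?Y 0 (int k) = Q ! k"
    if "k \<le> n" for k
    using boundary_nth(1,2)[OF that, of ?X] boundary_nth(1,2)[OF that, of ?Y] X(2) Y(2) by simp_all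
  have same: "\<And>k. k \<le> n \<Longrightarrow> k \<noteq> i \<Longrightarrow> P' ! k = P ! k" and ri: "raises (P ! (i - 1)) (P ! i) (P ! Suc i) (P' ! i)"
    using r P by (auto simp: raise_step_def tableau_pair_def)
  have i1: "int i - 1 = int (i - 1)" "int i + 1 = int (Suc i)" using i by auto
  have ends: "?X (int i - 1) 0 = P ! (i - 1)" "?X (int i + 1) 0 = P ! Suc i"
    unfolding i1 by (rule bX, use i in simp)+
  have column: "(\<forall>x\<le>n. x \<noteq> i \<longrightarrow> ?Y (int x) (int y) = ?X (int x) (int y)) \<and>
    raises (?X (int i - 1) (int y)) (?X (int i) (int y)) (?X (int i + 1) (int y)) (?Y (int i) (int y))" if "y \<le> n" for y
    by (rule raises_propagate[OF X(1) Y(1) i _ _ _ that])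
      (use bX bY same ri i ends in auto)
  have pairs: "tableau_pair n l (cRSK n (P, Q))" "tableau_pair n l (cRSK n (P', Q))"
    using tableau_pair_cRSK[OF P n] tableau_pair_cRSK[OF P' n] by auto
  then have lens: "length (fst (cRSK n (P, Q))) = Suc n" "length (fst (cRSK n (P', Q))) = Suc n"
     "length (snd (cRSK n (P, Q))) = Suc n" "length (snd (cRSK n (P', Q))) = Suc n"
    by (auto simp: tableau_pair_def case_prod_beta)
  note nX = cRSK_nth[OF X(1) refl] and nY = cRSK_nth[OF Y(1) refl]
  show "raise_step i (fst (cRSK n (P, Q))) (fst (cRSK n (P', Q)))"
    unfolding raise_step_def lens less_Suc_eq_le
    using column[OF order_refl] i by (auto simp: nX nY i1 simp del: of_nat_Suc)
  show "snd (cRSK n (P', Q)) = snd (cRSK n (P, Q))"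
    using column i by (auto simp: list_eq_iff_nth_eq lens less_Suc_eq_le nX nY)
qed

text \<open>A successful \<open>e_i\<close> forces \<open>i < n\<close>, whereas for
  \<open>f_i\<close> the bound has to be assumed. Allowing all \<open>E\<close> admits
  \<open>E 1\<close> at \<open>n = 1\<close>, through which the index 0 operator is defined.\<close>

lemma act_P_cRSK:
  assumes PQ: "tableau_pair n l PQ" and n: "n \<ge> 1" and k: "k \<in> range E \<union> F ` {..<n}" "1 \<le> kindex k"
    and act: "act_P n k PQ = Some PQ'"
  shows "tableau_pair n l PQ' \<and> act_P n k (cRSK n PQ) = Some (cRSK n PQ')"
proof -
  obtain P Q where PQ_eq: "PQ = (P, Q)" by (cases PQ)
  then obtain P' where P': "act_skew n k P = Some P'" "PQ' = (P', Q)" using act by (auto simp: act_P_def)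
  have ss: "semistandard n l P" using PQ by (simp add: PQ_eq tableau_pair_iff)
  define i where "i = kindex k"
  obtain i_less: "i < n" and r: "k = E i \<and> raise_step i P P' \<or> k = F i \<and> raise_step i P' P"
    using k P'(1) act_skew_E_iff[OF ss] act_skew_F_iff[OF ss] by (cases k) (auto simp: i_def)
  have i1: "1 \<le> i" using k by (simp add: i_def)
  have PQ': "tableau_pair n l (P', Q)"
    using r raise_step_tableau_pair[OF _ i1 i_less] PQ unfolding PQ_eq by blast
  define P1 Q1 P1' Q1' where "P1 = fst (cRSK n (P, Q))" and "Q1 = snd (cRSK n (P, Q))"
    and "P1' = fst (cRSK n (P', Q))" and "Q1' = snd (cRSK n (P', Q))"
  then have pairs: "cRSK n (P, Q) = (P1, Q1)" "cRSK n (P', Q) = (P1', Q1')" by simp_all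
  have "Q1' = Q1 \<and> (k = E i \<and> raise_step i P1 P1' \<or> k = F i \<and> raise_step i P1' P1)"
    using r raise_step_cRSK[OF _ _ _ i1 i_less] PQ PQ' unfolding PQ_eq P1_def P1'_def Q1_def Q1'_def by metis
  moreover have "semistandard n l P1"
    using tableau_pair_cRSK[OF PQ n] by (simp add: PQ_eq pairs tableau_pair_iff)
  ultimately have "act_skew n k P1 = Some P1'" "Q1' = Q1"
    using act_skew_E_iff i1 i_less act_skew_F_iff by blast+
  then show ?thesis using PQ' by (simp add: act_P_def PQ_eq P'(2) pairs)
qed

lemma act_Q_swap: "act_Q n k PQ = map_option prod.swap (act_P n k (prod.swap PQ))"
  by (cases PQ) (simp add: act_Q_def act_P_def option.map_comp o_def)

lemma act_Q_cRSK:
  assumes PQ: "tableau_pair n l PQ" and n: "n \<ge> 1" and k: "k \<in> range E \<union> F ` {..<n}" "1 \<le> kindex k"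
    and act: "act_Q n k PQ = Some PQ'"
  shows "tableau_pair n l PQ' \<and> act_Q n k (cRSK n PQ) = Some (cRSK n PQ')"
proof -
  have s: "tableau_pair n l (prod.swap PQ)" using PQ by (simp add: tableau_pair_swap)
  obtain R where R: "act_P n k (prod.swap PQ) = Some R" "PQ' = prod.swap R" using act by (auto simp: act_Q_swap)
  then have "tableau_pair n l R" "act_P n k (cRSK n (prod.swap PQ)) = Some (cRSK n R)"
    using act_P_cRSK[OF s n k] by auto
  then show ?thesis
    using cRSK_swap[OF PQ n] cRSK_swap[of n l R, OF _ n] R(2) by (simp add: act_Q_swap tableau_pair_swap)
qed

text \<open>For index 0 the operator is conjugated by a translation, and translations commute with
  \<open>cRSK\<close>; what remains is the commutation for index 1 at the translated pair.\<close>

lemma with_affine_cRSK: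
  assumes PQ: "tableau_pair n l PQ" and n: "n \<ge> 1" and k: "k \<in> insert (E 0) (classical n)"
    and act: "\<And>k PQ PQ'. tableau_pair n l PQ \<Longrightarrow> k \<in> range E \<union> F ` {..<n} \<Longrightarrow> 1 \<le> kindex k \<Longrightarrow>
      act k PQ = Some PQ' \<Longrightarrow> tableau_pair n l PQ' \<and> act k (cRSK n PQ) = Some (cRSK n PQ')"
    and run: "with_affine n (shift n u v) act k PQ = Some PQ'"
  shows "tableau_pair n l PQ' \<and> with_affine n (shift n u v) act k (cRSK n PQ) = Some (cRSK n PQ')"
proof (cases "k = E 0")
  case True
  let ?Z = "shift n (- u) (- v) PQ"
  have Z: "tableau_pair n l ?Z" by (rule tableau_pair_shift[OF PQ n])
  obtain R where R: "act (E 1) ?Z = Some R" "PQ' = shift n u v R"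
    using run by (auto simp: True with_affine_def inv_into_shift[OF PQ n])
  have R': "tableau_pair n l R" "act (E 1) (cRSK n ?Z) = Some (cRSK n R)" using act[OF Z _ _ R(1)] by auto
  have "inv_into (SST_pairs n) (shift n u v) (cRSK n PQ) = cRSK n ?Z"
    using inv_into_shift[OF tableau_pair_cRSK[OF PQ n] n] shift_shift[OF PQ n] by (simp add: cRSK_shift algebra_simps)
  moreover have "shift n u v (cRSK n R) = cRSK n PQ'"
    using shift_shift[OF R'(1) n] by (simp add: cRSK_shift R(2) algebra_simps)
  ultimately show ?thesis using R' tableau_pair_shift[OF R'(1) n] R(2) by (simp add: True with_affine_def)
next
  case False
  then have k': "k \<in> range E \<union> F ` {..<n}" "1 \<le> kindex k" using k by (auto simp: classical_def)
  then have "with_affine n (shift n u v) act k X = act k X" for X by (cases k) (auto simp: with_affine_def)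
  then show ?thesis using act[OF PQ k'] run by simp
qed

lemma act1_cRSK:
  assumes "tableau_pair n l PQ" "n \<ge> 1" "k \<in> insert (E 0) (classical n)" "act1 n k PQ = Some PQ'"
  shows "tableau_pair n l PQ' \<and> act1 n k (cRSK n PQ) = Some (cRSK n PQ')"
  unfolding act1_def iota1_shift
proof (rule with_affine_cRSK[OF assms(1-3)])
  show "with_affine n (shift n 1 0) (act_P n) k PQ = Some PQ'"
    using assms(4) by (simp add: act1_def iota1_shift)
qed (rule act_P_cRSK[OF _ assms(2)])

lemma act2_cRSK:
  assumes "tableau_pair n l PQ" "n \<ge> 1" "k \<in> insert (E 0) (classical n)" "act2 n k PQ = Some PQ'"
  shows "tableau_pair n l PQ' \<and> act2 n k (cRSK n PQ) = Some (cRSK n PQ')"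
  unfolding act2_def iota2_shift
proof (rule with_affine_cRSK[OF assms(1-3)])
  show "with_affine n (shift n 0 1) (act_Q n) k PQ = Some PQ'"
    using assms(4) by (simp add: act2_def iota2_shift)
qed (rule act_Q_cRSK[OF _ assms(2)])

lemma run_commute:
  assumes "\<And>k s s'. I s \<Longrightarrow> k \<in> set L \<Longrightarrow> act k s = Some s' \<Longrightarrow> I s' \<and> act k (C s) = Some (C s')"
    and "I s" "run act L s = Some s'"
  shows "I s' \<and> run act L (C s) = Some (C s')"
  using assms
proof (induction L arbitrary: s)
  case (Cons k L)
  obtain s1 where s1: "act k s = Some s1" "run act L s1 = Some s'"
    using Cons.prems(3) by (auto split: bind_splits)
  have c: "I s1" "act k (C s) = Some (C s1)" using Cons.prems(1)[OF Cons.prems(2) _ s1(1)] by auto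
  have "I s' \<and> run act L (C s1) = Some (C s')"
    by (rule Cons.IH[OF _ c(1) s1(2)]) (use Cons.prems(1) in auto)
  then show ?case using c by simp
qed simp

lemma leading_path_set: "is_leading_path n H L \<Longrightarrow> set L \<subseteq> insert (E 0) (classical n)"
  by (induction rule: is_leading_path.induct) (auto simp: classical_def)

text \<open>The path chosen by \<open>SOME\<close> depends on the tableau alone, so both pairs run
  the same list; about this list only the operators occurring in it matter.\<close>

lemma leading_path_set': "leading_path n H = Some L \<Longrightarrow> set L \<subseteq> insert (E 0) (classical n)"
  unfolding leading_path_def by (metis leading_path_set option.distinct(1) option.inject someI_ex)

section \<open>Enlarging the alphabet\<close>

lemma extend_alphabet_nth:
  assumes "length P = Suc n" "n \<le> n'"
  shows "length (extend_alphabet n' P) = Suc n'" "i \<le> n' \<Longrightarrow> extend_alphabet n' P ! i = P ! min i n"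
proof -
  have "last P = P ! n" using assms(1) by (cases P rule: rev_cases) (auto simp: nth_append)
  then show "length (extend_alphabet n' P) = Suc n'" "i \<le> n' \<Longrightarrow> extend_alphabet n' P ! i = P ! min i n"
    using assms by (auto simp: extend_alphabet_def nth_append min_def)
qed

text \<open>The enlarged pair may live on a wider cylinder, so the two fields are compared on the
  first block only. There the enlarged one repeats the last row and column of the old one, and
  \<open>cRSK\<close> depends on nothing else.\<close>

lemma fomin_field_extend:
  assumes PQ: "tableau_pair n l PQ" and n: "n \<ge> 1" "n \<le> n'"
  defines "PQ' \<equiv> map_prod (extend_alphabet n') (extend_alphabet n') PQ"
  shows "tableau_pair n' l PQ'" and "cRSK n' PQ' = map_prod (extend_alphabet n') (extend_alphabet n') (cRSK n PQ)"
proof -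
  obtain P Q where PQ_eq: "PQ = (P, Q)" by (cases PQ)
  have len: "length P = Suc n" "length Q = Suc n" using PQ by (auto simp: PQ_eq tableau_pair_def)
  have hrefl: "lam \<in> signatures l \<Longrightarrow> lam \<preceq>\<^sub>h lam" for lam by (simp add: hstrip_iff)
  note ext = extend_alphabet_nth[OF len(1) n(2)] extend_alphabet_nth[OF len(2) n(2)]
  show pair: "tableau_pair n' l PQ'"
    unfolding PQ'_def PQ_eq tableau_pair_def map_prod_simp case_prod_conv
    using PQ n ext hrefl unfolding PQ_eq tableau_pair_def by (auto simp: min_def not_le Suc_le_eq)
  let ?X = "field_of n PQ"
  note X = fomin_field_field_of[OF PQ n(1)]
  have n': "n' \<ge> 1" using n by simp
  note Y = fomin_field_field_of[OF pair n']
  \<comment> \<open>Truncating both coordinates at \<open>n\<close> expresses this repetition; each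
    square beyond \<open>n\<close> has a trivial side and satisfies the rule for that
    reason.\<close>
  define G where "G x y = ?X (int (min x n)) (int (min y n))" for x y
  have sigX: "?X x y \<in> signatures l" and hX: "?X x y \<preceq>\<^sub>h ?X (x + 1) y" "?X x y \<preceq>\<^sub>h ?X x (y + 1)"
    and ruleX: "?X (x + 1) (y + 1) = fomin_rule (?X x y) (?X (x + 1) y) (?X x (y + 1))" for x y
    using X(1) unfolding fomin_field_def by blast+
  have G1: "G x y \<preceq>\<^sub>h G (Suc x) y" "G x y \<preceq>\<^sub>h G x (Suc y)" for x y
  proof -
    show "G x y \<preceq>\<^sub>h G (Suc x) y"
    proof (cases "x < n")
      case True
      then show ?thesis using hX(1)[of "int x"] by (simp add: G_def min_def add.commute[of 1])
    next
      case False
      then have "G (Suc x) y = G x y" by (simp add: G_def)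
      then show ?thesis using hrefl[OF sigX] by (simp add: G_def)
    qed
    show "G x y \<preceq>\<^sub>h G x (Suc y)"
    proof (cases "y < n")
      case True
      then show ?thesis using hX(2)[of _ "int y"] by (simp add: G_def min_def add.commute[of 1])
    next
      case False
      then have "G x (Suc y) = G x y" by (simp add: G_def)
      then show ?thesis using hrefl[OF sigX] by (simp add: G_def)
    qed
  qed
  have "G (Suc x) (Suc y) = fomin_rule (G x y) (G (Suc x) y) (G x (Suc y))" for x y
  proof -
    consider "x < n" "y < n" | "n \<le> x" | "n \<le> y" by linarith
    then show ?thesis
    proof cases
      case 1
      then show ?thesis using ruleX[of "int x" "int y"] by (simp add: G_def min_def add.commute[of 1])
    next
      case 2
      then have "G (Suc x) y = G x y" "G (Suc x) (Suc y) = G x (Suc y)" by (simp_all add: G_def)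
      then show ?thesis using fomin_rule_triv[OF G1(2)[of x y]]
          fomin_rule_commute[of "G x y" "G x y" "G x (Suc y)"] G1[of x y] by simp
    next
      case 3
      then have "G x (Suc y) = G x y" "G (Suc x) (Suc y) = G (Suc x) y" by (simp_all add: G_def)
      then show ?thesis using fomin_rule_triv[OF G1(1)[of x y]] by simp
    qed
  qed
  then have grid: "grid n' G" using G1 by (simp add: grid_def)
  have bX: "?X (int k) 0 = P ! k" "?X 0 (int k) = Q ! k" if "k \<le> n" for k
    using boundary_nth(1,2)[OF that, of ?X] X(2) by (simp_all add: PQ_eq)
  have Yeq: "field_of n' PQ' (int x) (int y) = G x y" if "x \<le> n'" "y \<le> n'" for x y
  proof -
    have "fst PQ' ! i = G i 0" "snd PQ' ! i = G 0 i" if "i \<le> n'" for i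
      using bX[of "min i n"] ext that by (simp_all add: PQ'_def PQ_eq G_def)
    then show ?thesis
      using fomin_field_block(1)[OF Y(1) that] grid_eq_grow[OF grid, of "nth (fst PQ')" "nth (snd PQ')", OF _ _ that]
      unfolding Y(2) by simp
  qed
  have pairs: "tableau_pair n l (cRSK n PQ)" "tableau_pair n' l (cRSK n' PQ')"
    using tableau_pair_cRSK[OF PQ n(1)] tableau_pair_cRSK[OF pair n'] by auto
  obtain A B where AB: "cRSK n PQ = (A, B)" by (cases "cRSK n PQ")
  obtain A' B' where AB': "cRSK n' PQ' = (A', B')" by (cases "cRSK n' PQ'")
  have lens: "length A = Suc n" "length B = Suc n" "length A' = Suc n'" "length B' = Suc n'"
    using pairs by (auto simp: AB AB' tableau_pair_def)
  have "A' ! i = A ! min i n" "B' ! i = B ! min i n" if "i \<le> n'" for i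
    using cRSK_nth[OF Y(1) refl that] cRSK_nth[OF X(1) refl, of "min i n"] Yeq[OF that order_refl] Yeq[OF order_refl that] n(2)
    by (simp_all add: AB AB' G_def)
  then show "cRSK n' PQ' = map_prod (extend_alphabet n') (extend_alphabet n') (cRSK n PQ)"
    using extend_alphabet_nth[OF lens(1) n(2)] extend_alphabet_nth[OF lens(2) n(2)] lens
    by (simp add: AB AB' list_eq_iff_nth_eq less_Suc_eq_le)
qed

section \<open>Quantities preserved by the time step\<close>

text \<open>Both sequences converge to the same points, if any, so the two definite descriptions
  coincide.\<close>

lemma lim_offset: "lim (\<lambda>t. f (t + k)) = lim (f :: nat \<Rightarrow> 'a :: t2_space)"
  unfolding lim_def by (metis LIMSEQ_ignore_initial_segment LIMSEQ_offset)

text \<open>Translation by \<open>(n, 0)\<close> is a delay of the time \<open>t\<close> by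
  \<open>n\<close> in both limits: directly for the second tableau, and through the periodicity for
  the first.\<close>

lemma soliton_data_cRSK:
  assumes PQ: "tableau_pair n l PQ" and n: "n \<ge> 1"
  shows "soliton_data n (cRSK n PQ) = soliton_data n PQ"
proof -
  let ?X = "field_of n PQ"
  note X = fomin_field_field_of(1)[OF PQ n]
  have per: "?X (x + int n) y = ?X x (y + int n)" for x y
  proof -
    have "?X (x + 1 * int n) (y + int n - 1 * int n) = ?X x (y + int n)"
      using X unfolding fomin_field_def by blast
    then show ?thesis by simp
  qed
  have l: "length (fst (cRSK n PQ) ! 0) = length (fst PQ ! 0)"
    using PQ tableau_pair_cRSK[OF PQ n] by (auto simp: tableau_pair_def case_prod_beta signatures_def)
  have "lim (\<lambda>t. ?X (int i + int n) (int t) ! j - ?X (int i - 1 + int n) (int t) ! j)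
      = lim (\<lambda>t. ?X (int i) (int t) ! j - ?X (int i - 1) (int t) ! j)" for i j
    using lim_offset[of "\<lambda>t. ?X (int i) (int t) ! j - ?X (int i - 1) (int t) ! j" n] by (simp add: per)
  moreover have "lim (\<lambda>t. ?X (int t + int n) (int i) ! j - ?X (int t + int n) (int i - 1) ! j)
      = lim (\<lambda>t. ?X (int t) (int i) ! j - ?X (int t) (int i - 1) ! j)" for i j
    using lim_offset[of "\<lambda>t. ?X (int t) (int i) ! j - ?X (int t) (int i - 1) ! j" n] by simp
  ultimately show ?thesis
    using field_of_shift[OF PQ n, of "int n" 0]
    unfolding soliton_data_def l by (simp add: cRSK_shift Let_def translate_def)
qed

lemma count_signature:
  "int (count (mset lam) j) = conjugate lam j - conjugate lam (j + 1)"
proof -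
  have "{k. k < length lam \<and> j \<le> lam ! k} = {k. k < length lam \<and> lam ! k = j} \<union> {k. k < length lam \<and> j + 1 \<le> lam ! k}"
    by auto
  then have "card {k. k < length lam \<and> j \<le> lam ! k}
      = card ({k. k < length lam \<and> lam ! k = j} \<union> {k. k < length lam \<and> j + 1 \<le> lam ! k})"
    by (rule arg_cong)
  also have "\<dots> = card {k. k < length lam \<and> lam ! k = j} + card {k. k < length lam \<and> j + 1 \<le> lam ! k}"
    by (rule card_Un_disjoint) auto
  finally have "card {k. k < length lam \<and> j \<le> lam ! k}
      = card {k. k < length lam \<and> lam ! k = j} + card {k. k < length lam \<and> j + 1 \<le> lam ! k}" .
  moreover have "count (mset lam) j = card {k. k < length lam \<and> lam ! k = j}"
    unfolding count_mset count_list_eq_length_filter length_filter_conv_card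
    by (rule arg_cong[of _ _ card]) auto
  ultimately show ?thesis by (simp add: conjugate_def)
qed

text \<open>The multiplicity of \<open>j\<close> in \<open>lam\<close> is that in \<open>rho\<close>
  plus \<open>b j - b (j + 1)\<close>. It exceeds the old one by 1 exactly at a pattern 10, where
  the new residual removes \<open>j\<close>, and falls short by 1 exactly at a pattern 01, where the
  old residual removes it.\<close>

lemma residual_evolution:
  assumes h: "rho \<preceq>\<^sub>h lam" and c: "is_carry (\<lambda>x. ball_state rho lam x + ball_state rho lam x) c"
    and b': "\<And>x. b' x = ball_state rho lam x + c (x - 1) - c x"
  shows "residual lam b' = residual rho (ball_state rho lam)"
proof -
  let ?b = "ball_state rho lam"
  have bits: "?b x = 0 \<or> ?b x = 1" for x using hstrip_bits[OF h, of x] by (auto simp: ball_state_def)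
  note crec = is_carry_rec[OF c] and c0 = is_carry_nonneg[OF c]
  let ?A = "{j. ?b j = 0 \<and> ?b (j + 1) = 1}" and ?A' = "{j. b' j = 0 \<and> b' (j + 1) = 1}"
  have A': "?A' = {j. ?b j = 1 \<and> ?b (j + 1) = 0}"
  proof -
    \<comment> \<open>The new state has a ball exactly at the empty sites reached with a nonzero
      carry. If \<open>b' j = 0\<close> while \<open>c j > 0\<close>, the carry was increased at
      \<open>j\<close>, so \<open>b j = 1\<close>.\<close>
    have "b' j = 0 \<and> b' (j + 1) = 1 \<longleftrightarrow> ?b j = 1 \<and> ?b (j + 1) = 0" for j
      using bits[of j] bits[of "j + 1"] crec[of j] crec[of "j + 1"] c0[of "j - 1"] c0[of j]
      unfolding b' by (auto simp: max_def split: if_splits)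
    then show ?thesis by blast
  qed
  have fin: "finite {j. ?b j = 1}"
  proof -
    obtain N1 N2 where N: "\<And>x. x \<le> N1 \<Longrightarrow> ?b x = 0" "\<And>x. x \<ge> N2 \<Longrightarrow> ?b x = 0"
      using hstrip_eventually[OF h] by (auto simp: ball_state_def eventually_at_bot_linorder eventually_at_top_linorder)
    have "{j. ?b j = 1} \<subseteq> {N1..N2}" using N by (auto simp: not_le[symmetric]) (metis linear zero_neq_one)+
    then show ?thesis by (rule finite_subset) simp
  qed
  have ic: "int (count (mset lam) j) = int (count (mset rho) j) + ?b j - ?b (j + 1)" for j
    by (simp add: count_signature ball_state_def)
  have "finite ?A'" unfolding A' by (rule finite_subset[OF _ fin]) auto
  moreover have "?A \<subseteq> (\<lambda>x. x - 1) ` {j. ?b j = 1}" by force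
  then have "finite ?A" using fin finite_subset by blast
  ultimately have cnt: "count (mset lam) j - count (mset_set ?A') j = count (mset rho) j - count (mset_set ?A) j" for j
    unfolding A' by (cases rule: disjE[OF bits[of j]]; cases rule: disjE[OF bits[of "j + 1"]]) (use ic[of j] in \<open>simp_all add: count_mset_set'\<close>)
  then have "mset lam - mset_set ?A' = mset rho - mset_set ?A"
    by (intro multiset_eqI) (simp only: count_diff)
  then show ?thesis by (simp add: residual_def)
qed


text \<open>The block takes three values only: \<open>T ! 0\<close> at the corner,
  \<open>lam\<close> on the rest of the two axes and \<open>nu\<close> elsewhere. One square is
  proper; all others have a trivial side.\<close>

lemma cRSK_one_letter:
  assumes T: "tableau_pair n l (T, T)" and n: "n \<ge> 1" and const: "\<And>i. i \<in> {1..n} \<Longrightarrow> T ! i = lam"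
  defines "nu \<equiv> fomin_rule (T ! 0) lam lam"
  shows "cRSK n (T, T) = (lam # replicate n nu, lam # replicate n nu)"
proof -
  note X = fomin_field_field_of[OF T n]
  let ?X = "field_of n (T, T)"
  have T1: "T ! 1 = lam" using const n by simp
  have h: "T ! 0 \<preceq>\<^sub>h lam" using T n T1 by (auto simp: tableau_pair_def)
  obtain c where c: "fomin_square (T ! 0) lam lam nu c" using fomin_square_rule[OF h h] unfolding nu_def .
  then have h': "lam \<preceq>\<^sub>h nu" "lam \<preceq>\<^sub>h lam" "nu \<preceq>\<^sub>h nu"
    using hstrip_signatures[of lam nu] hstrip_iff by (auto simp: fomin_square_def)
  define G where "G x y = (if x = 0 \<and> y = 0 then T ! 0 else if x = 0 \<or> y = 0 then lam else nu)" for x y :: nat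
  have "fomin_rule lam lam nu = nu" "fomin_rule lam nu lam = nu" "fomin_rule nu nu nu = nu"
    using fomin_rule_triv[OF h'(1)] fomin_rule_triv[OF h'(3)] fomin_rule_commute[OF h'(1,2)] by simp_all
  then have grid: "grid n G" unfolding grid_def G_def using h h' by (auto simp: nu_def)
  have "T ! i = G i 0" "T ! i = G 0 i" if "i \<le> n" for i
    using const that by (auto simp: G_def)
  then have XG: "?X (int x) (int y) = G x y" if "x \<le> n" "y \<le> n" for x y
    using fomin_field_block(1)[OF X(1) that] grid_eq_grow[OF grid, of "nth T" "nth T", OF _ _ that]
    unfolding X(2) by simp
  have "length (fst (cRSK n (T, T))) = Suc n" "length (snd (cRSK n (T, T))) = Suc n"
    using tableau_pair_cRSK[OF T n] by (auto simp: tableau_pair_def case_prod_beta)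
  moreover have "fst (cRSK n (T, T)) ! i = (lam # replicate n nu) ! i"
    "snd (cRSK n (T, T)) ! i = (lam # replicate n nu) ! i" if "i \<le> n" for i
    using cRSK_nth[OF X(1) refl that] XG[OF that order_refl] XG[OF order_refl that] n that
    by (cases i; simp add: G_def)+
  ultimately show ?thesis by (auto simp: prod_eq_iff list_eq_iff_nth_eq less_Suc_eq_le)
qed

section \<open>Transporting a successful run\<close>

lemma Upsilon_col_SomeD:
  assumes "Upsilon_col n PQ = Some (H1, H2, kappa, nu)"
  obtains L1 L2 PQ1 T J where "soliton_data n PQ = (H1, H2)"
    "leading_path (max (length H1) n) H1 = Some L1" "leading_path (max (length H1) n) H2 = Some L2"
    "run (act1 (max (length H1) n)) L1 (map_prod (extend_alphabet (max (length H1) n)) (extend_alphabet (max (length H1) n)) PQ) = Some PQ1"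
    "run (act2 (max (length H1) n)) L2 PQ1 = Some (T, T)"
    "\<forall>i\<in>{1..max (length H1) n}. T ! i = T ! 1"
    "KKR (ball_state (T ! 0) (T ! 1)) = (map length H1, J)"
    "kappa = map2 (+) J (map int (map length H1))" "nu = residual (T ! 0) (ball_state (T ! 0) (T ! 1))"
proof -
  obtain A1 A2 where s: "soliton_data n PQ = (A1, A2)" by (cases "soliton_data n PQ")
  let ?m = "max (length A1) n"
  obtain L1 L2 PQ1 TT where L: "leading_path ?m A1 = Some L1" "leading_path ?m A2 = Some L2"
    and run: "run (act1 ?m) L1 (map_prod (extend_alphabet ?m) (extend_alphabet ?m) PQ) = Some PQ1"
      "run (act2 ?m) L2 PQ1 = Some TT"
    and rest: "(case TT of (T, T') \<Rightarrow> case KKR (ball_state (T ! 0) (T ! 1)) of (mu', J) \<Rightarrow>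
      if T = T' \<and> (\<forall>i\<in>{1..?m}. T ! i = T ! 1) \<and> mu' = map length A1
      then Some (A1, A2, map2 (+) J (map int (map length A1)), residual (T ! 0) (ball_state (T ! 0) (T ! 1)))
      else None) = Some (H1, H2, kappa, nu)"
    using assms unfolding Upsilon_col_def s Let_def prod.case length_map bind_eq_Some_conv by blast
  obtain T T' where TT: "TT = (T, T')" by (cases TT)
  obtain mu' J where K: "KKR (ball_state (T ! 0) (T ! 1)) = (mu', J)" by (cases "KKR (ball_state (T ! 0) (T ! 1))")
  have cond: "T = T' \<and> (\<forall>i\<in>{1..?m}. T ! i = T ! 1) \<and> mu' = map length A1"
    using rest unfolding TT prod.case K by (rule contrapos_pp) (simp only: if_False option.distinct not_False_eq_True)
  have "A1 = H1" "A2 = H2" "map2 (+) J (map int (map length A1)) = kappa"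
      "residual (T ! 0) (ball_state (T ! 0) (T ! 1)) = nu"
    using rest[unfolded TT prod.case K if_P[OF cond]] by auto
  then show thesis using that[OF _ _ _ _ _ _ _] s L run cond K TT by blast
qed

theorem corollary7p4:
  fixes n :: nat and P Q P' Q' :: tableau and H1 H2 :: hwt
    and kappa nu :: "int list" and mu :: "nat list"
  assumes "n \<ge> 1"
    and "(P, Q) \<in> SST_pairs n"
    and "(P', Q') = cRSK n (P, Q)"
    and "Upsilon_col n (P, Q) = Some (H1, H2, kappa, nu)"
    and "H1 \<in> HWT mu n" and "H2 \<in> HWT mu n"
  shows "Upsilon_col n (P', Q') = Some (H1, H2, map2 (+) kappa (map int mu), nu)"
proof -
  obtain l where PQ: "tableau_pair n l (P, Q)" using assms(2) by (auto simp: SST_pairs_iff)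
  have mu: "mu = map length H1" using assms(5) by (simp add: HWT_def)
  define n' where "n' = max (length H1) n"
  let ?ext = "map_prod (extend_alphabet n') (extend_alphabet n')"
  have n': "n \<le> n'" "n' \<ge> 1" using assms(1) by (auto simp: n'_def)
  obtain L1 L2 PQ1 T J where sol: "soliton_data n (P, Q) = (H1, H2)"
    and L: "leading_path n' H1 = Some L1" "leading_path n' H2 = Some L2"
    and run: "run (act1 n') L1 (?ext (P, Q)) = Some PQ1" "run (act2 n') L2 PQ1 = Some (T, T)"
    and const: "\<forall>i\<in>{1..n'}. T ! i = T ! 1"
    and kkr: "KKR (ball_state (T ! 0) (T ! 1)) = (mu, J)"
    and res: "kappa = map2 (+) J (map int mu)" "nu = residual (T ! 0) (ball_state (T ! 0) (T ! 1))"
    using Upsilon_col_SomeD[OF assms(4)] unfolding n'_def mu by metis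
  note ext = fomin_field_extend[OF PQ assms(1) n'(1)]
  have run1: "tableau_pair n' l PQ1 \<and> run (act1 n') L1 (cRSK n' (?ext (P, Q))) = Some (cRSK n' PQ1)"
    by (rule run_commute[where act = "act1 n'" and C = "cRSK n'" and I = "tableau_pair n' l", OF _ ext(1) run(1)])
      (use act1_cRSK[OF _ n'(2)] leading_path_set'[OF L(1)] in blast)
  then have run2: "tableau_pair n' l (T, T) \<and> run (act2 n') L2 (cRSK n' PQ1) = Some (cRSK n' (T, T))"
    by (intro run_commute[where act = "act2 n'" and C = "cRSK n'" and I = "tableau_pair n' l", OF _ _ run(2)])
      (use act2_cRSK[OF _ n'(2)] leading_path_set'[OF L(2)] in blast)+
  define lam nu1 where "lam = T ! 1" and "nu1 = fomin_rule (T ! 0) lam lam"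
  define S where "S = lam # replicate n' nu1"
  have ST: "cRSK n' (T, T) = (S, S)"
    using cRSK_one_letter[of n' l T lam] run2 n'(2) const unfolding S_def nu1_def lam_def by blast
  then have run2': "run (act2 n') L2 (cRSK n' PQ1) = Some (S, S)" using run2 by simp
  have S: "S ! 0 = lam" "S ! 1 = nu1" "\<forall>i\<in>{1..n'}. S ! i = nu1"
    using n'(2) by (auto simp: S_def nth_Cons')
  have h: "T ! 0 \<preceq>\<^sub>h lam" using run2 n'(2) by (auto simp: lam_def tableau_pair_def)
  let ?b = "ball_state (T ! 0) lam"
  obtain c where c: "fomin_square (T ! 0) lam lam nu1 c" using fomin_square_rule[OF h h] unfolding nu1_def .
  \<comment> \<open>Both input edges of the single proper square lead to \<open>lam\<close>, so
    their bits agree, and its carry is that of the box-ball system.\<close>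
  have carry: "is_carry (\<lambda>x. ?b x + ?b x) c" using c by (simp add: fomin_square_def ball_state_def)
  have b': "ball_state lam nu1 = (\<lambda>x. ?b x + c (x - 1) - c x)"
    using c by (simp add: fomin_square_def ball_state_def fun_eq_iff)
  have "KKR (ball_state lam nu1) = (mu, map2 (+) J (map int mu))"
    unfolding b' using KKR_evolution[OF _ carry _ _ kkr[folded lam_def]] hstrip_bits[OF h] hstrip_eventually[OF h]
    by (simp add: ball_state_def)
  moreover have "residual lam (ball_state lam nu1) = nu"
    using residual_evolution[OF h carry] b' res(2) by (simp add: lam_def)
  moreover have "soliton_data n (P', Q') = (H1, H2)" using soliton_data_cRSK[OF PQ assms(1)] sol assms(3) by simp
  moreover have "run (act1 n') L1 (?ext (P', Q')) = Some (cRSK n' PQ1)" using run1 ext(2) assms(3) by simp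
  ultimately show ?thesis
    using L run2' S res(1) unfolding Upsilon_col_def mu n'_def by (simp add: Let_def)
qed

end
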